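(* Consider the two-component system $\partial_t\vec u=L_\lambda\vec u+\vec g(\vec u)$ on $(0,\pi)$, where $L_\lambda$ and $\vec g$ satisfy all the standing assumptions listed in the context, with critical wavenumber $c$, critical parameter value $\lambda_0$, and transition numbers $\mathcal P_N=\mathcal S_N+\mathcal C_N$ ($N\ge 2$) as defined in the context. Let $\mathfrak m_{\mathtt m}$ be the lowest degree $k+l$ with $\vec a_{k,l}\neq\vec 0$, and suppose that the genericity condition $$\mathcal P_N\neq 0\quad\text{for some } 2\le N\le 2\mathfrak m_{\mathtt m}-1$$ holds. Then the critical index $\mathfrak m$ and the transition number $\mathcal P\ne 0$ in the truncated reduced equation $$\frac{du_{c,1}}{dt}=\beta_{c,1}u_{c,1}+\mathcal P\,u_{c,1}^{\mathfrak m}$$ (as defined in the context, i.e. the order and the coefficient of the leading nonlinear term of the center manifold reduction at $\lambda=\lambda_0$) are given by $$\mathfrak m=\min\{N\ge 2:\ \mathcal P_N\neq 0\},\qquad \mathcal P=\mathcal P_{\mathfrak m}.$$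
   Context: **System.** Unknown $\vec u=(u,v)^T$, functions of $x\in(0,\pi)$ and $t\ge 0$; $\lambda\in\mathbb R$ is a control parameter. $H=L^2(0,\pi)^2$ and $H_1\subset H_0^1(0,\pi)^2$ is the domain of $L_\lambda$. **Linear operator.** $L_\lambda$ is self-adjoint in $H$, sectorial, with compact resolvent. Its eigenvalues are real, $\{\beta_{m,n}=\beta_{m,n}(\lambda):m\in\mathbb Z_{\ge1},\,n\in\{1,2\}\}$, with eigenfunctions $\vec e_{m,n}=\vec\alpha_{m,n}\sin mx$, where $\vec\alpha_{m,n}=(\alpha_{m,n,1},\alpha_{m,n,2})^T\in\mathbb R^2$, $\|\vec\alpha_{m,n}\|=1$ and $\vec\alpha_{m,1}\perp\vec\alpha_{m,2}$. In particular $\beta_{m,n}\to-\infty$ as $m\to\infty$. ($L_\lambda$ need not be of second order.) **Principle of exchange of stabilities (PES).** There are $\lambda_0\in\mathbb R$ and a critical wavenumber $c\in\mathbb Z_{\ge1}$ such that $\beta_{c,1}(\lambda)<0$ for $\lambda<\lambda_0$, $\beta_{c,1}(\lambda_0)=0$, $\beta_{c,1}(\lambda)>0$ for $\lambda>\lambda_0$, and $\beta_{m,n}(\lambda_0)<0$ for all $(m,n)\neq(c,1)$. The critical mode is $\vec e_{c,1}=\vec\alpha_{c,1}\sin cx$. **Nonlinearity.** $\vec g(u,v)=\sum_{k+l\ge2,\;k,l\in\mathbb N_0}\vec a_{k,l}u^kv^l$ with $\vec a_{k,l}=(a_{k,l,1},a_{k,l,2})^T\in\mathbb R^2$ and $\limsup_{k+l\to\infty}\|\vec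 a_{k,l}\|^{1/(k+l)}<\infty$, so that $\vec g:H_1\to H$ is analytic near the origin. **Reduced equation, critical index, transition number.** On the center manifold one writes $\vec u=u_{c,1}\vec e_{c,1}+\vec\Phi$, where $\vec\Phi=\vec\Phi(u_{c,1})$ is the center manifold function, with values in the closed span of the modes $\vec e_{m,n}$, $(m,n)\neq(c,1)$, and $\vec\Phi=O(u_{c,1}^2)$ as $u_{c,1}\to0$ (the graph of $\vec\Phi$ is a locally invariant manifold; it is taken as smooth as needed). Projecting the system on the critical mode gives the scalar reduced equation $\frac{du_{c,1}}{dt}=\beta_{c,1}u_{c,1}+g_{c,1}(u_{c,1})$ with $$g_{c,1}(u_{c,1})=\frac{1}{\langle\vec e_{c,1},\vec e_{c,1}\rangle}\int_0^\pi\vec g\big(u_{c,1}\vec e_{c,1}+\vec\Phi(u_{c,1})\big)\cdot\vec e_{c,1}\,dx,\qquad \langle\vec e_{c,1},\vec e_{c,1}\rangle=\tfrac{\pi}{2}.$$ The critical index $\mathfrak m\in\mathbb Z_{\ge2}$ and the transition number $\mathcal P\ne0$ are those of the leading term at $\lambda=\lambda_0$: $g_{c,1}(u_{c,1})=\mathcal P u_{c,1}^{\mathfrak m}+O(u_{c,1}^{\mathfrak m+1})$ as $u_{c,1}\to0$. Keeping only this term gives the truncated reduced equation. **Conventions.** $\mathbb 1_A$ is the indicator function of the set $A$; $0^0=1$; a product having an explicit integer prefactor $k=0$ or $l=0$ is $0$; $\mathrm i$ is the imaginary unit; $B$ is the Beta function. In the numbers below $\beta_{m,n}$ and $\vec\alpha_{m,n}$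 are evaluated at $\lambda=\lambda_0$. **Self interaction number.** For $N\ge2$, $$\mathcal S_N=s_{N,c}\sum_{\substack{k+l=N\\0\le k,l\le N}}(\vec a_{k,l}\cdot\vec\alpha_{c,1})\,\alpha_{c,1,1}^k\,\alpha_{c,1,2}^l,\qquad s_{N,c}=\frac2\pi B\Big(\frac{N+2}2,\frac12\Big)\Big[\mathbb 1_{2\mathbb Z+1}(N)+\frac1c\,\mathbb 1_{2\mathbb Z}(N)\,\mathbb 1_{2\mathbb Z+1}(c)\Big].$$ **Cross interaction number.** For $N\ge2$, $$\mathcal C_N=\sum_{\delta\in\Lambda_N}\frac1{\beta_{m,n}}\,c_\delta\,(\vec a_{k,l}\cdot\vec\alpha_{c,1})(\vec a_{k',l'}\cdot\vec\alpha_{m,n}),$$ where $\Lambda_N$ is the set of $\delta=(N_1,N_2,k,l,k',l',m,n)\in\mathbb Z_{\ge0}^8$ with $N_1\ge2$, $N_2\ge2$, $N_1+N_2=N+1$, $k+l=N_1$, $k'+l'=N_2$, $m\ge1$, $n\in\{1,2\}$, $(m,n)\neq(c,1)$ (so $\Lambda_2=\emptyset$ and $\mathcal C_2=0$), $$c_\delta=-\frac4{\pi^2}\Big(k\,\alpha_{c,1,1}^{k+k'-1}\alpha_{c,1,2}^{l+l'}\alpha_{m,n,1}+l\,\alpha_{c,1,1}^{k+k'}\alpha_{c,1,2}^{l+l'-1}\alpha_{m,n,2}\Big)\mathcal J_{m,c}^{1,N_1}\mathcal J_{m,c}^{1,N_2},$$ and, with $\gamma_j=m+(N-2j)c$, $$\mathcal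 J_{m,c}^{1,N}=\frac1{(2\mathrm i)^{N+1}}\sum_{j=0}^N(-1)^j\binom Nj\Big[\mathbb 1_{\{0\}}(\gamma_j)\pi-\mathbb 1_{\{2m\}}(\gamma_j)\pi+\mathbb 1_{\mathbb Z\setminus\{0,2m\}}(\gamma_j)\frac{2m(1-(-1)^{\gamma_j})}{\mathrm i\gamma_j(\gamma_j-2m)}\Big],$$ which is the closed form of $\int_0^\pi\sin mx\,\sin^Ncx\,dx$. **$N$th transition number.** $\mathcal P_N=\mathcal S_N+\mathcal C_N$, $N\ge2$. *)

theory Defs
  imports "HOL-Analysis.Analysis" "HOL-Library.Landau_Symbols"
begin

section \<open>The Hilbert space \<open>L\<^sup>2(0,\<pi>)\<^sup>2\<close>\<close>

definition L2_funs :: "(real \<Rightarrow> real \<times> real) set" where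
  "L2_funs = {f. f \<in> borel_measurable (lebesgue_on {0<..<pi}) \<and>
                 integrable (lebesgue_on {0<..<pi}) (\<lambda>x. (norm (f x))\<^sup>2)}"

definition L2_eq :: "(real \<Rightarrow> real \<times> real) \<Rightarrow> (real \<Rightarrow> real \<times> real) \<Rightarrow> bool" where
  "L2_eq f g \<longleftrightarrow> f \<in> L2_funs \<and> g \<in> L2_funs \<and> (AE x in lebesgue_on {0<..<pi}. f x = g x)"

lemma L2_funs_zero: "(\<lambda>_. 0) \<in> L2_funs"
  by (simp add: L2_funs_def)

lemma L2_funs_scaleR:
  assumes "f \<in> L2_funs" shows "(\<lambda>x. r *\<^sub>R f x) \<in> L2_funs"
  using assms by (auto simp: L2_funs_def power_mult_distrib)

lemma L2_funs_add:
  assumes f: "f \<in> L2_funs" and g: "g \<in> L2_funs"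
  shows "(\<lambda>x. f x + g x) \<in> L2_funs"
proof -
  let ?M = "lebesgue_on {0<..<pi}"
  have [measurable]: "f \<in> borel_measurable ?M" "g \<in> borel_measurable ?M"
    using f g by (auto simp: L2_funs_def)
  have "integrable ?M (\<lambda>x. 2 * (norm (f x))\<^sup>2 + 2 * (norm (g x))\<^sup>2)"
    using f g by (auto simp: L2_funs_def)
  then have "integrable ?M (\<lambda>x. (norm (f x + g x))\<^sup>2)"
  proof (rule Bochner_Integration.integrable_bound)
    show "AE x in ?M. norm ((norm (f x + g x))\<^sup>2) \<le> norm (2 * (norm (f x))\<^sup>2 + 2 * (norm (g x))\<^sup>2)"
    proof (rule AE_I2)
      fix x
      have "(norm (f x + g x))\<^sup>2 \<le> (norm (f x) + norm (g x))\<^sup>2"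
        by (intro power_mono norm_triangle_ineq norm_ge_zero)
      also have "\<dots> \<le> 2 * (norm (f x))\<^sup>2 + 2 * (norm (g x))\<^sup>2"
        using zero_le_power2[of "norm (f x) - norm (g x)"]
        by (simp add: power2_sum power2_diff)
      finally show "norm ((norm (f x + g x))\<^sup>2) \<le> norm (2 * (norm (f x))\<^sup>2 + 2 * (norm (g x))\<^sup>2)"
        by simp
    qed
  qed simp
  then show ?thesis
    by (simp add: L2_funs_def)
qed

lemma L2_funs_integrable_inner:
  assumes f: "f \<in> L2_funs" and g: "g \<in> L2_funs"
  shows "integrable (lebesgue_on {0<..<pi}) (\<lambda>x. f x \<bullet> g x)"
proof -
  let ?M = "lebesgue_on {0<..<pi}"
  have [measurable]: "f \<in> borel_measurable ?M" "g \<in> borel_measurable ?M"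
    using f g by (auto simp: L2_funs_def)
  have "integrable ?M (\<lambda>x. (norm (f x))\<^sup>2 + (norm (g x))\<^sup>2)"
    using f g by (auto simp: L2_funs_def)
  then show ?thesis
  proof (rule Bochner_Integration.integrable_bound)
    show "AE x in ?M. norm (f x \<bullet> g x) \<le> norm ((norm (f x))\<^sup>2 + (norm (g x))\<^sup>2)"
    proof (rule AE_I2)
      fix x
      have "\<bar>f x \<bullet> g x\<bar> \<le> norm (f x) * norm (g x)"
        by (rule Cauchy_Schwarz_ineq2)
      also have "\<dots> \<le> (norm (f x))\<^sup>2 + (norm (g x))\<^sup>2"
        using zero_le_power2[of "norm (f x) - norm (g x)"]
          zero_le_power2[of "norm (f x)"] zero_le_power2[of "norm (g x)"]
          unfolding power2_diff by linarith
      finally show "norm (f x \<bullet> g x) \<le> norm ((norm (f x))\<^sup>2 + (norm (g x))\<^sup>2)"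
        by simp
    qed
  qed simp
qed

quotient_type L2 = "real \<Rightarrow> real \<times> real" / partial: L2_eq
  morphisms rep_L2 abs_L2
proof (rule part_equivpI)
  show "\<exists>x. L2_eq x x"
    using L2_funs_zero by (auto simp: L2_eq_def)
  show "symp L2_eq"
    by (rule sympI) (auto simp: L2_eq_def eq_commute)
  show "transp L2_eq"
    by (rule transpI) (auto simp: L2_eq_def elim: eventually_elim2)
qed

instantiation L2 :: real_vector
begin

lift_definition zero_L2 :: L2 is "\<lambda>_. 0"
  by (simp add: L2_eq_def L2_funs_zero)

lift_definition plus_L2 :: "L2 \<Rightarrow> L2 \<Rightarrow> L2" is "\<lambda>f g x. f x + g x"
  by (auto simp: L2_eq_def intro: L2_funs_add)

lift_definition scaleR_L2 :: "real \<Rightarrow> L2 \<Rightarrow> L2" is "\<lambda>r f x. r *\<^sub>R f x"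
  by (auto simp: L2_eq_def intro: L2_funs_scaleR)

definition uminus_L2 :: "L2 \<Rightarrow> L2" where "uminus_L2 u = (-1) *\<^sub>R u"

definition minus_L2 :: "L2 \<Rightarrow> L2 \<Rightarrow> L2" where "minus_L2 u v = u + - v"

instance
proof
  fix u v w :: L2 and r s :: real
  show "u + v + w = u + (v + w)"
    by transfer (auto simp: L2_eq_def add.assoc intro: L2_funs_add)
  show "u + v = v + u"
    by transfer (auto simp: L2_eq_def add.commute intro: L2_funs_add)
  show "0 + u = u"
    by transfer (auto simp: L2_eq_def)
  show "- u + u = 0"
    unfolding uminus_L2_def
    by transfer (auto simp: L2_eq_def L2_funs_zero)
  show "u - v = u + - v" by (simp add: minus_L2_def)
  show "r *\<^sub>R (u + v) = r *\<^sub>R u + r *\<^sub>R v"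
    by transfer (auto simp: L2_eq_def scaleR_add_right intro!: L2_funs_add L2_funs_scaleR)
  show "(r + s) *\<^sub>R u = r *\<^sub>R u + s *\<^sub>R u"
    by transfer (auto simp: L2_eq_def scaleR_add_left intro!: L2_funs_add L2_funs_scaleR)
  show "r *\<^sub>R s *\<^sub>R u = (r * s) *\<^sub>R u"
    by transfer (auto simp: L2_eq_def intro!: L2_funs_scaleR)
  show "1 *\<^sub>R u = u"
    by transfer (auto simp: L2_eq_def)
qed

end

instantiation L2 :: real_inner
begin

lift_definition inner_L2 :: "L2 \<Rightarrow> L2 \<Rightarrow> real" is
  "\<lambda>f g. \<integral>x. f x \<bullet> g x \<partial>lebesgue_on {0<..<pi}"
proof -
  fix f f' g g' assume "L2_eq f f'" "L2_eq g g'"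
  then have ae: "AE x in lebesgue_on {0<..<pi}. f x = f' x" "AE x in lebesgue_on {0<..<pi}. g x = g' x"
    and [measurable]: "f \<in> borel_measurable (lebesgue_on {0<..<pi})"
      "f' \<in> borel_measurable (lebesgue_on {0<..<pi})"
      "g \<in> borel_measurable (lebesgue_on {0<..<pi})"
      "g' \<in> borel_measurable (lebesgue_on {0<..<pi})"
    by (auto simp: L2_eq_def L2_funs_def)
  show "(\<integral>x. f x \<bullet> g x \<partial>lebesgue_on {0<..<pi}) = (\<integral>x. f' x \<bullet> g' x \<partial>lebesgue_on {0<..<pi})"
    by (rule integral_cong_AE) (use ae in \<open>auto elim: eventually_elim2\<close>)
qed

definition norm_L2 :: "L2 \<Rightarrow> real" where "norm_L2 u = sqrt (inner u u)"

definition sgn_L2 :: "L2 \<Rightarrow> L2" where "sgn_L2 u = u /\<^sub>R norm u"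

definition dist_L2 :: "L2 \<Rightarrow> L2 \<Rightarrow> real" where "dist_L2 u v = norm (u - v)"

definition uniformity_L2 :: "(L2 \<times> L2) filter" where
  "uniformity_L2 = (INF e\<in>{0 <..}. principal {(x, y). dist x y < e})"

definition open_L2 :: "L2 set \<Rightarrow> bool" where
  "open_L2 U = (\<forall>x\<in>U. eventually (\<lambda>(x', y). x' = x \<longrightarrow> y \<in> U) uniformity)"

instance
proof
  fix u v w :: L2 and r s :: real
  show "sgn u = u /\<^sub>R norm u" by (simp add: sgn_L2_def)
  show "dist u v = norm (u - v)" by (simp add: dist_L2_def)
  show "(uniformity :: (L2 \<times> L2) filter) = (INF e\<in>{0 <..}. principal {(x, y). dist x y < e})"
    by (simp add: uniformity_L2_def)
  show "open U = (\<forall>x\<in>U. eventually (\<lambda>(x', y). x' = x \<longrightarrow> y \<in> U) uniformity)" for U :: "L2 set"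
    by (simp add: open_L2_def)
  show "inner u v = inner v u"
    by transfer (simp add: inner_commute)
  show "inner (u + v) w = inner u w + inner v w"
    by transfer (simp add: inner_add_left L2_eq_def L2_funs_integrable_inner)
  show "inner (r *\<^sub>R u) v = r * inner u v"
    by transfer simp
  show "0 \<le> inner u u"
    by transfer simp
  show "inner u u = 0 \<longleftrightarrow> u = 0"
  proof transfer
    fix f assume "L2_eq f f"
    then have f: "f \<in> L2_funs" by (simp add: L2_eq_def)
    have "(\<integral>x. f x \<bullet> f x \<partial>lebesgue_on {0<..<pi}) = 0 \<longleftrightarrow>
        (AE x in lebesgue_on {0<..<pi}. f x \<bullet> f x = 0)"
      by (rule integral_nonneg_eq_0_iff_AE) (auto intro: L2_funs_integrable_inner f)
    then show "(\<integral>x. f x \<bullet> f x \<partial>lebesgue_on {0<..<pi}) = 0 \<longleftrightarrow> L2_eq f (\<lambda>_. 0)"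
      using f by (simp add: L2_eq_def L2_funs_zero)
  qed
  show "norm u = sqrt (inner u u)" by (simp add: norm_L2_def)
qed

end

text \<open>The class of a function; functions that are not square integrable are sent to \<open>0\<close>.\<close>
lift_definition L2_of :: "(real \<Rightarrow> real \<times> real) \<Rightarrow> L2" is
  "\<lambda>f. if f \<in> L2_funs then f else (\<lambda>_. 0)"
  by (simp add: L2_eq_def L2_funs_zero)


section \<open>The Sobolev space \<open>H\<^sub>0\<^sup>1(0,\<pi>)\<^sup>2\<close>\<close>

definition test_function :: "(real \<Rightarrow> real \<times> real) \<Rightarrow> bool" where
  "test_function f \<longleftrightarrow>
     (\<exists>D :: nat \<Rightarrow> real \<Rightarrow> real \<times> real. D 0 = f \<and>
        (\<forall>j x. (D j has_vector_derivative D (Suc j) x) (at x))) \<and>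
     (\<exists>a b. 0 < a \<and> b < pi \<and> (\<forall>x. x \<notin> {a..b} \<longrightarrow> f x = 0))"

text \<open>Closure of the test functions in the norm of \<open>H\<^sup>1\<close>; \<open>w\<close> is the weak derivative of \<open>u\<close>.\<close>
definition H01 :: "L2 set" where
  "H01 = {u. \<exists>w. \<exists>f :: nat \<Rightarrow> real \<Rightarrow> real \<times> real. (\<forall>i. test_function (f i)) \<and>
     (\<lambda>i. L2_of (f i)) \<longlonglongrightarrow> u \<and>
     (\<lambda>i. L2_of (\<lambda>x. vector_derivative (f i) (at x))) \<longlonglongrightarrow> w}"


section \<open>Unbounded operators\<close>

text \<open>An unbounded operator is given by its domain \<open>D\<close> and a total function \<open>A\<close>, of which only
  the values on \<open>D\<close> matter. The third conjunct below says that the graph of the adjoint is the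
  graph of the operator.\<close>
definition self_adjoint :: "'a::real_inner set \<Rightarrow> ('a \<Rightarrow> 'a) \<Rightarrow> bool" where
  "self_adjoint D A \<longleftrightarrow>
     subspace D \<and> closure D = UNIV \<and>
     (\<forall>u\<in>D. \<forall>v\<in>D. \<forall>r s. A (r *\<^sub>R u + s *\<^sub>R v) = r *\<^sub>R A u + s *\<^sub>R A v) \<and>
     (\<forall>u w. (\<forall>v\<in>D. inner u (A v) = inner w v) \<longleftrightarrow> u \<in> D \<and> w = A u)"

definition compact_resolvent :: "'a::real_normed_vector set \<Rightarrow> ('a \<Rightarrow> 'a) \<Rightarrow> bool" where
  "compact_resolvent D A \<longleftrightarrow>
     (\<exists>\<mu>::real. bij_betw (\<lambda>u. \<mu> *\<^sub>R u - A u) D UNIV \<and>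
        compact (closure (inv_into D (\<lambda>u. \<mu> *\<^sub>R u - A u) ` cball 0 1)))"

text \<open>The operator \<open>z - A\<close> on the complexification of the space, the pair \<open>(f, g)\<close> standing for
  \<open>f + \<i> g\<close>; the norm of the product type is the norm of the complexification.\<close>
definition complexified_shift :: "('a::real_normed_vector \<Rightarrow> 'a) \<Rightarrow> complex \<Rightarrow> 'a \<times> 'a \<Rightarrow> 'a \<times> 'a" where
  "complexified_shift A z = (\<lambda>(f, g).
     (Re z *\<^sub>R f - Im z *\<^sub>R g - A f, Im z *\<^sub>R f + Re z *\<^sub>R g - A g))"

text \<open>Sign convention: \<open>A\<close> generates an analytic semigroup, i.e.\ the sector contained in the
  resolvent set opens to the right.\<close>
definition sectorial :: "'a::real_normed_vector set \<Rightarrow> ('a \<Rightarrow> 'a) \<Rightarrow> bool" where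
  "sectorial D A \<longleftrightarrow>
     (\<exists>\<omega> \<theta> M :: real. pi / 2 < \<theta> \<and> \<theta> < pi \<and>
        (\<forall>z. z \<noteq> of_real \<omega> \<and> \<bar>Arg (z - of_real \<omega>)\<bar> < \<theta> \<longrightarrow>
           bij_betw (complexified_shift A z) (D \<times> D) UNIV \<and>
           (\<forall>w \<in> D \<times> D. norm w \<le> M / cmod (z - of_real \<omega>) * norm (complexified_shift A z w))))"


section \<open>Standing assumptions\<close>

definition mode :: "real \<times> real \<Rightarrow> nat \<Rightarrow> L2" where
  "mode \<alpha> m = L2_of (\<lambda>x. sin (real m * x) *\<^sub>R \<alpha>)"

definition linear_operator_assms ::
  "L2 set \<Rightarrow> (real \<Rightarrow> L2 \<Rightarrow> L2) \<Rightarrow> (real \<Rightarrow> nat \<Rightarrow> nat \<Rightarrow> real \<times> real) \<Rightarrow> (real \<Rightarrow> nat \<Rightarrow> nat \<Rightarrow> real) \<Rightarrow> bool"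
where
  "linear_operator_assms H1 L \<alpha> \<beta> \<longleftrightarrow>
     H1 \<subseteq> H01 \<and>
     (\<forall>lam. self_adjoint H1 (L lam) \<and> sectorial H1 (L lam) \<and> compact_resolvent H1 (L lam) \<and>
        {\<mu>. \<exists>u\<in>H1. u \<noteq> 0 \<and> L lam u = \<mu> *\<^sub>R u} = {\<beta> lam m n | m n. 1 \<le> m \<and> n \<in> {1, 2}} \<and>
        (\<forall>m\<ge>1. \<forall>n\<in>{1, 2}. norm (\<alpha> lam m n) = 1 \<and> mode (\<alpha> lam m n) m \<in> H1 \<and>
            L lam (mode (\<alpha> lam m n) m) = \<beta> lam m n *\<^sub>R mode (\<alpha> lam m n) m) \<and>
        (\<forall>m\<ge>1. \<alpha> lam m 1 \<bullet> \<alpha> lam m 2 = 0) \<and>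
        (\<forall>n\<in>{1, 2}. filterlim (\<lambda>m. \<beta> lam m n) at_bot sequentially))"

definition exchange_of_stabilities ::
  "(real \<Rightarrow> nat \<Rightarrow> nat \<Rightarrow> real) \<Rightarrow> real \<Rightarrow> nat \<Rightarrow> bool" where
  "exchange_of_stabilities \<beta> lam0 c \<longleftrightarrow>
     1 \<le> c \<and>
     (\<forall>lam<lam0. \<beta> lam c 1 < 0) \<and> \<beta> lam0 c 1 = 0 \<and> (\<forall>lam>lam0. \<beta> lam c 1 > 0) \<and>
     (\<forall>m\<ge>1. \<forall>n\<in>{1, 2}. (m, n) \<noteq> (c, 1) \<longrightarrow> \<beta> lam0 m n < 0)"

definition nonlinearity_assms :: "(nat \<Rightarrow> nat \<Rightarrow> real \<times> real) \<Rightarrow> bool" where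
  "nonlinearity_assms a \<longleftrightarrow>
     Limsup (filtercomap (\<lambda>(k, l). k + l) sequentially)
       (\<lambda>(k, l). ereal (root (k + l) (norm (a k l)))) < \<infinity>"

definition nonlinearity :: "(nat \<Rightarrow> nat \<Rightarrow> real \<times> real) \<Rightarrow> real \<times> real \<Rightarrow> real \<times> real" where
  "nonlinearity a = (\<lambda>(u, v). \<Sum>\<^sub>\<infinity>(k, l)\<in>{(k, l). 2 \<le> k + l}. (u ^ k * v ^ l) *\<^sub>R a k l)"

text \<open>The coefficients with \<open>k + l < 2\<close> do not occur in the nonlinearity.\<close>
definition lowest_degree :: "(nat \<Rightarrow> nat \<Rightarrow> real \<times> real) \<Rightarrow> nat" where
  "lowest_degree a = (LEAST d. 2 \<le> d \<and> (\<exists>k l. k + l = d \<and> a k l \<noteq> 0))"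

text \<open>The substitution operator. On \<open>H\<^sub>0\<^sup>1\<close> near the origin \<open>u\<close> is small in the sup norm, so the series
  converges and the result is bounded; elsewhere the value may be a default one.\<close>
definition substitution :: "(nat \<Rightarrow> nat \<Rightarrow> real \<times> real) \<Rightarrow> L2 \<Rightarrow> L2" where
  "substitution a u = L2_of (\<lambda>x. nonlinearity a (rep_L2 u x))"


section \<open>Center manifold reduction\<close>

definition solution_on ::
  "real \<Rightarrow> L2 set \<Rightarrow> (L2 \<Rightarrow> L2) \<Rightarrow> (nat \<Rightarrow> nat \<Rightarrow> real \<times> real) \<Rightarrow> (real \<Rightarrow> L2) \<Rightarrow> bool" where
  "solution_on T H1 A a u \<longleftrightarrow>
     (\<forall>t\<in>{0..<T}. u t \<in> H1 \<and>
        (u has_vector_derivative A (u t) + substitution a (u t)) (at t within {0..<T}))"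

definition locally_invariant ::
  "L2 set \<Rightarrow> L2 set \<Rightarrow> (L2 \<Rightarrow> L2) \<Rightarrow> (nat \<Rightarrow> nat \<Rightarrow> real \<times> real) \<Rightarrow> bool" where
  "locally_invariant S H1 A a \<longleftrightarrow>
     (\<forall>u0\<in>S. \<exists>T>0. \<exists>u. u 0 = u0 \<and> solution_on T H1 A a u \<and> (\<forall>t\<in>{0..<T}. u t \<in> S))"

text \<open>Curves of class \<open>C\<^sup>r\<close> on an open set \<open>S\<close>; \<open>D j\<close> is the \<open>j\<close>-th derivative.\<close>
definition C_curve_on :: "nat \<Rightarrow> real set \<Rightarrow> (real \<Rightarrow> 'a::real_normed_vector) \<Rightarrow> bool" where
  "C_curve_on r S F \<longleftrightarrow>
     (\<exists>D :: nat \<Rightarrow> real \<Rightarrow> 'a. D 0 = F \<and>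
        (\<forall>j<r. \<forall>s\<in>S. (D j has_vector_derivative D (Suc j) s) (at s)) \<and>
        continuous_on S (D r))"

text \<open>The domain \<open>H1\<close> carries the graph norm of \<open>A\<close>, i.e.\ the norm of \<open>(u, A u)\<close> in the product
  space; smoothness and the order of vanishing of \<open>\<Phi>\<close> are those of an \<open>H1\<close>-valued function.
  Class \<open>C\<^sup>2\<close> is asked for as the least smoothness; smoother center manifolds are a special case.
  Invariance is asked for forward in time only.\<close>
definition center_manifold_function ::
  "L2 set \<Rightarrow> (L2 \<Rightarrow> L2) \<Rightarrow> (nat \<Rightarrow> nat \<Rightarrow> real \<times> real) \<Rightarrow> (nat \<Rightarrow> nat \<Rightarrow> real \<times> real) \<Rightarrow> nat \<Rightarrow>
   (real \<Rightarrow> L2) \<Rightarrow> bool" where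
  "center_manifold_function H1 A \<alpha> a c \<Phi> \<longleftrightarrow>
     (\<exists>\<epsilon>>0.
        (\<forall>s\<in>{-\<epsilon><..<\<epsilon>}. \<Phi> s \<in> H1 \<and>
           \<Phi> s \<in> closure (span {mode (\<alpha> m n) m | m n. 1 \<le> m \<and> n \<in> {1, 2} \<and> (m, n) \<noteq> (c, 1)})) \<and>
        C_curve_on 2 {-\<epsilon><..<\<epsilon>} (\<lambda>s. (\<Phi> s, A (\<Phi> s))) \<and>
        (\<lambda>s. norm (\<Phi> s, A (\<Phi> s))) \<in> O[at 0](\<lambda>s. s\<^sup>2) \<and>
        locally_invariant ((\<lambda>s. s *\<^sub>R mode (\<alpha> c 1) c + \<Phi> s) ` {-\<epsilon><..<\<epsilon>}) H1 A a)"

definition reduced_nonlinearity ::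
  "(nat \<Rightarrow> nat \<Rightarrow> real \<times> real) \<Rightarrow> L2 \<Rightarrow> (real \<Rightarrow> L2) \<Rightarrow> real \<Rightarrow> real" where
  "reduced_nonlinearity a e \<Phi> s = 1 / inner e e * inner (substitution a (s *\<^sub>R e + \<Phi> s)) e"

text \<open>\<open>\<mm>\<close> is the critical index and \<open>P\<close> the transition number of the reduced equation with
  nonlinear part \<open>g\<close>.\<close>
definition leading_term :: "(real \<Rightarrow> real) \<Rightarrow> nat \<Rightarrow> real \<Rightarrow> bool" where
  "leading_term g \<mm> P \<longleftrightarrow>
     2 \<le> \<mm> \<and> P \<noteq> 0 \<and> (\<lambda>s. g s - P * s ^ \<mm>) \<in> O[at 0](\<lambda>s. s ^ (\<mm> + 1))"


section \<open>Interaction numbers\<close>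

definition self_coeff :: "nat \<Rightarrow> nat \<Rightarrow> real" where
  "self_coeff c N = 2 / pi * Beta ((real N + 2) / 2) (1 / 2) *
     (of_bool (odd N) + 1 / real c * of_bool (even N) * of_bool (odd c))"

definition self_number :: "nat \<Rightarrow> (nat \<Rightarrow> nat \<Rightarrow> real \<times> real) \<Rightarrow> (nat \<Rightarrow> nat \<Rightarrow> real \<times> real) \<Rightarrow> nat \<Rightarrow> real" where
  "self_number c \<alpha> a N = self_coeff c N *
     (\<Sum>(k, l)\<in>{(k, l). k + l = N}. (a k l \<bullet> \<alpha> c 1) * fst (\<alpha> c 1) ^ k * snd (\<alpha> c 1) ^ l)"

text \<open>Closed form of the integral of \<open>sin (m x) * sin (c x) ^ N\<close> over \<open>(0, \<pi>)\<close>.\<close>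
definition sine_integral :: "nat \<Rightarrow> nat \<Rightarrow> nat \<Rightarrow> complex" where
  "sine_integral m c N = 1 / (2 * \<i>) ^ (N + 1) *
     (\<Sum>j=0..N. (-1) ^ j * of_nat (N choose j) *
        (let \<gamma> = int m + (int N - 2 * int j) * int c in
           of_bool (\<gamma> = 0) * of_real pi - of_bool (\<gamma> = 2 * int m) * of_real pi +
           of_bool (\<gamma> \<notin> {0, 2 * int m}) *
             (2 * of_nat m * (1 - (-1) powi \<gamma>) / (\<i> * of_int \<gamma> * (of_int \<gamma> - 2 * of_nat m)))))"

lemma sine_integral_real: "sine_integral m c N \<in> \<real>"
proof -
  define g where "g j = int m + (int N - 2 * int j) * int c" for j
  define A :: "nat \<Rightarrow> complex" where
    "A j = of_bool (g j = 0) * of_real pi - of_bool (g j = 2 * int m) * of_real pi" for j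
  define B :: "nat \<Rightarrow> complex" where
    "B j = of_bool (g j \<notin> {0, 2 * int m}) *
       (2 * of_nat m * (1 - (-1) powi g j) / (\<i> * of_int (g j) * (of_int (g j) - 2 * of_nat m)))" for j
  define S where "S = (\<Sum>j=0..N. (-1) ^ j * of_nat (N choose j) * (A j + B j))"
  have cnjA: "cnj (A j) = A j" for j
    by (simp add: A_def)
  have cnjB: "cnj (B j) = - B j" for j
  proof -
    have "(-1) powi g j = (of_int ((-1) ^ nat \<bar>g j\<bar>) :: complex)"
      by (cases "even (g j)") (auto simp: power_int_def even_nat_iff)
    then have "cnj ((-1) powi g j) = ((-1) powi g j :: complex)"
      by simp
    then show ?thesis
      by (simp add: B_def)
  qed
  have g: "g (N - j) = 2 * int m - g j" if "j \<le> N" for j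
    using that by (simp add: g_def of_nat_diff algebra_simps)
  have A: "A (N - j) = - A j" if "j \<le> N" for j
    using g[OF that] by (auto simp: A_def)
  have B: "B (N - j) = B j" if "j \<le> N" for j
  proof -
    have "(-1) powi (2 * int m - g j) = ((-1) powi g j :: complex)"
      by (simp add: power_int_minus_left)
    moreover have "\<i> * of_int (2 * int m - g j) * (of_int (2 * int m - g j) - 2 * of_nat m) =
        (\<i> * of_int (g j) * (of_int (g j) - 2 * of_nat m) :: complex)"
      by (simp add: algebra_simps)
    moreover have "2 * int m - g j \<notin> {0, 2 * int m} \<longleftrightarrow> g j \<notin> {0, 2 * int m}"
      by auto
    ultimately show ?thesis
      unfolding B_def g[OF that] by (simp only:)
  qed
  have "S = (\<Sum>j=0..N. (-1) ^ (N - j) * of_nat (N choose (N - j)) * (A (N - j) + B (N - j)))"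
    unfolding S_def by (subst sum.atLeastAtMost_rev) simp
  also have "\<dots> = (\<Sum>j=0..N. - ((-1) ^ N) * ((-1) ^ j * of_nat (N choose j) * cnj (A j + B j)))"
  proof (rule sum.cong [OF refl])
    fix j assume "j \<in> {0..N}"
    then have j: "j \<le> N" by simp
    have sgn: "(-1) ^ (N - j) = ((-1) ^ N * (-1) ^ j :: complex)"
      using j by (cases "even j"; cases "even N") auto
    have bin: "N choose (N - j) = N choose j"
      using j by (rule binomial_symmetric [symmetric])
    show "(-1) ^ (N - j) * of_nat (N choose (N - j)) * (A (N - j) + B (N - j)) =
        - ((-1) ^ N) * ((-1) ^ j * of_nat (N choose j) * cnj (A j + B j))"
      unfolding sgn bin A[OF j] B[OF j] by (simp add: cnjA cnjB algebra_simps)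
  qed
  also have "\<dots> = - ((-1) ^ N) * cnj S"
    by (simp add: S_def sum_distrib_left)
  finally have S: "S = - ((-1) ^ N) * cnj S" .
  have J: "sine_integral m c N = 1 / (2 * \<i>) ^ (N + 1) * S"
    by (simp add: sine_integral_def S_def A_def B_def g_def Let_def)
  have "cnj (sine_integral m c N) = 1 / (- (2 * \<i>)) ^ (N + 1) * cnj S"
  proof -
    have "cnj (2 * \<i>) = - (2 * \<i>)" by simp
    then show ?thesis
      unfolding J complex_cnj_mult[of _ S] complex_cnj_divide complex_cnj_power complex_cnj_one
      by (simp only:)
  qed
  also have "(- (2 * \<i>)) ^ (N + 1) = (-1) ^ (N + 1) * (2 * \<i>) ^ (N + 1)"
    by (rule power_minus)
  also have "1 / ((-1) ^ (N + 1) * (2 * \<i>) ^ (N + 1)) * cnj S =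
      1 / (2 * \<i>) ^ (N + 1) * (- ((-1) ^ N) * cnj S)"
    by (cases "even N") (simp_all del: power_Suc)
  finally have "cnj (sine_integral m c N) = sine_integral m c N"
    using S J by (simp only: S [symmetric])
  then show ?thesis
    by (simp add: Reals_cnj_iff)
qed

definition cross_indices :: "nat \<Rightarrow> nat \<Rightarrow> (nat \<times> nat \<times> nat \<times> nat \<times> nat \<times> nat \<times> nat \<times> nat) set" where
  "cross_indices c N = {(N1, N2, k, l, k', l', m, n).
     2 \<le> N1 \<and> 2 \<le> N2 \<and> N1 + N2 = N + 1 \<and> k + l = N1 \<and> k' + l' = N2 \<and>
     1 \<le> m \<and> n \<in> {1, 2} \<and> (m, n) \<noteq> (c, 1)}"

text \<open>The natural number exponents \<open>k + k' - 1\<close> and \<open>l + l' - 1\<close> are truncated only where the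
  prefactor \<open>k\<close> or \<open>l\<close> vanishes.\<close>
definition cross_coeff ::
  "nat \<Rightarrow> (nat \<Rightarrow> nat \<Rightarrow> real \<times> real) \<Rightarrow> nat \<times> nat \<times> nat \<times> nat \<times> nat \<times> nat \<times> nat \<times> nat \<Rightarrow> real" where
  "cross_coeff c \<alpha> = (\<lambda>(N1, N2, k, l, k', l', m, n).
     - 4 / pi\<^sup>2 *
     (real k * fst (\<alpha> c 1) ^ (k + k' - 1) * snd (\<alpha> c 1) ^ (l + l') * fst (\<alpha> m n) +
      real l * fst (\<alpha> c 1) ^ (k + k') * snd (\<alpha> c 1) ^ (l + l' - 1) * snd (\<alpha> m n)) *
     Re (sine_integral m c N1) * Re (sine_integral m c N2))"

definition cross_number ::
  "nat \<Rightarrow> (nat \<Rightarrow> nat \<Rightarrow> real) \<Rightarrow> (nat \<Rightarrow> nat \<Rightarrow> real \<times> real) \<Rightarrow> (nat \<Rightarrow> nat \<Rightarrow> real \<times> real) \<Rightarrow> nat \<Rightarrow> real" where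
  "cross_number c \<beta> \<alpha> a N =
     (\<Sum>\<^sub>\<infinity>(N1, N2, k, l, k', l', m, n)\<in>cross_indices c N.
        1 / \<beta> m n * cross_coeff c \<alpha> (N1, N2, k, l, k', l', m, n) *
        (a k l \<bullet> \<alpha> c 1) * (a k' l' \<bullet> \<alpha> m n))"

definition transition_number ::
  "nat \<Rightarrow> (nat \<Rightarrow> nat \<Rightarrow> real) \<Rightarrow> (nat \<Rightarrow> nat \<Rightarrow> real \<times> real) \<Rightarrow> (nat \<Rightarrow> nat \<Rightarrow> real \<times> real) \<Rightarrow> nat \<Rightarrow> real" where
  "transition_number c \<beta> \<alpha> a N = self_number c \<alpha> a N + cross_number c \<beta> \<alpha> a N"

end

theory Submission
  imports Defs
begin

text \<open>
  At the critical parameter value the linear operator \<open>A\<close> has the kernel spanned by the critical mode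
  \<open>e\<close> and is injective on the closed span of the other, stable modes. Let \<open>r\<close> be the nonlinear part of the
  reduced equation, \<open>G\<close> the nonlinearity, \<open>G\<^sub>N\<close> its part of degree \<open>N\<close> and \<open>d\<close> the lowest degree with
  \<open>G\<^sub>d \<noteq> 0\<close>. Local invariance of the graph of \<open>\<Phi>\<close> amounts to
  \<open>A \<Phi>(s) = r(s) \<Phi>'(s) + r(s) e - G(s e + \<Phi>(s))\<close> (\<open>invariance_equation\<close>). As \<open>\<Phi>\<close> is quadratically small,
  \<open>G(s e + \<Phi>(s))\<close> is \<open>O(s\<^sup>d)\<close>; therefore so are \<open>r\<close> and \<open>A \<Phi>\<close> (\<open>manifold_order\<close>). Moreover \<open>r \<Phi>'\<close> is
  \<open>O(s\<^sup>d\<^sup>+\<^sup>1)\<close>, and thus \<open>A \<Phi>(s)\<close> equals the stable part of \<open>- s\<^sup>d G\<^sub>d(e)\<close> up to \<open>O(s\<^sup>d\<^sup>+\<^sup>1)\<close>.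

  Below order \<open>2 d\<close> the function \<open>\<Phi>\<close> enters \<open>G(s e + \<Phi>(s))\<close> only through the derivative of \<open>G\<^sub>d\<close>, with a factor
  \<open>s\<^sup>d\<^sup>-\<^sup>1\<close> (\<open>pointwise_expansion\<close>). Projected on \<open>e\<close> this leaves the self interaction numbers and a single
  further monomial, of degree \<open>2 d - 1\<close>, whose coefficient is a sum over the stable modes of products
  of two sine coefficients divided by the eigenvalue (\<open>reduced_expansion\<close>, \<open>manifold_pairing\<close>). The cross
  interaction numbers produce the same monomial: their indices satisfy \<open>N1 + N2 = N + 1\<close>, and both
  \<open>N1\<close> and \<open>N2\<close> are at least \<open>d\<close> in every nonzero term, so that they vanish for \<open>N < 2 d - 1\<close> and involve
  only \<open>N1 = N2 = d\<close> for \<open>N = 2 d - 1\<close> (\<open>cross_number_first\<close>). Hence \<open>r(s)\<close> is the sum of the terms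
  \<open>transition_number N * s\<^sup>N\<close> with \<open>d \<le> N \<le> 2 d - 1\<close>, up to \<open>O(s\<^sup>2\<^sup>d)\<close> (\<open>transition_expansion\<close>), and the
  genericity condition places a nonzero coefficient in this range.

  The pointwise estimates need the sup norm of \<open>\<Phi>\<close>, whereas the hypotheses speak of its graph norm. The
  link is the inclusion of the domain in \<open>H\<^sub>0\<^sup>1\<close>: it forces the eigenvalues to grow at least linearly in
  the wavenumber (\<open>shifted_eigenvalue_growth\<close>), so that their inverses are square summable and the sine
  coefficients of an element of the stable subspace are absolutely summable (\<open>sup_bound\<close>).
\<close>

section \<open>The space of square integrable functions\<close>

abbreviation leb :: "real measure" where "leb \<equiv> lebesgue_on {0<..<pi}"

lemma finite_measure_leb: "finite_measure leb"
  by (rule finite_measure_lebesgue_on) simp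

lemma measure_leb: "measure leb (space leb) = pi"
  by (simp add: measure_restrict_space space_restrict_space)

lemma rep_L2_in: "rep_L2 u \<in> L2_funs"
  using Quotient3_rep_reflp[OF Quotient3_L2, of u] by (simp add: L2_eq_def)

lemma L2_of_eq_abs: "f \<in> L2_funs \<Longrightarrow> L2_of f = abs_L2 f"
  by (simp add: L2_of_def)

lemma L2_of_rep: "L2_of (rep_L2 u) = u"
  using Quotient3_abs_rep[OF Quotient3_L2, of u] by (simp add: L2_of_eq_abs rep_L2_in)

lemma L2_of_eq_iff:
  assumes "f \<in> L2_funs" "g \<in> L2_funs"
  shows "L2_of f = L2_of g \<longleftrightarrow> (AE x in leb. f x = g x)"
  using assms Quotient3_rel[OF Quotient3_L2, of f g] by (simp add: L2_of_eq_abs L2_eq_def)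

lemma rep_L2_of: "f \<in> L2_funs \<Longrightarrow> AE x in leb. rep_L2 (L2_of f) x = f x"
  using L2_of_eq_iff[OF rep_L2_in, of f "L2_of f"] by (simp add: L2_of_rep)

lemma inner_L2_of:
  assumes "f \<in> L2_funs" "g \<in> L2_funs"
  shows "inner (L2_of f) (L2_of g) = (\<integral>x. f x \<bullet> g x \<partial>leb)"
  using assms by (simp add: L2_of_eq_abs inner_L2.abs_eq L2_eq_def)

lemma L2_of_add:
  assumes "f \<in> L2_funs" "g \<in> L2_funs"
  shows "L2_of (\<lambda>x. f x + g x) = L2_of f + L2_of g"
  using assms by (simp add: L2_of_eq_abs plus_L2.abs_eq L2_eq_def L2_funs_add)

lemma L2_of_scaleR:
  assumes "f \<in> L2_funs"
  shows "L2_of (\<lambda>x. r *\<^sub>R f x) = r *\<^sub>R L2_of f"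
  using assms by (simp add: L2_of_eq_abs scaleR_L2.abs_eq L2_eq_def L2_funs_scaleR)

lemma L2_funs_diff:
  assumes "f \<in> L2_funs" "g \<in> L2_funs"
  shows "(\<lambda>x. f x - g x) \<in> L2_funs"
  using L2_funs_add[OF assms(1) L2_funs_scaleR[OF assms(2), of "-1"]] by simp

lemma L2_of_diff:
  assumes "f \<in> L2_funs" "g \<in> L2_funs"
  shows "L2_of (\<lambda>x. f x - g x) = L2_of f - L2_of g"
  using L2_of_add[OF assms(1) L2_funs_scaleR[OF assms(2), of "-1"]] L2_of_scaleR[OF assms(2), of "-1"]
  by simp

lemma L2_funs_bounded:
  assumes "f \<in> borel_measurable leb" "AE x in leb. norm (f x) \<le> K"
  shows "f \<in> L2_funs"
proof -
  interpret finite_measure leb by (rule finite_measure_leb)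
  have "integrable leb (\<lambda>x. (norm (f x))\<^sup>2)"
  proof (rule integrable_const_bound)
    show "AE x in leb. norm ((norm (f x))\<^sup>2) \<le> K\<^sup>2"
      using assms(2) by eventually_elim (simp add: power_mono)
  qed (use assms(1) in measurable)
  then show ?thesis using assms(1) by (simp add: L2_funs_def)
qed

text \<open>Remainders are estimated pointwise below; this carries the estimates over to the norm of
  \<open>L\<^sup>2\<close>.\<close>
lemma norm_L2_of_le:
  assumes "f \<in> borel_measurable leb" "AE x in leb. norm (f x) \<le> K" "0 \<le> K"
  shows "norm (L2_of f) \<le> sqrt pi * K"
proof -
  interpret finite_measure leb by (rule finite_measure_leb)
  have f: "f \<in> L2_funs" using L2_funs_bounded assms by blast
  have "(norm (L2_of f))\<^sup>2 = (\<integral>x. f x \<bullet> f x \<partial>leb)"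
    by (simp add: power2_norm_eq_inner inner_L2_of f)
  also have "\<dots> \<le> (\<integral>x. K\<^sup>2 \<partial>leb)"
  proof (rule integral_mono_AE)
    show "AE x in leb. f x \<bullet> f x \<le> K\<^sup>2"
      using assms(2) by eventually_elim (simp add: power_mono flip: power2_norm_eq_inner)
  qed (auto intro: L2_funs_integrable_inner f)
  also have "\<dots> = (sqrt pi * K)\<^sup>2" using measure_leb by (simp add: power_mult_distrib)
  finally show ?thesis by (rule power2_le_imp_le) (simp add: assms)
qed

lemma complete_measure_leb: "complete_measure leb"
proof
  fix A B assume "B \<subseteq> A" "A \<in> null_sets leb"
  moreover from this have "A \<in> null_sets lebesgue" "A \<subseteq> {0<..<pi}"
    by (auto simp: null_sets_restrict_space)
  moreover from this \<open>B \<subseteq> A\<close> have "B \<in> null_sets lebesgue"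
    using completion.complete2 by blast
  ultimately show "B \<in> sets leb"
    by (auto simp: sets_restrict_space_iff)
qed

text \<open>This rests on completeness of the measure. It is needed because a representative of a class is
  small, and its composition with a power series meaningful, only almost everywhere.\<close>
lemma borel_measurable_leb_AE_cong:
  fixes f g :: "real \<Rightarrow> 'b::topological_space"
  assumes f: "f \<in> borel_measurable leb" and ae: "AE x in leb. f x = g x"
  shows "g \<in> borel_measurable leb"
proof (rule measurableI)
  fix A :: "'b set" assume A: "A \<in> sets borel"
  show "g -` A \<inter> space leb \<in> sets leb"
  proof (rule complete_measure.in_sets_AE[OF complete_measure_leb])
    show "AE x in leb. (x \<in> f -` A \<inter> space leb) = (x \<in> g -` A \<inter> space leb)"
      using ae by eventually_elim auto
    show "f -` A \<inter> space leb \<in> sets leb" using f A by (rule measurable_sets)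
  qed auto
qed simp

lemma continuous_in_L2_funs:
  assumes "continuous_on {0..pi} f"
  shows "f \<in> L2_funs"
proof -
  have "bounded (f ` {0..pi})"
    using assms by (intro compact_imp_bounded compact_continuous_image) auto
  then obtain K where K: "\<And>x. x \<in> {0..pi} \<Longrightarrow> norm (f x) \<le> K"
    unfolding bounded_iff by blast
  have c: "continuous_on {0<..<pi} f"
    using assms by (rule continuous_on_subset) auto
  show ?thesis
  proof (rule L2_funs_bounded)
    show "f \<in> borel_measurable leb"
      by (rule continuous_imp_measurable_on_sets_lebesgue[OF c]) simp
    show "AE x in leb. norm (f x) \<le> K"
      by (rule AE_I2) (use K in \<open>auto simp: space_restrict_space\<close>)
  qed
qed

lemma integrable_leb_continuous:
  fixes f :: "real \<Rightarrow> real"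
  assumes "continuous_on {0..pi} f"
  shows "integrable leb f"
proof -
  have "f absolutely_integrable_on {0..pi}"
    using assms absolutely_integrable_continuous_real by blast
  then have "f absolutely_integrable_on {0<..<pi}"
    by (rule set_integrable_subset) auto
  then show ?thesis
    by (simp add: set_integrable_def integrable_restrict_space)
qed

lemma integral_leb_continuous:
  fixes f :: "real \<Rightarrow> real"
  assumes "continuous_on {0..pi} f"
  shows "integral\<^sup>L leb f = integral {0..pi} f"
proof -
  have "integral\<^sup>L leb f = integral {0<..<pi} f"
    by (rule lebesgue_integral_eq_integral) (simp_all add: integrable_leb_continuous assms)
  then show ?thesis by (simp add: integral_open_interval_real)
qed

lemma integral_leb_FTC:
  fixes f F :: "real \<Rightarrow> real"
  assumes "continuous_on {0..pi} f" "\<And>x. (F has_real_derivative f x) (at x)"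
  shows "integral\<^sup>L leb f = F pi - F 0"
proof -
  have "(f has_integral F pi - F 0) {0..pi}"
    using assms(2)
    by (intro fundamental_theorem_of_calculus)
       (auto simp flip: has_real_derivative_iff_has_vector_derivative intro: has_field_derivative_at_within)
  then show ?thesis
    using integral_leb_continuous[OF assms(1)] by (simp add: integral_unique)
qed

section \<open>Integrals of products of sines\<close>

text \<open>The function \<open>cos (c x) sin\<^sup>n\<^sup>+\<^sup>1 (c x)\<close> vanishes at both ends of the interval because \<open>c\<close> is an integer;
  integrating its derivative gives the recursion.\<close>
lemma integral_sin_power_step:
  assumes "1 \<le> c"
  shows "real (n + 2) * (\<integral>x. sin (real c * x) ^ (n + 2) \<partial>leb) =
         real (n + 1) * (\<integral>x. sin (real c * x) ^ n \<partial>leb)"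
proof -
  define F where "F x = - cos (real c * x) * sin (real c * x) ^ (n + 1) / real c" for x
  have "(F has_real_derivative
      real (n + 2) * sin (real c * x) ^ (n + 2) - real (n + 1) * sin (real c * x) ^ n) (at x)" for x
  proof -
    have c2: "cos (real c * x) * cos (real c * x) = 1 - sin (real c * x) ^ 2"
      by (metis cos_squared_eq power2_eq_square)
    have "(F has_real_derivative
      sin (real c * x) * sin (real c * x) ^ (n + 1)
       - real (n + 1) * sin (real c * x) ^ n * (cos (real c * x) * cos (real c * x))) (at x)"
      unfolding F_def using assms
      by (auto intro!: derivative_eq_intros simp: field_simps simp del: power_Suc)
    then show ?thesis
      unfolding c2 by (rule back_subst[where P = "\<lambda>d. (F has_real_derivative d) (at x)"])
        (simp add: algebra_simps power2_eq_square)
  qed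
  then have "(\<integral>x. real (n + 2) * sin (real c * x) ^ (n + 2) - real (n + 1) * sin (real c * x) ^ n \<partial>leb)
      = F pi - F 0"
    by (intro integral_leb_FTC) (auto intro!: continuous_intros)
  also have "\<dots> = 0" by (simp add: F_def)
  also have "(\<integral>x. real (n + 2) * sin (real c * x) ^ (n + 2) - real (n + 1) * sin (real c * x) ^ n \<partial>leb)
     = real (n + 2) * (\<integral>x. sin (real c * x) ^ (n + 2) \<partial>leb) - real (n + 1) * (\<integral>x. sin (real c * x) ^ n \<partial>leb)"
    by (subst Bochner_Integration.integral_diff)
       (auto intro!: integrable_leb_continuous continuous_intros simp del: power_Suc)
  finally show ?thesis by simp
qed

text \<open>The Beta function satisfies the two-step recursion of the integral. The parity of \<open>c\<close> enters
  through the starting value \<open>n = 1\<close>, which is \<open>2 / c\<close> for odd \<open>c\<close> and \<open>0\<close> for even \<open>c\<close>.\<close>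
lemma integral_sin_power:
  assumes c: "1 \<le> c"
  shows "(\<integral>x. sin (real c * x) ^ n \<partial>leb) =
    Beta ((real n + 1) / 2) (1 / 2) * (of_bool (even n) + 1 / real c * of_bool (odd n) * of_bool (odd c))"
proof (induction n rule: induct_nat_012)
  case 0
  show ?case using measure_leb by (simp add: Beta_def Gamma_one_half_real)
next
  case 1
  have "(\<integral>x. sin (real c * x) \<partial>leb) = - cos (real c * pi) / real c - (- cos (real c * 0) / real c)"
    using c by (intro integral_leb_FTC) (auto intro!: continuous_intros derivative_eq_intros)
  also have "\<dots> = (if odd c then 2 / real c else 0)"
    by (simp add: cos_npi)
  moreover have "Beta 1 (1/2::real) = 2"
  proof -
    have "(1 / 2 :: real) \<notin> \<int>\<^sub>\<le>\<^sub>0"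
      using nonpos_Ints_nonpos[of "1 / 2 :: real"] by auto
    then have "Gamma (1 + 1 / 2 :: real) = 1 / 2 * Gamma (1 / 2)"
      using Gamma_plus1[of "1/2 :: real"] by (simp add: add.commute)
    moreover have "Gamma (1 / 2 :: real) \<noteq> 0" by (simp add: Gamma_one_half_real)
    ultimately show ?thesis by (simp add: Beta_def field_simps)
  qed
  ultimately show ?case by simp
next
  case (ge2 n)
  have B: "(real n + 2) * Beta ((real n + 3) / 2) (1 / 2) = (real n + 1) * Beta ((real n + 1) / 2) (1 / 2)"
    using Beta_plus1_left[of "(real n + 1) / 2" "1 / 2 :: real"] 
    by (simp add: field_simps nonpos_Ints_def)
  have "(real n + 2) * (\<integral>x. sin (real c * x) ^ (n + 2) \<partial>leb) = (real n + 1) * (\<integral>x. sin (real c * x) ^ n \<partial>leb)"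
    using integral_sin_power_step[OF c, of n] by (simp add: algebra_simps)
  also have "\<dots> = (real n + 2) * (Beta ((real n + 3) / 2) (1 / 2) *
      (of_bool (even n) + 1 / real c * of_bool (odd n) * of_bool (odd c)))"
    unfolding ge2(1) using B by (metis (no_types, opaque_lifting) mult.assoc)
  finally have "(\<integral>x. sin (real c * x) ^ (n + 2) \<partial>leb) = (Beta ((real n + 3) / 2) (1 / 2) *
      (of_bool (even n) + 1 / real c * of_bool (odd n) * of_bool (odd c)))"
    by (subst (asm) mult_left_cancel) auto
  then show ?case by (simp add: add.commute)
qed

lemma self_coeff_eq_integral:
  assumes "1 \<le> c"
  shows "self_coeff c N = 2 / pi * (\<integral>x. sin (real c * x) ^ (N + 1) \<partial>leb)"
  unfolding self_coeff_def integral_sin_power[OF assms] by (simp add: add.commute)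

lemma integral_sin_sin:
  assumes "1 \<le> m" "1 \<le> k"
  shows "(\<integral>x. sin (real m * x) * sin (real k * x) \<partial>leb) = (if m = k then pi / 2 else 0)"
proof (cases "m = k")
  case True
  have "(\<integral>x. sin (real k * x) * sin (real k * x) \<partial>leb) = pi / 2"
    using integral_sin_power_step[OF assms(2), of 0] measure_leb by simp
  then show ?thesis using True by simp
next
  case False
  define a b where "a = real m - real k" and "b = real m + real k"
  have ab: "a \<noteq> 0" "b \<noteq> 0" using False assms by (auto simp: a_def b_def)
  have s: "sin (real m * x) * sin (real k * x) = (cos (a * x) - cos (b * x)) / 2" for x
    unfolding a_def b_def left_diff_distrib distrib_right by (rule sin_times_sin)
  have "(\<integral>x. (cos (a * x) - cos (b * x)) / 2 \<partial>leb) =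
     (sin (a * pi) / a - sin (b * pi) / b) / 2 - (sin (a * 0) / a - sin (b * 0) / b) / 2"
    using ab by (intro integral_leb_FTC) (auto intro!: continuous_intros derivative_eq_intros)
  also have "\<dots> = 0" by (simp add: a_def b_def left_diff_distrib distrib_right sin_diff sin_add)
  finally show ?thesis using False by (simp add: s)
qed

lemma has_integral_cis:
  "((\<lambda>x. cis (of_int g * x)) has_integral
     (if g = 0 then of_real pi else ((-1) powi g - 1) / (\<i> * of_int g))) {0..pi}"
proof (cases "g = 0")
  case True
  then show ?thesis using has_integral_const_real[of "1::complex" 0 pi] by (simp add: scaleR_conv_of_real)
next
  case False
  have "((\<lambda>x. cis (of_int g * x)) has_integral
     (cis (of_int g * pi) / (\<i> * of_int g) - cis (of_int g * 0) / (\<i> * of_int g))) {0..pi}"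
  proof (rule fundamental_theorem_of_calculus)
    fix x assume "x \<in> {0..pi}"
    have "((\<lambda>x. exp (\<i> * of_int g * of_real x) / (\<i> * of_int g)) has_vector_derivative
        exp (\<i> * of_int g * of_real x)) (at x within {0..pi})"
      using False
      by (intro has_vector_derivative_real_field) (auto intro!: derivative_eq_intros)
    then show "((\<lambda>x. cis (of_int g * x) / (\<i> * of_int g)) has_vector_derivative cis (of_int g * x))
        (at x within {0..pi})"
      by (simp add: cis_conv_exp mult.assoc)
  qed simp
  moreover have "cis (of_int g * pi) = (-1) powi g"
    by (metis cis_pi cis_power_int)
  ultimately show ?thesis using False by (simp add: diff_divide_distrib)
qed

lemma of_real_sin_cis: "complex_of_real (sin x) = (cis x - cis (- x)) / (2 * \<i>)"
  by (simp add: complex_eq_iff)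

text \<open>Both sines are written with exponentials; the binomial theorem then gives the frequencies
  \<open>\<gamma>\<close> and \<open>\<gamma> - 2 m\<close>, whose difference of primitives produces the factor \<open>2 m\<close>.\<close>
lemma sine_integral_eq:
  assumes m: "1 \<le> m"
  shows "sine_integral m c N = of_real (\<integral>x. sin (real m * x) * sin (real c * x) ^ N \<partial>leb)"
proof -
  define g where "g j = int m + (int N - 2 * int j) * int c" for j :: nat
  define v :: "int \<Rightarrow> complex" where
    "v h = (if h = 0 then of_real pi else ((-1) powi h - 1) / (\<i> * of_int h))" for h
  have expand: "complex_of_real (sin (real m * x) * sin (real c * x) ^ N) =
      (\<Sum>j\<le>N. 1 / (2 * \<i>) ^ (N + 1) * ((-1) ^ j * of_nat (N choose j)) *
        (cis (of_int (g j) * x) - cis (of_int (g j - 2 * int m) * x)))" for x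
  proof -
    have "complex_of_real (sin (real c * x)) ^ N = (- cis (- (real c * x)) + cis (real c * x)) ^ N / (2 * \<i>) ^ N"
      unfolding of_real_sin_cis power_divide by simp
    also have "(- cis (- (real c * x)) + cis (real c * x)) ^ N =
       (\<Sum>j\<le>N. of_nat (N choose j) * (- cis (- (real c * x))) ^ j * cis (real c * x) ^ (N - j))"
      by (rule binomial_ring)
    also have "\<dots> = (\<Sum>j\<le>N. (-1) ^ j * of_nat (N choose j) * cis ((real N - 2 * real j) * real c * x))"
    proof (rule sum.cong[OF refl])
      fix j assume "j \<in> {..N}"
      then have "real j * - (real c * x) + real (N - j) * (real c * x) = (real N - 2 * real j) * real c * x"
        by (simp add: of_nat_diff algebra_simps)
      then have "(- cis (- (real c * x))) ^ j * cis (real c * x) ^ (N - j) =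
         (-1) ^ j * cis ((real N - 2 * real j) * real c * x)"
        unfolding power_minus[of "cis _"] Complex.DeMoivre mult.assoc cis_mult by (simp only: mult.assoc)
      then show "of_nat (N choose j) * (- cis (- (real c * x))) ^ j * cis (real c * x) ^ (N - j) =
         (-1) ^ j * of_nat (N choose j) * cis ((real N - 2 * real j) * real c * x)"
        by (simp add: mult.assoc mult.left_commute)
    qed
    finally have "complex_of_real (sin (real m * x) * sin (real c * x) ^ N) =
      (\<Sum>j\<le>N. (cis (real m * x) - cis (- (real m * x))) / (2 * \<i>) *
         ((-1) ^ j * of_nat (N choose j) * cis ((real N - 2 * real j) * real c * x) / (2 * \<i>) ^ N))"
      by (simp add: of_real_sin_cis sum_divide_distrib sum_distrib_left)
    also have "\<dots> = (\<Sum>j\<le>N. 1 / (2 * \<i>) ^ (N + 1) * ((-1) ^ j * of_nat (N choose j)) *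
        (cis (of_int (g j) * x) - cis (of_int (g j - 2 * int m) * x)))"
    proof (rule sum.cong[OF refl])
      fix j
      have 1: "cis (of_int (g j) * x) = cis (real m * x) * cis ((real N - 2 * real j) * real c * x)"
        by (simp add: g_def cis_mult algebra_simps)
      have 2: "cis (of_int (g j - 2 * int m) * x) = cis (- (real m * x)) * cis ((real N - 2 * real j) * real c * x)"
        by (simp add: g_def cis_mult algebra_simps)
      show "(cis (real m * x) - cis (- (real m * x))) / (2 * \<i>) *
         ((-1) ^ j * of_nat (N choose j) * cis ((real N - 2 * real j) * real c * x) / (2 * \<i>) ^ N) =
        1 / (2 * \<i>) ^ (N + 1) * ((-1) ^ j * of_nat (N choose j)) *
        (cis (of_int (g j) * x) - cis (of_int (g j - 2 * int m) * x))"
        unfolding 1 2 by (simp add: algebra_simps divide_simps)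
    qed
    finally show ?thesis .
  qed
  have "((\<lambda>x. complex_of_real (sin (real m * x) * sin (real c * x) ^ N)) has_integral
     (\<Sum>j\<le>N. 1 / (2 * \<i>) ^ (N + 1) * ((-1) ^ j * of_nat (N choose j)) * (v (g j) - v (g j - 2 * int m)))) {0..pi}"
    unfolding expand v_def
    by (intro has_integral_sum has_integral_mult_right has_integral_diff has_integral_cis) simp
  moreover have "v (g j) - v (g j - 2 * int m) =
      (let \<gamma> = g j in of_bool (\<gamma> = 0) * of_real pi - of_bool (\<gamma> = 2 * int m) * of_real pi +
           of_bool (\<gamma> \<notin> {0, 2 * int m}) *
             (2 * of_nat m * (1 - (-1) powi \<gamma>) / (\<i> * of_int \<gamma> * (of_int \<gamma> - 2 * of_nat m))))" for j
  proof -
    have p: "(-1) powi (g j - 2 * int m) = ((-1) powi g j :: complex)"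
      by (simp add: power_int_minus_left)
    show ?thesis
    proof (cases "g j = 0 \<or> g j = 2 * int m")
      case True
      then show ?thesis using m p by (auto simp: v_def Let_def power_int_minus_left)
    next
      case False
      then have nz: "of_int (g j) \<noteq> (0::complex)" "of_int (g j) - 2 * of_nat m \<noteq> (0::complex)"
        using of_int_eq_iff[of "g j" "2 * int m", where 'a = complex] by auto
      have "(e - 1) / (\<i> * G) - (e - 1) / (\<i> * (G - 2 * M)) = 2 * M * (1 - e) / (\<i> * G * (G - 2 * M))"
        if "G \<noteq> 0" "G - 2 * M \<noteq> 0" for e G M :: complex
        using that by (simp add: divide_simps) (simp add: algebra_simps)
      from this[OF nz] show ?thesis using False p by (simp add: v_def Let_def)
    qed
  qed
  ultimately have "((\<lambda>x. complex_of_real (sin (real m * x) * sin (real c * x) ^ N)) has_integral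
     sine_integral m c N) {0..pi}"
    by (simp add: sine_integral_def g_def sum_distrib_left mult.assoc atMost_atLeast0)
  moreover have "((\<lambda>x. complex_of_real (sin (real m * x) * sin (real c * x) ^ N)) has_integral
     of_real (integral {0..pi} (\<lambda>x. sin (real m * x) * sin (real c * x) ^ N))) {0..pi}"
    by (intro has_integral_of_real integrable_integral integrable_continuous_interval continuous_intros)
  ultimately show ?thesis
    by (subst integral_leb_continuous) (auto intro!: continuous_intros dest: has_integral_unique)
qed

section \<open>Orthogonal expansions\<close>

definition orthogonal_family :: "('i \<Rightarrow> 'a::real_inner) \<Rightarrow> 'i set \<Rightarrow> bool" where
  "orthogonal_family E S \<longleftrightarrow> (\<forall>i\<in>S. E i \<noteq> 0 \<and> (\<forall>j\<in>S. i \<noteq> j \<longrightarrow> inner (E i) (E j) = 0))"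

definition fourier_sum :: "('i \<Rightarrow> 'a::real_inner) \<Rightarrow> 'i set \<Rightarrow> 'a \<Rightarrow> 'a" where
  "fourier_sum E F u = (\<Sum>i\<in>F. (inner u (E i) / inner (E i) (E i)) *\<^sub>R E i)"

lemma orthogonal_family_subset:
  "orthogonal_family E S \<Longrightarrow> T \<subseteq> S \<Longrightarrow> orthogonal_family E T"
  unfolding orthogonal_family_def by blast

lemma inner_fourier_sum:
  assumes "orthogonal_family E F" "finite F" "i \<in> F"
  shows "inner (fourier_sum E F u) (E i) = inner u (E i)"
proof -
  have "inner (fourier_sum E F u) (E i) =
      (\<Sum>j\<in>F. (inner u (E j) / inner (E j) (E j)) * inner (E j) (E i))"
    by (simp add: fourier_sum_def inner_sum_left)
  also have "\<dots> = (\<Sum>j\<in>F. if j = i then inner u (E i) else 0)"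
    using assms by (intro sum.cong) (auto simp: orthogonal_family_def)
  finally show ?thesis using assms by simp
qed

lemma bessel_inequality:
  assumes o: "orthogonal_family E F" and F: "finite F"
  shows "(\<Sum>i\<in>F. (inner u (E i))\<^sup>2 / inner (E i) (E i)) \<le> (norm u)\<^sup>2"
proof -
  let ?v = "fourier_sum E F u"
  have 1: "inner u ?v = (\<Sum>i\<in>F. (inner u (E i))\<^sup>2 / inner (E i) (E i))"
    by (simp add: fourier_sum_def inner_sum_right power2_eq_square)
  have "inner ?v ?v = (\<Sum>i\<in>F. (inner u (E i) / inner (E i) (E i)) * inner ?v (E i))"
    by (subst (2) fourier_sum_def) (simp add: inner_sum_right)
  also have "\<dots> = inner u ?v"
    unfolding 1 by (intro sum.cong) (auto simp: inner_fourier_sum[OF o F] power2_eq_square)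
  finally have 2: "inner ?v ?v = inner u ?v" .
  have "0 \<le> inner (u - ?v) (u - ?v)" by simp
  also have "\<dots> = (norm u)\<^sup>2 - inner u ?v"
    using 2 by (simp add: inner_diff_left inner_diff_right power2_norm_eq_inner inner_commute)
  finally show ?thesis using 1 by simp
qed

lemma best_approximation:
  assumes o: "orthogonal_family E F" and F: "finite F" and v: "v \<in> span (E ` F)"
  shows "norm (u - fourier_sum E F u) \<le> norm (u - v)"
proof -
  let ?w = "fourier_sum E F u"
  have sp: "?w - v \<in> span (E ` F)"
    unfolding fourier_sum_def by (intro span_diff span_sum span_scale span_base v) auto
  have "inner (u - ?w) z = 0" if "z \<in> span (E ` F)" for z
    using that
  proof (induction rule: span_induct_alt)
    case (step c x y)
    then show ?case
      by (auto simp: inner_add_right inner_diff_left inner_fourier_sum[OF o F])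
  qed simp
  from this[OF sp] have "inner (u - ?w) (?w - v) = 0" .
  then have "(norm (u - v))\<^sup>2 = (norm (u - ?w))\<^sup>2 + (norm (?w - v))\<^sup>2"
    using norm_add_Pythagorean[of "u - ?w" "?w - v"] by (simp add: orthogonal_def)
  then have "(norm (u - ?w))\<^sup>2 \<le> (norm (u - v))\<^sup>2" by simp
  then show ?thesis by (rule power2_le_imp_le) simp
qed

text \<open>Once a finite index set supports some element of the span close to \<open>u\<close>, best approximation
  makes every larger finite Fourier sum at least as close.\<close>
lemma fourier_has_sum:
  assumes o: "orthogonal_family E S" and u: "u \<in> closure (span (E ` S))"
  shows "((\<lambda>i. (inner u (E i) / inner (E i) (E i)) *\<^sub>R E i) has_sum u) S"
  unfolding has_sum_def
proof (rule tendstoI)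
  fix e :: real assume "0 < e"
  then obtain v where v: "v \<in> span (E ` S)" "dist v u < e"
    using u by (meson closure_approachable)
  from v(1) obtain T r where T: "finite T" "T \<subseteq> E ` S" "v = (\<Sum>a\<in>T. r a *\<^sub>R a)"
    unfolding span_explicit by auto
  then obtain F0 where F0: "F0 \<subseteq> S" "finite F0" "T = E ` F0"
    by (meson finite_subset_image)
  show "\<forall>\<^sub>F F in finite_subsets_at_top S.
       dist (\<Sum>i\<in>F. (inner u (E i) / inner (E i) (E i)) *\<^sub>R E i) u < e"
    unfolding eventually_finite_subsets_at_top
  proof (intro exI[of _ F0] conjI allI impI)
    fix F assume F: "finite F \<and> F0 \<subseteq> F \<and> F \<subseteq> S"
    have "v \<in> span (E ` F)"
      unfolding T(3) by (intro span_sum span_scale span_base) (use F F0 in auto)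
    then have "norm (u - fourier_sum E F u) \<le> norm (u - v)"
      using F orthogonal_family_subset[OF o] by (intro best_approximation) auto
    then show "dist (\<Sum>i\<in>F. (inner u (E i) / inner (E i) (E i)) *\<^sub>R E i) u < e"
      using v(2) by (simp add: fourier_sum_def dist_norm norm_minus_commute)
  qed (use F0 in auto)
qed

section \<open>Eigenmodes and the growth of the eigenvalues\<close>

lemma sin_scaleR_in_L2_funs: "(\<lambda>x. sin (real m * x) *\<^sub>R v) \<in> L2_funs"
  by (intro continuous_in_L2_funs continuous_intros)

lemma inner_mode:
  assumes "f \<in> L2_funs"
  shows "inner (L2_of f) (mode v m) = (\<integral>x. sin (real m * x) * (f x \<bullet> v) \<partial>leb)"
  using assms by (simp add: mode_def inner_L2_of sin_scaleR_in_L2_funs)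

lemma inner_mode_mode:
  assumes "1 \<le> m" "1 \<le> k"
  shows "inner (mode v m) (mode w k) = (if m = k then pi / 2 * (v \<bullet> w) else 0)"
proof -
  have "inner (mode v m) (mode w k) = (\<integral>x. (v \<bullet> w) * (sin (real m * x) * sin (real k * x)) \<partial>leb)"
    unfolding mode_def[of v] inner_mode[OF sin_scaleR_in_L2_funs]
    by (simp only: inner_scaleR_left mult_ac)
  then show ?thesis using integral_sin_sin[OF assms] by simp
qed

lemma mode_scaleR: "mode (r *\<^sub>R v) m = r *\<^sub>R mode v m"
  unfolding mode_def L2_of_scaleR[OF sin_scaleR_in_L2_funs, symmetric]
  by (simp only: scaleR_scaleR mult.commute)

lemma L2_funs_sum:
  assumes "\<And>i. i \<in> F \<Longrightarrow> f i \<in> L2_funs"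
  shows "(\<lambda>x. \<Sum>i\<in>F. f i x) \<in> L2_funs"
  using assms by (induction F rule: infinite_finite_induct) (auto simp: L2_funs_zero L2_funs_add)

lemma L2_of_sum:
  assumes "\<And>i. i \<in> F \<Longrightarrow> f i \<in> L2_funs"
  shows "L2_of (\<lambda>x. \<Sum>i\<in>F. f i x) = (\<Sum>i\<in>F. L2_of (f i))"
proof -
  have z: "L2_of (\<lambda>_. 0) = 0" using L2_of_scaleR[OF L2_funs_zero, of 0] by simp
  show ?thesis
    using assms
    by (induction F rule: infinite_finite_induct) (auto simp: z L2_of_add L2_funs_sum)
qed

text \<open>The partial sums converge uniformly by the Weierstrass test, hence in \<open>L\<^sup>2\<close>: this produces
  elements with prescribed sine coefficients.\<close>
lemma sine_series_sums:
  fixes v :: "nat \<Rightarrow> real \<times> real"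
  assumes v: "summable (\<lambda>k. norm (v k))"
  shows "(\<lambda>k. mode (v k) (m k)) sums L2_of (\<lambda>x. \<Sum>k. sin (real (m k) * x) *\<^sub>R v k)"
proof -
  let ?S = "\<lambda>n x. \<Sum>k<n. sin (real (m k) * x) *\<^sub>R v k"
  let ?f = "\<lambda>x. \<Sum>k. sin (real (m k) * x) *\<^sub>R v k"
  have ul: "uniform_limit UNIV ?S ?f sequentially"
    by (rule Weierstrass_m_test[OF _ v]) (simp add: mult_left_le_one_le)
  have "continuous_on UNIV ?f"
    by (rule uniform_limit_theorem[OF _ ul]) (auto intro!: always_eventually continuous_intros)
  then have f: "?f \<in> L2_funs"
    by (intro continuous_in_L2_funs) (rule continuous_on_subset, auto)
  have S: "?S n \<in> L2_funs" for n by (intro L2_funs_sum sin_scaleR_in_L2_funs)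
  have "(\<lambda>n. L2_of (?S n)) \<longlonglongrightarrow> L2_of ?f"
  proof (rule tendstoI)
    fix e :: real assume e: "0 < e"
    have "\<forall>\<^sub>F n in sequentially. \<forall>x\<in>UNIV. dist (?S n x) (?f x) < e / (2 * sqrt pi)"
      using ul e unfolding uniform_limit_iff by simp
    then show "\<forall>\<^sub>F n in sequentially. dist (L2_of (?S n)) (L2_of ?f) < e"
    proof eventually_elim
      case (elim n)
      have "norm (L2_of (\<lambda>x. ?S n x - ?f x)) \<le> sqrt pi * (e / (2 * sqrt pi))"
        by (rule norm_L2_of_le)
           (use L2_funs_diff[OF S f] e elim in \<open>auto simp: L2_funs_def dist_norm intro!: AE_I2 less_imp_le\<close>)
      then show ?case using e by (simp add: L2_of_diff[OF S f] dist_norm)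
    qed
  qed
  then show ?thesis
    unfolding sums_def by (subst (asm) L2_of_sum) (auto simp: sin_scaleR_in_L2_funs mode_def)
qed

text \<open>Integration by parts: multiplying the sine coefficients by the frequency gives the cosine
  coefficients of the weak derivative, which are bounded.\<close>
lemma H01_sine_coefficients:
  assumes "u \<in> H01"
  obtains C where "\<And>m v. norm v = 1 \<Longrightarrow> real m * \<bar>inner u (mode v m)\<bar> \<le> C"
proof -
  from assms obtain w f where tf: "\<And>i. test_function (f i)"
    and fu: "(\<lambda>i. L2_of (f i)) \<longlonglongrightarrow> u"
    and fw: "(\<lambda>i. L2_of (\<lambda>x. vector_derivative (f i) (at x))) \<longlonglongrightarrow> w"
    unfolding H01_def by blast
  have cosL: "(\<lambda>x. cos (real m * x) *\<^sub>R v) \<in> L2_funs" for m and v :: "real \<times> real"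
    by (intro continuous_in_L2_funs continuous_intros)
  have parts: "inner (L2_of (\<lambda>x. vector_derivative (f i) (at x))) (L2_of (\<lambda>x. cos (real m * x) *\<^sub>R v))
      = real m * inner (L2_of (f i)) (mode v m)" for i m v
  proof -
    obtain D a b where D: "D 0 = f i"
      "\<And>j x. (D j has_vector_derivative D (Suc j) x) (at x)"
      and ab: "0 < a" "b < pi" "\<And>x. x \<notin> {a..b} \<Longrightarrow> f i x = 0"
      using tf[of i] unfolding test_function_def by blast
    have der: "(f i has_vector_derivative D 1 x) (at x)" for x
      using D(2)[of 0 x] D(1) by simp
    then have vd: "(\<lambda>x. vector_derivative (f i) (at x)) = D 1"
      by (auto simp: vector_derivative_at)
    have cD: "continuous_on S (D j)" for j S
      by (meson D(2) continuous_at_imp_continuous_on has_vector_derivative_continuous)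
    have cf: "continuous_on S (f i)" for S using cD[of S 0] D(1) by simp
    define F where "F x = cos (real m * x) * (f i x \<bullet> v)" for x
    have "(F has_real_derivative cos (real m * x) * (D 1 x \<bullet> v) - real m * (sin (real m * x) * (f i x \<bullet> v))) (at x)" for x
    proof -
      have "((\<lambda>x. f i x \<bullet> v) has_real_derivative D 1 x \<bullet> v) (at x)"
        unfolding has_real_derivative_iff_has_vector_derivative
        by (rule bounded_linear.has_vector_derivative[OF bounded_linear_inner_left der])
      then show ?thesis unfolding F_def by (auto intro!: derivative_eq_intros)
    qed
    then have "(\<integral>x. cos (real m * x) * (D 1 x \<bullet> v) - real m * (sin (real m * x) * (f i x \<bullet> v)) \<partial>leb)
        = F pi - F 0"
      by (intro integral_leb_FTC) (auto intro!: continuous_intros cD cf)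
    also have "\<dots> = 0" using ab by (simp add: F_def)
    also have "(\<integral>x. cos (real m * x) * (D 1 x \<bullet> v) - real m * (sin (real m * x) * (f i x \<bullet> v)) \<partial>leb)
        = (\<integral>x. cos (real m * x) * (D 1 x \<bullet> v) \<partial>leb) - real m * (\<integral>x. sin (real m * x) * (f i x \<bullet> v) \<partial>leb)"
      by (subst Bochner_Integration.integral_diff)
         (auto intro!: integrable_leb_continuous continuous_intros cD cf)
    finally show ?thesis
      unfolding vd using cD[of _ 1] cf
      by (simp add: inner_mode inner_L2_of cosL continuous_in_L2_funs)
  qed
  have bound: "real m * \<bar>inner u (mode v m)\<bar> \<le> norm w * sqrt pi" if v: "norm v = 1" for m v
  proof -
    let ?c = "L2_of (\<lambda>x. cos (real m * x) *\<^sub>R v)"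
    have "(\<lambda>i. inner (L2_of (\<lambda>x. vector_derivative (f i) (at x))) ?c) \<longlonglongrightarrow> inner w ?c"
      by (intro tendsto_intros fw)
    moreover have "(\<lambda>i. real m * inner (L2_of (f i)) (mode v m)) \<longlonglongrightarrow> real m * inner u (mode v m)"
      by (intro tendsto_intros fu)
    ultimately have eq: "real m * inner u (mode v m) = inner w ?c"
      unfolding parts by (rule LIMSEQ_unique[symmetric])
    have "norm ?c \<le> sqrt pi * 1"
      by (rule norm_L2_of_le) (use cosL[of m v] v in \<open>auto simp: L2_funs_def\<close>)
    then have "\<bar>inner w ?c\<bar> \<le> norm w * sqrt pi"
      using Cauchy_Schwarz_ineq2[of w ?c] mult_left_mono[of "norm ?c" "sqrt pi" "norm w"] by simp
    then show ?thesis unfolding eq[symmetric] by (simp add: abs_mult)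
  qed
  then show ?thesis by (rule that)
qed

text \<open>The excess of \<open>|u|\<close> over \<open>K\<close> is at most \<open>|u - g|\<close> for every \<open>g\<close> bounded by \<open>K\<close>, so its square has
  integral zero when such \<open>g\<close> come arbitrarily close to \<open>u\<close>.\<close>
lemma AE_bounded_limit:
  assumes "\<And>e. 0 < e \<Longrightarrow> \<exists>g\<in>L2_funs. (\<forall>x. norm (g x) \<le> K) \<and> norm (u - L2_of g) < e"
  shows "AE x in leb. norm (rep_L2 u x) \<le> K"
proof -
  define h where "h x = (max 0 (norm (rep_L2 u x) - K))\<^sup>2" for x
  have [measurable]: "rep_L2 u \<in> borel_measurable leb" using rep_L2_in[of u] by (simp add: L2_funs_def)
  have [measurable]: "h \<in> borel_measurable leb" unfolding h_def by measurable
  have main: "integrable leb h \<and> integral\<^sup>L leb h \<le> e" if e: "0 < e" for e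
  proof -
    obtain g where g: "g \<in> L2_funs" "\<And>x. norm (g x) \<le> K" "norm (u - L2_of g) < sqrt e"
      using assms[of "sqrt e"] e by auto
    let ?d = "\<lambda>x. rep_L2 u x - g x"
    have d: "?d \<in> L2_funs" by (intro L2_funs_diff rep_L2_in g)
    have hd: "h x \<le> ?d x \<bullet> ?d x" for x
    proof -
      have "norm (rep_L2 u x) \<le> norm (g x) + norm (?d x)"
        using norm_triangle_ineq[of "g x" "?d x"] by simp
      then have "max 0 (norm (rep_L2 u x) - K) \<le> norm (?d x)" using g(2)[of x] by simp
      then have "h x \<le> (norm (?d x))\<^sup>2" unfolding h_def by (intro power_mono) auto
      then show ?thesis by (simp add: power2_norm_eq_inner)
    qed
    have int: "integrable leb (\<lambda>x. ?d x \<bullet> ?d x)" by (rule L2_funs_integrable_inner[OF d d])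
    have ih: "integrable leb h"
      by (rule Bochner_Integration.integrable_bound[OF int])
         (use hd in \<open>auto simp: h_def intro!: AE_I2\<close>)
    have "integral\<^sup>L leb h \<le> (\<integral>x. ?d x \<bullet> ?d x \<partial>leb)"
      by (intro integral_mono ih int hd)
    also have "\<dots> = (norm (L2_of ?d))\<^sup>2"
      by (simp add: power2_norm_eq_inner inner_L2_of d)
    also have "L2_of ?d = u - L2_of g" by (simp add: L2_of_diff rep_L2_in g L2_of_rep)
    also have "(norm (u - L2_of g))\<^sup>2 \<le> (sqrt e)\<^sup>2" using g(3) by (intro power_mono) auto
    finally show ?thesis using ih e by simp
  qed
  then have "integral\<^sup>L leb h \<le> 0" using field_le_epsilon[of "integral\<^sup>L leb h" 0] by simp
  moreover have "0 \<le> integral\<^sup>L leb h" by (simp add: h_def)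
  ultimately have "integral\<^sup>L leb h = 0" by simp
  then have "AE x in leb. h x = 0"
    using integral_nonneg_eq_0_iff_AE[of leb h] main[of 1] by (simp add: h_def)
  then show ?thesis by eventually_elim (auto simp: h_def max_def split: if_splits)
qed

lemma self_adjoint_symmetric:
  assumes "self_adjoint D A" "u \<in> D" "v \<in> D"
  shows "inner (A u) v = inner u (A v)"
  using assms unfolding self_adjoint_def by metis

text \<open>The linear operator at the critical parameter value. It annihilates the mode \<open>(c, 1)\<close> and no
  other one; the others are called stable.\<close>
locale critical_operator =
  fixes H1 :: "L2 set" and A :: "L2 \<Rightarrow> L2" and \<alpha> :: "nat \<Rightarrow> nat \<Rightarrow> real \<times> real"
    and \<beta> :: "nat \<Rightarrow> nat \<Rightarrow> real" and c :: nat
  assumes dom: "H1 \<subseteq> H01" and sa: "self_adjoint H1 A" and cr: "compact_resolvent H1 A"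
    and norm_\<alpha>: "1 \<le> m \<Longrightarrow> n \<in> {1, 2} \<Longrightarrow> norm (\<alpha> m n) = 1"
    and mode_dom: "1 \<le> m \<Longrightarrow> n \<in> {1, 2} \<Longrightarrow> mode (\<alpha> m n) m \<in> H1"
    and eigen: "1 \<le> m \<Longrightarrow> n \<in> {1, 2} \<Longrightarrow> A (mode (\<alpha> m n) m) = \<beta> m n *\<^sub>R mode (\<alpha> m n) m"
    and orth_\<alpha>: "1 \<le> m \<Longrightarrow> \<alpha> m 1 \<bullet> \<alpha> m 2 = 0"
    and c: "1 \<le> c" and critical: "\<beta> c 1 = 0"
    and noncritical: "1 \<le> m \<Longrightarrow> n \<in> {1, 2} \<Longrightarrow> (m, n) \<noteq> (c, 1) \<Longrightarrow> \<beta> m n \<noteq> 0"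
begin

definition stable :: "(nat \<times> nat) set" where
  "stable = {(m, n). 1 \<le> m \<and> n \<in> {1, 2} \<and> (m, n) \<noteq> (c, 1)}"

definition E :: "nat \<times> nat \<Rightarrow> L2" where
  "E = (\<lambda>(m, n). mode (\<alpha> m n) m)"

definition \<alpha>\<^sub>c :: "real \<times> real" where "\<alpha>\<^sub>c = \<alpha> c 1"

definition e :: L2 where "e = mode \<alpha>\<^sub>c c"

lemma inner_E_E:
  assumes "1 \<le> fst p" "snd p \<in> {1, 2}" "1 \<le> fst q" "snd q \<in> {1, 2}"
  shows "inner (E p) (E q) = (if p = q then pi / 2 else 0)"
proof -
  obtain m n k l where pq: "p = (m, n)" "q = (k, l)" by (metis surj_pair)
  have "\<alpha> m n \<bullet> \<alpha> m l = (if n = l then 1 else 0)" if "m = k"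
    using assms norm_\<alpha>[of m n] orth_\<alpha>[of m] that
    by (auto simp: pq inner_commute norm_eq_1)
  then show ?thesis using assms by (auto simp: pq E_def inner_mode_mode)
qed

lemma orthogonal_stable: "orthogonal_family E stable"
proof -
  have "E p \<noteq> 0" if "p \<in> stable" for p
    using inner_E_E[of p p] that by (auto simp: stable_def)
  then show ?thesis
    by (auto simp: orthogonal_family_def inner_E_E stable_def)
qed

lemma inner_E_stable: "p \<in> stable \<Longrightarrow> inner (E p) (E p) = pi / 2"
  by (auto simp: stable_def inner_E_E)

lemma inner_e_e: "inner e e = pi / 2"
  using inner_E_E[of "(c, 1)" "(c, 1)"] c by (simp add: E_def e_def \<alpha>\<^sub>c_def)

lemma inner_e_stable: "p \<in> stable \<Longrightarrow> inner e (E p) = 0"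
  using inner_E_E[of "(c, 1)" p] c by (auto simp: E_def e_def \<alpha>\<^sub>c_def stable_def)

lemma inner_A_mode:
  assumes "u \<in> H1" "1 \<le> m" "n \<in> {1, 2}"
  shows "inner (A u) (mode (\<alpha> m n) m) = \<beta> m n * inner u (mode (\<alpha> m n) m)"
  using self_adjoint_symmetric[OF sa assms(1) mode_dom[OF assms(2,3)]] eigen[OF assms(2,3)] by simp

lemma norm_critical_vector: "norm \<alpha>\<^sub>c = 1"
  using norm_\<alpha>[of c 1] c by (simp add: \<alpha>\<^sub>c_def)

lemma e_in_H1: "e \<in> H1"
  using mode_dom[of c 1] c by (simp add: e_def \<alpha>\<^sub>c_def)

lemma A_e: "A e = 0"
  using eigen[of c 1] c critical by (simp add: e_def \<alpha>\<^sub>c_def)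

lemma inner_A_e: "u \<in> H1 \<Longrightarrow> inner (A u) e = 0"
  using inner_A_mode[of u c 1] c critical by (simp add: e_def \<alpha>\<^sub>c_def)

text \<open>If the shifted eigenvalues were smaller than \<open>4\<^sup>-\<^sup>k m\<close> along a sequence of modes, the resolvent would map the
  superposition of these modes with weights \<open>2\<^sup>-\<^sup>k\<close> to an element whose sine coefficients, multiplied by
  the frequency, are unbounded; such an element does not lie in \<open>H\<^sub>0\<^sup>1\<close>. The modes need not be
  distinct, since repetitions only add nonnegative contributions.\<close>
lemma shifted_eigenvalue_growth:
  obtains \<mu> \<kappa> where "0 < \<kappa>"
    "\<And>m n. 1 \<le> m \<Longrightarrow> n \<in> {1, 2} \<Longrightarrow> \<kappa> * real m \<le> \<bar>\<mu> - \<beta> m n\<bar>"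
proof -
  obtain \<mu> where bij: "bij_betw (\<lambda>u. \<mu> *\<^sub>R u - A u) H1 UNIV"
    using cr unfolding compact_resolvent_def by blast
  show ?thesis
  proof (cases "\<exists>\<kappa>>0. \<forall>m n. 1 \<le> m \<longrightarrow> n \<in> {1, 2} \<longrightarrow> \<kappa> * real m \<le> \<bar>\<mu> - \<beta> m n\<bar>")
    case True
    then show ?thesis using that by blast
  next
    case False
    have "\<exists>m n. 1 \<le> m \<and> n \<in> {1, 2} \<and> \<bar>\<mu> - \<beta> m n\<bar> < (1/4) ^ k * real m" for k :: nat
    proof (rule ccontr)
      assume "\<nexists>m n. 1 \<le> m \<and> n \<in> {1, 2} \<and> \<bar>\<mu> - \<beta> m n\<bar> < (1/4) ^ k * real m"
      then have "\<forall>m n. 1 \<le> m \<longrightarrow> n \<in> {1, 2} \<longrightarrow> (1/4) ^ k * real m \<le> \<bar>\<mu> - \<beta> m n\<bar>"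
        by (meson not_less)
      moreover have "(0::real) < (1/4) ^ k" by simp
      ultimately show False using False by blast
    qed
    then have "\<forall>k. \<exists>p. 1 \<le> fst p \<and> snd p \<in> {1, 2} \<and> \<bar>\<mu> - \<beta> (fst p) (snd p)\<bar> < (1/4) ^ k * real (fst p)"
      by simp
    from choice[OF this] obtain p where p: "\<And>k. 1 \<le> fst (p k) \<and> snd (p k) \<in> {1, 2} \<and>
      \<bar>\<mu> - \<beta> (fst (p k)) (snd (p k))\<bar> < (1/4) ^ k * real (fst (p k))"
      by blast
    define m n where "m k = fst (p k)" and "n k = snd (p k)" for k
    have mn: "\<And>k. 1 \<le> m k" "\<And>k. n k \<in> {1, 2}"
      "\<And>k. \<bar>\<mu> - \<beta> (m k) (n k)\<bar> < (1/4) ^ k * real (m k)"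
      using p by (simp_all add: m_def n_def)
    define v where "v k = (1/2) ^ k *\<^sub>R \<alpha> (m k) (n k)" for k
    define f where "f = L2_of (\<lambda>x. \<Sum>k. sin (real (m k) * x) *\<^sub>R v k)"
    have nv: "norm (v k) = (1/2) ^ k" for k
      using norm_\<alpha>[OF mn(1) mn(2)] by (simp add: v_def)
    have "(\<lambda>k. mode (v k) (m k)) sums f"
      unfolding f_def by (rule sine_series_sums) (simp add: nv)
    then have f: "(\<lambda>k. (1/2) ^ k *\<^sub>R E (m k, n k)) sums f"
      by (simp add: v_def mode_scaleR E_def)
    have "f \<in> (\<lambda>u. \<mu> *\<^sub>R u - A u) ` H1"
      using bij by (simp add: bij_betw_def)
    then obtain u where u: "u \<in> H1" "f = \<mu> *\<^sub>R u - A u"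
      by blast
    obtain C where C: "\<And>m v. norm v = 1 \<Longrightarrow> real m * \<bar>inner u (mode v m)\<bar> \<le> C"
      by (rule H01_sine_coefficients[of u]) (use u(1) dom in auto)
    have "2 ^ j * (pi / 2) \<le> C" for j
    proof -
      let ?q = "(m j, n j)"
      have "(\<lambda>k. (1/2) ^ k * inner (E (m k, n k)) (E ?q)) sums inner f (E ?q)"
        using bounded_linear.sums[OF bounded_linear_inner_left f, of "E ?q"] by simp
      moreover have "inner (E (m k, n k)) (E ?q) = (if (m k, n k) = ?q then pi / 2 else 0)" for k
        using mn by (intro inner_E_E) auto
      ultimately have s: "(\<lambda>k. (1/2) ^ k * (if (m k, n k) = ?q then pi / 2 else 0)) sums inner f (E ?q)"
        by simp
      have "(\<Sum>k\<in>{j}. (1/2) ^ k * (if (m k, n k) = ?q then pi / 2 else 0)) \<le> inner f (E ?q)"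
        unfolding sums_unique[OF s] by (rule sum_le_suminf[OF sums_summable[OF s]]) auto
      then have "(1/2) ^ j * (pi / 2) \<le> inner f (E ?q)" by simp
      also have "inner f (E ?q) = (\<mu> - \<beta> (m j) (n j)) * inner u (E ?q)"
        using inner_A_mode[OF u(1) mn(1) mn(2), of j j] by (simp add: u(2) E_def inner_diff_left algebra_simps)
      also have "\<dots> \<le> \<bar>\<mu> - \<beta> (m j) (n j)\<bar> * \<bar>inner u (E ?q)\<bar>"
        by (metis abs_ge_self abs_mult)
      also have "\<dots> \<le> ((1/4) ^ j * real (m j)) * \<bar>inner u (E ?q)\<bar>"
        using mn(3)[of j] by (intro mult_right_mono) auto
      also have "\<dots> \<le> (1/4) ^ j * C"
        using C[OF norm_\<alpha>[OF mn(1) mn(2)], of "m j" j j] by (simp add: E_def mult.assoc)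
      finally have "4 ^ j * ((1/2) ^ j * (pi / 2)) \<le> 4 ^ j * ((1/4) ^ j * C)"
        by (intro mult_left_mono) auto
      then show ?thesis
        by (simp add: mult.assoc[symmetric] power_mult_distrib[symmetric])
    qed
    moreover obtain j where "C < 2 ^ j" using real_arch_pow[of 2 C] by auto
    moreover have "2 ^ j * 1 \<le> 2 ^ j * (pi / 2)" by (intro mult_left_mono) (use pi_ge_two in auto)
    ultimately have False by (metis less_le_not_le mult.right_neutral order_trans)
    then show ?thesis ..
  qed
qed

text \<open>For large \<open>m\<close> the shift is absorbed by half of the growth; the finitely many other stable modes
  contribute a positive minimum of \<open>|\<beta>| / m\<close>.\<close>
lemma eigenvalue_growth:
  obtains \<kappa> where "0 < \<kappa>" "\<And>m n. (m, n) \<in> stable \<Longrightarrow> \<kappa> * real m \<le> \<bar>\<beta> m n\<bar>"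
proof -
  obtain \<mu> \<kappa> where \<kappa>: "0 < \<kappa>"
    "\<And>m n. 1 \<le> m \<Longrightarrow> n \<in> {1, 2} \<Longrightarrow> \<kappa> * real m \<le> \<bar>\<mu> - \<beta> m n\<bar>"
    by (rule shifted_eigenvalue_growth) (rule that)
  obtain M :: nat where M: "2 * \<bar>\<mu>\<bar> / \<kappa> \<le> real M" using real_arch_simple by blast
  define T where "T = insert (\<kappa> / 2) ((\<lambda>(m, n). \<bar>\<beta> m n\<bar> / real m) ` (stable \<inter> {..M} \<times> {1, 2}))"
  have fT: "finite T" and Tne: "T \<noteq> {}" by (simp_all add: T_def)
  have "0 < Min T"
    unfolding Min_gr_iff[OF fT Tne] using \<kappa>(1) noncritical
    by (auto simp: T_def stable_def)
  moreover have "Min T * real m \<le> \<bar>\<beta> m n\<bar>" if mn: "(m, n) \<in> stable" for m n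
  proof -
    have m: "0 < real m" "1 \<le> m" "n \<in> {1, 2}" using mn by (auto simp: stable_def)
    show ?thesis
    proof (cases "m \<le> M")
      case True
      then have "\<bar>\<beta> m n\<bar> / real m \<in> T" using mn m by (force simp: T_def)
      then have "Min T \<le> \<bar>\<beta> m n\<bar> / real m" using fT by simp
      then show ?thesis using m by (simp add: pos_le_divide_eq)
    next
      case False
      have "Min T \<le> \<kappa> / 2" using fT by (intro Min_le) (auto simp: T_def)
      then have "Min T * real m \<le> \<kappa> / 2 * real m" by (intro mult_right_mono) auto
      moreover have "2 * \<bar>\<mu>\<bar> \<le> \<kappa> * real m"
      proof -
        have "2 * \<bar>\<mu>\<bar> \<le> \<kappa> * real M" using M \<kappa>(1) by (simp add: pos_divide_le_eq mult.commute)
        also have "\<dots> \<le> \<kappa> * real m" using False \<kappa>(1) by simp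
        finally show ?thesis .
      qed
      moreover have "\<kappa> * real m \<le> \<bar>\<mu> - \<beta> m n\<bar>" using \<kappa>(2) m by blast
      ultimately show ?thesis by (simp add: abs_if split: if_splits)
    qed
  qed
  ultimately show ?thesis using that by blast
qed

lemma summable_inverse_squares: "(\<lambda>(m, n). 1 / (\<beta> m n)\<^sup>2) summable_on stable"
proof -
  obtain \<kappa> where \<kappa>: "0 < \<kappa>" "\<And>m n. (m, n) \<in> stable \<Longrightarrow> \<kappa> * real m \<le> \<bar>\<beta> m n\<bar>"
    by (rule eigenvalue_growth) (rule that)
  have "(\<lambda>m. 1 / \<kappa>\<^sup>2 * (1 / real m ^ 2)) summable_on UNIV"
    using inverse_power_summable[of 2, where 'a = real]
    by (intro summable_on_cmult_right summable_nonneg_imp_summable_on) (auto simp: inverse_eq_divide)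
  then have "(\<lambda>(m, n). 1 / \<kappa>\<^sup>2 * (1 / real m ^ 2)) summable_on (\<lambda>m. (m, n)) ` UNIV" for n :: nat
    by (subst summable_on_reindex) (auto simp: inj_on_def o_def)
  from summable_on_union[OF this[of 1] this[of 2]]
  have "(\<lambda>(m, n). 1 / \<kappa>\<^sup>2 * (1 / real m ^ 2)) summable_on stable"
    by (rule summable_on_subset) (auto simp: stable_def)
  then show ?thesis
  proof (rule summable_on_comparison_test)
    fix p assume p: "p \<in> stable"
    obtain m n where mn: "p = (m, n)" by (cases p)
    then have m: "0 < real m" using p by (auto simp: stable_def)
    have "(\<kappa> * real m)\<^sup>2 \<le> \<bar>\<beta> m n\<bar>\<^sup>2" using \<kappa> p mn by (intro power_mono) auto
    then have "1 / (\<beta> m n)\<^sup>2 \<le> 1 / (\<kappa> * real m)\<^sup>2"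
      using \<kappa>(1) m by (intro divide_left_mono) (auto simp: zero_less_mult_iff)
    then show "(case p of (m, n) \<Rightarrow> 1 / (\<beta> m n)\<^sup>2) \<le> (case p of (m, n) \<Rightarrow> 1 / \<kappa>\<^sup>2 * (1 / real m ^ 2))"
      by (simp add: mn power_mult_distrib)
  qed auto
qed

lemma norm_E_stable: "p \<in> stable \<Longrightarrow> norm (E p) = sqrt (pi / 2)"
  using inner_E_stable by (simp add: norm_eq_sqrt_inner)

lemma bessel_stable:
  assumes "finite F" "F \<subseteq> stable"
  shows "(\<Sum>p\<in>F. (inner u (E p))\<^sup>2) \<le> pi / 2 * (norm u)\<^sup>2"
proof -
  have "(\<Sum>p\<in>F. (inner u (E p))\<^sup>2 / inner (E p) (E p)) \<le> (norm u)\<^sup>2"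
    by (rule bessel_inequality[OF orthogonal_family_subset[OF orthogonal_stable assms(2)] assms(1)])
  also have "(\<Sum>p\<in>F. (inner u (E p))\<^sup>2 / inner (E p) (E p)) = 2 / pi * (\<Sum>p\<in>F. (inner u (E p))\<^sup>2)"
    unfolding sum_distrib_left
  proof (rule sum.cong[OF refl])
    fix p assume "p \<in> F"
    then have i: "inner (E p) (E p) = pi / 2" using assms(2) by (intro inner_E_stable) blast
    show "(inner u (E p))\<^sup>2 / inner (E p) (E p) = 2 / pi * (inner u (E p))\<^sup>2"
      unfolding i by simp
  qed
  finally show ?thesis by (simp add: field_simps)
qed

lemma bessel_summable: "(\<lambda>p. (inner u (E p))\<^sup>2) summable_on stable"
proof (rule nonneg_bdd_above_summable_on)
  show "bdd_above (sum (\<lambda>p. (inner u (E p))\<^sup>2) ` {F. F \<subseteq> stable \<and> finite F})"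
    using bessel_stable[of _ u] unfolding bdd_above_def by blast
qed simp

text \<open>For \<open>u\<close> in the stable subspace the sine coefficients are those of \<open>A u\<close> divided by the
  eigenvalues. By the Cauchy-Schwarz inequality their absolute values have a sum controlled by
  Bessel's inequality for \<open>A u\<close> and the square summability of the inverse eigenvalues.\<close>
lemma sup_bound:
  obtains K where "0 \<le> K" "\<And>u. u \<in> H1 \<Longrightarrow> u \<in> closure (span (E ` stable)) \<Longrightarrow>
    AE x in leb. norm (rep_L2 u x) \<le> K * norm (A u)"
proof -
  define B where "B = (\<Sum>\<^sub>\<infinity>(m, n)\<in>stable. 1 / (\<beta> m n)\<^sup>2)"
  define K where "K = 2 / pi * (sqrt (pi / 2) * sqrt B)"
  have B0: "0 \<le> B" unfolding B_def by (rule infsum_nonneg) auto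
  have "AE x in leb. norm (rep_L2 u x) \<le> K * norm (A u)"
    if u: "u \<in> H1" and cl: "u \<in> closure (span (E ` stable))" for u
  proof (rule AE_bounded_limit)
    fix d :: real assume d: "0 < d"
    define v where "v = (\<lambda>(m, n). (2 / pi * inner u (E (m, n))) *\<^sub>R \<alpha> m n)"
    have hs: "((\<lambda>p. (inner u (E p) / inner (E p) (E p)) *\<^sub>R E p) has_sum u) stable"
      by (rule fourier_has_sum[OF orthogonal_stable cl])
    obtain F where F: "finite F" "F \<subseteq> stable"
      "dist (\<Sum>p\<in>F. (inner u (E p) / inner (E p) (E p)) *\<^sub>R E p) u < d"
      using has_sum_finite_approximation[OF hs, of "d / 2"] d by force
    define g where "g x = (\<Sum>p\<in>F. sin (real (fst p) * x) *\<^sub>R v p)" for x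
    have gL: "g \<in> L2_funs" unfolding g_def by (intro L2_funs_sum sin_scaleR_in_L2_funs)
    have "L2_of g = (\<Sum>p\<in>F. mode (v p) (fst p))"
      unfolding g_def by (subst L2_of_sum) (auto simp: sin_scaleR_in_L2_funs mode_def)
    also have "\<dots> = (\<Sum>p\<in>F. (inner u (E p) / inner (E p) (E p)) *\<^sub>R E p)"
    proof (rule sum.cong[OF refl])
      fix p assume "p \<in> F"
      then have i: "inner (E p) (E p) = pi / 2" using F(2) by (intro inner_E_stable) blast
      show "mode (v p) (fst p) = (inner u (E p) / inner (E p) (E p)) *\<^sub>R E p"
        unfolding i by (cases p) (simp add: v_def mode_scaleR E_def)
    qed
    finally have "norm (u - L2_of g) < d" using F(3) by (simp add: dist_norm norm_minus_commute)
    moreover have "norm (g x) \<le> K * norm (A u)" for x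
    proof -
      have "norm (g x) \<le> (\<Sum>p\<in>F. norm (v p))"
        unfolding g_def by (rule sum_norm_le) (simp add: mult_left_le_one_le)
      also have "\<dots> = (\<Sum>p\<in>F. 2 / pi * (\<bar>inner (A u) (E p)\<bar> * (1 / \<bar>case p of (m, n) \<Rightarrow> \<beta> m n\<bar>)))"
      proof (rule sum.cong[OF refl])
        fix p assume "p \<in> F"
        then obtain m n where p: "p = (m, n)" "1 \<le> m" "n \<in> {1, 2}" "(m, n) \<noteq> (c, 1)"
          using F(2) by (auto simp: stable_def)
        then show "norm (v p) = 2 / pi * (\<bar>inner (A u) (E p)\<bar> * (1 / \<bar>case p of (m, n) \<Rightarrow> \<beta> m n\<bar>))"
          using norm_\<alpha>[of m n] inner_A_mode[OF u, of m n] noncritical[of m n]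
          by (simp add: v_def E_def abs_mult)
      qed
      also have "\<dots> = 2 / pi * (\<Sum>p\<in>F. \<bar>inner (A u) (E p)\<bar> * \<bar>1 / (case p of (m, n) \<Rightarrow> \<beta> m n)\<bar>)"
        by (simp add: sum_distrib_left)
      also have "\<dots> \<le> 2 / pi * (L2_set (\<lambda>p. inner (A u) (E p)) F * L2_set (\<lambda>p. 1 / (case p of (m, n) \<Rightarrow> \<beta> m n)) F)"
        by (intro mult_left_mono L2_set_mult_ineq) simp
      also have "\<dots> \<le> 2 / pi * ((sqrt (pi / 2) * norm (A u)) * sqrt B)"
      proof (intro mult_left_mono mult_mono)
        have "(\<Sum>p\<in>F. (inner (A u) (E p))\<^sup>2) \<le> pi / 2 * (norm (A u))\<^sup>2"
          by (rule bessel_stable[OF F(1,2)])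
        then have "sqrt (\<Sum>p\<in>F. (inner (A u) (E p))\<^sup>2) \<le> sqrt (pi / 2 * (norm (A u))\<^sup>2)" by simp
        then show "L2_set (\<lambda>p. inner (A u) (E p)) F \<le> sqrt (pi / 2) * norm (A u)"
          unfolding L2_set_def by (simp only: real_sqrt_mult real_sqrt_abs abs_norm_cancel)
        have "(\<Sum>p\<in>F. (1 / (case p of (m, n) \<Rightarrow> \<beta> m n))\<^sup>2) \<le> B"
        proof -
          have "(\<lambda>p. (1 / (case p of (m, n) \<Rightarrow> \<beta> m n))\<^sup>2) = (\<lambda>(m, n). 1 / (\<beta> m n)\<^sup>2)"
            by (auto simp: power_divide)
          then show ?thesis unfolding B_def using summable_inverse_squares F
            by (simp only:) (rule finite_sum_le_infsum, auto)
        qed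
        then show "L2_set (\<lambda>p. 1 / (case p of (m, n) \<Rightarrow> \<beta> m n)) F \<le> sqrt B"
          unfolding L2_set_def by simp
      qed (auto simp: B0 L2_set_nonneg)
      also have "\<dots> = K * norm (A u)" by (simp add: K_def)
      finally show ?thesis .
    qed
    ultimately show "\<exists>g\<in>L2_funs. (\<forall>x. norm (g x) \<le> K * norm (A u)) \<and> norm (u - L2_of g) < d"
      using gL by blast
  qed
  moreover have "0 \<le> K" by (simp add: K_def B0)
  ultimately show ?thesis using that by blast
qed

text \<open>The terms are products of two square summable families.\<close>
lemma resolvent_coefficients_summable:
  "(\<lambda>p. \<bar>inner u (E p) / \<beta> (fst p) (snd p)\<bar>) summable_on stable"
proof (rule summable_on_comparison_test)
  have "(\<lambda>p. 1 / (\<beta> (fst p) (snd p))\<^sup>2) summable_on stable"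
    using summable_inverse_squares by (simp add: case_prod_unfold)
  then show "(\<lambda>p. (inner u (E p))\<^sup>2 + 1 / (\<beta> (fst p) (snd p))\<^sup>2) summable_on stable"
    by (intro summable_on_add bessel_summable)
  fix p
  have "\<bar>x * y\<bar> \<le> x\<^sup>2 + y\<^sup>2" for x y :: real
    using zero_le_power2[of "\<bar>x\<bar> - \<bar>y\<bar>"] zero_le_power2[of x] zero_le_power2[of y]
    unfolding power2_diff abs_mult power2_abs by linarith
  from this[of "inner u (E p)" "1 / \<beta> (fst p) (snd p)"]
  show "\<bar>inner u (E p) / \<beta> (fst p) (snd p)\<bar> \<le> (inner u (E p))\<^sup>2 + 1 / (\<beta> (fst p) (snd p))\<^sup>2"
    by (simp add: power_divide)
qed auto

text \<open>Expressing the pairing through \<open>A u\<close> is what makes the invariance equation, which determines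
  \<open>A (\<Phi> s)\<close>, applicable.\<close>
lemma inner_by_modes:
  assumes u: "u \<in> H1" "u \<in> closure (span (E ` stable))"
  shows "((\<lambda>p. 2 / pi * (inner v (E p) / \<beta> (fst p) (snd p)) * inner (A u) (E p)) has_sum inner u v) stable"
proof -
  have "((\<lambda>p. inner ((inner u (E p) / inner (E p) (E p)) *\<^sub>R E p) v) has_sum inner u v) stable"
    by (rule has_sum_bounded_linear[OF bounded_linear_inner_left fourier_has_sum[OF orthogonal_stable u(2)]])
  then show ?thesis
  proof (rule has_sum_cong[THEN iffD1, rotated])
    fix p assume p: "p \<in> stable"
    have i: "inner (E p) (E p) = pi / 2" by (rule inner_E_stable[OF p])
    obtain m n where mn: "p = (m, n)" "1 \<le> m" "n \<in> {1, 2}" "(m, n) \<noteq> (c, 1)"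
      using p by (auto simp: stable_def)
    have "inner (A u) (E p) = \<beta> m n * inner u (E p)"
      using inner_A_mode[OF u(1) mn(2,3)] by (simp add: mn(1) E_def)
    then show "inner ((inner u (E p) / inner (E p) (E p)) *\<^sub>R E p) v =
        2 / pi * (inner v (E p) / \<beta> (fst p) (snd p)) * inner (A u) (E p)"
      unfolding inner_scaleR_left i inner_commute[of "E p" v]
      using noncritical[OF mn(2,3,4)] by (simp add: mn(1))
  qed
qed

end

section \<open>Expansion of the nonlinearity\<close>

definition hom_part :: "(nat \<Rightarrow> nat \<Rightarrow> real \<times> real) \<Rightarrow> nat \<Rightarrow> real \<times> real \<Rightarrow> real \<times> real" where
  "hom_part a N w = (\<Sum>(k, l)\<in>{(k, l). k + l = N}. (fst w ^ k * snd w ^ l) *\<^sub>R a k l)"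

text \<open>The derivative of the homogeneous part of degree \<open>N\<close> at \<open>w\<close> in the direction \<open>h\<close>. The exponents
  \<open>k - 1\<close> and \<open>l - 1\<close> are truncated only where the prefactor vanishes.\<close>
definition hom_deriv :: "(nat \<Rightarrow> nat \<Rightarrow> real \<times> real) \<Rightarrow> nat \<Rightarrow> real \<times> real \<Rightarrow> real \<times> real \<Rightarrow> real \<times> real" where
  "hom_deriv a N w h = (\<Sum>(k, l)\<in>{(k, l). k + l = N}.
     (real k * fst w ^ (k - 1) * snd w ^ l * fst h + real l * fst w ^ k * snd w ^ (l - 1) * snd h) *\<^sub>R a k l)"

lemma finite_degree [simp]: "finite {(k, l). k + l = (N::nat)}"
  by (rule finite_subset[of _ "{..N} \<times> {..N}"]) auto

lemma abs_fst_snd_le: "\<bar>fst w\<bar> \<le> norm w" "\<bar>snd w\<bar> \<le> norm w" for w :: "real \<times> real"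
  using norm_fst_le[of "fst w" "snd w"] norm_snd_le[of "snd w" "fst w"] by auto

text \<open>The limsup controls all coefficients but finitely many, which the constant \<open>C\<close> absorbs.\<close>
lemma coefficient_bound:
  assumes "nonlinearity_assms a"
  obtains C B where "1 \<le> B" "0 \<le> C" "\<And>k l. norm (a k l) \<le> C * B ^ (k + l)"
proof -
  obtain b where b: "Limsup (filtercomap (\<lambda>(k, l). k + l) sequentially)
       (\<lambda>(k, l). ereal (root (k + l) (norm (a k l)))) < ereal b"
    using assms unfolding nonlinearity_assms_def by (meson less_PInf_Ex_of_nat ereal_dense2)
  have "eventually (\<lambda>(k, l). root (k + l) (norm (a k l)) < b) (filtercomap (\<lambda>(k, l). k + l) sequentially)"
    using Limsup_lessD[OF b] by (simp add: case_prod_unfold)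
  then obtain N where N: "\<And>k l. N \<le> k + l \<Longrightarrow> root (k + l) (norm (a k l)) < b"
    by (auto simp: eventually_filtercomap eventually_sequentially)
  define B where "B = max 1 b"
  define C where "C = 1 + (\<Sum>(k, l)\<in>{..N} \<times> {..N}. norm (a k l))"
  have B: "1 \<le> B" by (simp add: B_def)
  have C1: "1 \<le> C" unfolding C_def by (auto intro!: sum_nonneg)
  have "norm (a k l) \<le> C * B ^ (k + l)" for k l
  proof (cases "N < k + l")
    case True
    then have "root (k + l) (norm (a k l)) \<le> B" using N[of k l] by (simp add: B_def)
    then have "root (k + l) (norm (a k l)) ^ (k + l) \<le> B ^ (k + l)"
      by (intro power_mono) (auto intro: real_root_ge_zero)
    moreover have "root (k + l) (norm (a k l)) ^ (k + l) = norm (a k l)"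
      by (rule real_root_pow_pos2) (use True in auto)
    ultimately have "norm (a k l) \<le> 1 * B ^ (k + l)" by linarith
    also have "\<dots> \<le> C * B ^ (k + l)" using C1 B by (intro mult_right_mono) auto
    finally show ?thesis .
  next
    case False
    have "norm (a k l) \<le> (\<Sum>(k, l)\<in>{..N} \<times> {..N}. norm (a k l))"
      using member_le_sum[of "(k, l)" "{..N} \<times> {..N}" "\<lambda>(k, l). norm (a k l)"] False by auto
    also have "\<dots> \<le> C * 1" by (simp add: C_def)
    also have "\<dots> \<le> C * B ^ (k + l)" using C1 B by (intro mult_left_mono one_le_power) auto
    finally show ?thesis .
  qed
  then show ?thesis using that[OF B, of C] C1 by auto
qed

lemma half_powers_summable: "(\<lambda>(k, l). (1/2::real) ^ k * (1/2) ^ l) summable_on UNIV"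
proof -
  have g: "((\<lambda>k. (1/2::real) ^ k) has_sum 2) UNIV"
    using geometric_sums[of "1/2::real"] by (intro sums_nonneg_imp_has_sum) auto
  have "(\<lambda>(k, l). (1/2::real) ^ k * (1/2) ^ l) summable_on UNIV \<times> UNIV"
  proof (rule summable_on_SigmaI)
    show "((\<lambda>l. case (k, l) of (k, l) \<Rightarrow> (1/2::real) ^ k * (1/2) ^ l) has_sum (1/2) ^ k * 2) UNIV" for k :: nat
      using has_sum_cmult_right[OF g, of "(1/2) ^ k"] by simp
    show "(\<lambda>k. (1/2::real) ^ k * 2) summable_on UNIV"
      by (intro summable_on_cmult_left has_sum_imp_summable[OF g])
  qed auto
  then show ?thesis by simp
qed

lemma sum_degrees:
  fixes K :: nat
  shows "(\<Sum>p\<in>{(k, l). 2 \<le> k + l \<and> k + l \<le> K}. f p) = (\<Sum>N=2..K. \<Sum>p\<in>{(k, l). k + l = N}. f p)"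
proof -
  have "{(k, l). 2 \<le> k + l \<and> k + l \<le> K} = (\<Union>N\<in>{2..K}. {(k, l). k + l = N})" by auto
  then show ?thesis by (simp only:) (rule sum.UNION_disjoint, auto)
qed

text \<open>The remainder of the power series after degree \<open>K\<close> is dominated by a geometric series; a
  single radius and constant work for all \<open>K\<close>.\<close>
lemma nonlinearity_expansion:
  assumes "nonlinearity_assms a"
  obtains C \<rho> where "0 < \<rho>" "0 \<le> C" "\<And>w K. norm w \<le> \<rho> \<Longrightarrow>
    norm (nonlinearity a w - (\<Sum>N=2..K. hom_part a N w)) \<le> C * (norm w / (2 * \<rho>)) ^ (K + 1)"
proof -
  obtain C B where B: "1 \<le> B" and C: "0 \<le> C" and a: "\<And>k l. norm (a k l) \<le> C * B ^ (k + l)"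
    using coefficient_bound[OF assms] by metis
  \<comment> \<open>With this radius \<open>B |w| = r / 2\<close> where \<open>r \<le> 1\<close>: the powers of \<open>r\<close> give the order in \<open>w\<close>
    and those of \<open>1 / 2\<close> the convergence.\<close>
  define \<rho> where "\<rho> = 1 / (4 * B)"
  define H where "H = (\<Sum>\<^sub>\<infinity>(k, l). (1/2::real) ^ k * (1/2) ^ l)"
  have H: "((\<lambda>(k, l). (1/2::real) ^ k * (1/2) ^ l) has_sum H) UNIV"
    unfolding H_def by (rule has_sum_infsum[OF half_powers_summable])
  have H0: "0 \<le> H" unfolding H_def by (rule infsum_nonneg) auto
  have "norm (nonlinearity a w - (\<Sum>N=2..K. hom_part a N w)) \<le> C * H * (norm w / (2 * \<rho>)) ^ (K + 1)"
    if w: "norm w \<le> \<rho>" for w K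
  proof -
    define f where "f = (\<lambda>(k, l). (fst w ^ k * snd w ^ l) *\<^sub>R a k l)"
    define r where "r = norm w / (2 * \<rho>)"
    have r: "0 \<le> r" "r \<le> 1" "B * norm w = r / 2"
      using w B by (auto simp: r_def \<rho>_def field_simps)
    have fb: "norm (f (k, l)) \<le> C * r ^ (k + l) * ((1/2) ^ k * (1/2) ^ l)" for k l
    proof -
      have "\<bar>fst w\<bar> ^ k * \<bar>snd w\<bar> ^ l \<le> norm w ^ k * norm w ^ l"
        by (intro mult_mono power_mono abs_fst_snd_le) auto
      then have "norm (f (k, l)) \<le> norm w ^ (k + l) * (C * B ^ (k + l))"
        unfolding f_def by (simp add: abs_mult power_abs power_add[symmetric]) (intro mult_mono a, auto)
      also have "\<dots> = C * (B * norm w) ^ (k + l)" by (simp add: power_mult_distrib)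
      also have "\<dots> = C * r ^ (k + l) * ((1/2) ^ k * (1/2) ^ l)"
        unfolding r(3) by (simp add: power_divide power_add)
      finally show ?thesis .
    qed
    have fs: "(\<lambda>p. norm (f p)) summable_on UNIV"
    proof (rule Infinite_Sum.abs_summable_on_comparison_test')
      show "(\<lambda>p. C * (case p of (k, l) \<Rightarrow> (1/2) ^ k * (1/2) ^ l)) summable_on UNIV"
        by (intro summable_on_cmult_right half_powers_summable)
      fix p :: "nat \<times> nat"
      obtain k l where p: "p = (k, l)" by (cases p)
      have "C * r ^ (k + l) * ((1/2) ^ k * (1/2) ^ l) \<le> C * 1 * ((1/2) ^ k * (1/2) ^ l)"
        by (intro mult_right_mono mult_left_mono power_le_one) (use r C in auto)
      then show "norm (f p) \<le> C * (case p of (k, l) \<Rightarrow> (1/2) ^ k * (1/2) ^ l)"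
        using fb[of k l] by (simp add: p)
    qed
    have fs': "f summable_on S" for S
      by (rule summable_on_subset_banach[OF Infinite_Sum.abs_summable_summable[OF fs]]) simp
    let ?low = "{(k, l). 2 \<le> k + l \<and> k + l \<le> K}" and ?high = "{(k, l). 2 \<le> k + l \<and> K + 1 \<le> k + l}"
    have fin: "finite ?low" by (rule finite_subset[of _ "{..K} \<times> {..K}"]) auto
    have "nonlinearity a w = infsum f {(k, l). 2 \<le> k + l}"
      by (simp add: nonlinearity_def f_def case_prod_unfold)
    also have "{(k, l). 2 \<le> k + l} = ?low \<union> ?high" by auto
    also have "infsum f (?low \<union> ?high) = infsum f ?low + infsum f ?high"
      by (rule infsum_Un_disjoint) (auto intro: fs')
    also have "infsum f ?low = (\<Sum>N=2..K. hom_part a N w)"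
      using fin by (simp add: sum_degrees hom_part_def f_def)
    finally have "nonlinearity a w - (\<Sum>N=2..K. hom_part a N w) = infsum f ?high" by simp
    also have "norm \<dots> \<le> C * r ^ (K + 1) * infsum (\<lambda>(k, l). (1/2) ^ k * (1/2) ^ l) ?high"
    proof (rule norm_infsum_le)
      show "(f has_sum infsum f ?high) ?high" by (intro has_sum_infsum fs')
      show "((\<lambda>p. C * r ^ (K + 1) * (case p of (k, l) \<Rightarrow> (1/2) ^ k * (1/2) ^ l)) has_sum
          C * r ^ (K + 1) * infsum (\<lambda>(k, l). (1/2) ^ k * (1/2) ^ l) ?high) ?high"
        by (intro has_sum_cmult_right has_sum_infsum summable_on_subset_banach[OF half_powers_summable]) auto
      fix p assume "p \<in> ?high"
      then obtain k l where p: "p = (k, l)" "K + 1 \<le> k + l" by auto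
      have "C * r ^ (k + l) * ((1/2) ^ k * (1/2) ^ l) \<le> C * r ^ (K + 1) * ((1/2) ^ k * (1/2) ^ l)"
        using p r C by (intro mult_right_mono mult_left_mono power_decreasing) auto
      then show "norm (f p) \<le> C * r ^ (K + 1) * (case p of (k, l) \<Rightarrow> (1/2) ^ k * (1/2) ^ l)"
        using fb[of k l] by (simp add: p)
    qed
    also have "\<dots> \<le> C * r ^ (K + 1) * H"
    proof (intro mult_left_mono)
      show "infsum (\<lambda>(k, l). (1/2::real) ^ k * (1/2) ^ l) ?high \<le> H"
        unfolding H_def
        by (intro infsum_mono_neutral summable_on_subset_banach[OF half_powers_summable] half_powers_summable) auto
    qed (use C r in auto)
    finally show ?thesis by (simp add: r_def mult_ac)
  qed
  moreover have "0 < \<rho>" using B by (simp add: \<rho>_def)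
  ultimately show ?thesis using that[of \<rho> "C * H"] C H0 by auto
qed

lemma continuous_hom_part [continuous_intros]: "continuous_on S (hom_part a N)"
  unfolding hom_part_def case_prod_unfold by (intro continuous_intros)

lemma nonlinearity_continuous:
  assumes "nonlinearity_assms a"
  obtains \<rho> where "0 < \<rho>" "continuous_on (cball 0 \<rho>) (nonlinearity a)"
proof -
  obtain C \<rho> where \<rho>: "0 < \<rho>" and C: "0 \<le> C" and b: "\<And>w K. norm w \<le> \<rho> \<Longrightarrow>
    norm (nonlinearity a w - (\<Sum>N=2..K. hom_part a N w)) \<le> C * (norm w / (2 * \<rho>)) ^ (K + 1)"
    using nonlinearity_expansion[OF assms] by metis
  have "uniform_limit (cball 0 \<rho>) (\<lambda>K w. \<Sum>N=2..K. hom_part a N w) (nonlinearity a) sequentially"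
    unfolding uniform_limit_iff
  proof (intro allI impI)
    fix e :: real assume e: "0 < e"
    have "(\<lambda>K. C * (1/2) ^ (K + 1)) \<longlonglongrightarrow> C * 0"
      by (intro tendsto_intros LIMSEQ_ignore_initial_segment LIMSEQ_power_zero) simp
    then have "\<forall>\<^sub>F K in sequentially. C * (1/2) ^ (K + 1) < e"
      using e by (intro order_tendstoD) auto
    then show "\<forall>\<^sub>F K in sequentially. \<forall>w\<in>cball 0 \<rho>. dist (\<Sum>N=2..K. hom_part a N w) (nonlinearity a w) < e"
    proof eventually_elim
      case (elim K)
      show ?case
      proof
        fix w :: "real \<times> real" assume "w \<in> cball 0 \<rho>"
        then have w: "norm w \<le> \<rho>" by simp
        have "(norm w / (2 * \<rho>)) ^ (K + 1) \<le> (1/2) ^ (K + 1)"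
          using w \<rho> by (intro power_mono) (auto simp: field_simps)
        then have "C * (norm w / (2 * \<rho>)) ^ (K + 1) \<le> C * (1/2) ^ (K + 1)"
          using C by (intro mult_left_mono) auto
        then show "dist (\<Sum>N=2..K. hom_part a N w) (nonlinearity a w) < e"
          using b[OF w, of K] elim by (simp add: dist_norm norm_minus_commute)
      qed
    qed
  qed
  then have "continuous_on (cball 0 \<rho>) (nonlinearity a)"
    by (rule uniform_limit_theorem[rotated]) (auto intro!: always_eventually continuous_intros)
  then show ?thesis using \<rho> that by blast
qed

lemma power_taylor:
  fixes x h :: real
  assumes "\<bar>x\<bar> \<le> 1" "\<bar>h\<bar> \<le> 1"
  shows "\<bar>(x + h) ^ k - x ^ k - real k * x ^ (k - 1) * h\<bar> \<le> 4 ^ k * h\<^sup>2"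
proof (induction k)
  case (Suc k)
  let ?R = "(x + h) ^ k - x ^ k - real k * x ^ (k - 1) * h"
  have x: "x * (real k * x ^ (k - 1)) = real k * x ^ k"
    by (cases k) auto
  have "(x + h) ^ Suc k - x ^ Suc k - real (Suc k) * x ^ (Suc k - 1) * h
      = (x + h) * ?R + real k * x ^ (k - 1) * h\<^sup>2"
    using arg_cong[OF x, of "\<lambda>z. z * h"] by (simp add: algebra_simps power2_eq_square)
  also have "\<bar>\<dots>\<bar> \<le> \<bar>x + h\<bar> * \<bar>?R\<bar> + \<bar>real k * x ^ (k - 1) * h\<^sup>2\<bar>"
    using abs_triangle_ineq[of "(x + h) * ?R" "real k * x ^ (k - 1) * h\<^sup>2"]
    unfolding abs_mult[of "x + h" ?R] .
  also have "\<dots> \<le> 2 * (4 ^ k * h\<^sup>2) + 4 ^ k * h\<^sup>2"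
  proof (intro add_mono mult_mono Suc.IH)
    have "real k \<le> 4 ^ k" using of_nat_less_two_power[of k, where 'a = real]
      power_mono[of "2::real" 4 k] by simp
    moreover have "\<bar>x\<bar> ^ (k - 1) \<le> 1" using assms by (intro power_le_one) auto
    ultimately have "real k * \<bar>x\<bar> ^ (k - 1) \<le> 4 ^ k * 1" by (intro mult_mono) auto
    then show "\<bar>real k * x ^ (k - 1) * h\<^sup>2\<bar> \<le> 4 ^ k * h\<^sup>2"
      by (simp add: abs_mult power_abs) (rule mult_right_mono, auto)
  qed (use assms in auto)
  also have "\<dots> \<le> 4 ^ Suc k * h\<^sup>2" by simp
  finally show ?case .
qed simp

text \<open>Each factor is split into its value, its linear part and a quadratic remainder; in the product
  the linear parts multiply to a quadratic term, and every term with a remainder is quadratic as well.\<close>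
lemma monomial_taylor:
  fixes x y h j :: real
  assumes "\<bar>x\<bar> \<le> 1" "\<bar>y\<bar> \<le> 1" "\<bar>h\<bar> \<le> r" "\<bar>j\<bar> \<le> r" "r \<le> 1"
  shows "\<bar>(x + h) ^ k * (y + j) ^ l - x ^ k * y ^ l -
     (real k * x ^ (k - 1) * y ^ l * h + real l * x ^ k * y ^ (l - 1) * j)\<bar> \<le> 4 * 4 ^ k * 4 ^ l * r\<^sup>2"
proof -
  define R where "R = (x + h) ^ k - x ^ k - real k * x ^ (k - 1) * h"
  define S where "S = (y + j) ^ l - y ^ l - real l * y ^ (l - 1) * j"
  define p q where "p = real k * x ^ (k - 1) * h" and "q = real l * y ^ (l - 1) * j"
  have hj: "\<bar>h\<bar> \<le> 1" "\<bar>j\<bar> \<le> 1" and r: "0 \<le> r" using assms by auto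
  have h2: "h\<^sup>2 \<le> r\<^sup>2" "j\<^sup>2 \<le> r\<^sup>2"
    using assms power_mono[of "\<bar>h\<bar>" r 2] power_mono[of "\<bar>j\<bar>" r 2] by auto
  have R: "\<bar>R\<bar> \<le> 4 ^ k * r\<^sup>2" and S: "\<bar>S\<bar> \<le> 4 ^ l * r\<^sup>2"
    unfolding R_def S_def using power_taylor[OF assms(1) hj(1), of k] power_taylor[OF assms(2) hj(2), of l] h2
    by (meson mult_left_mono order_trans zero_le_numeral zero_le_power)+
  have lin: "\<bar>real i * z ^ (i - 1) * g\<bar> \<le> 2 ^ i * r" if "\<bar>z\<bar> \<le> 1" "\<bar>g\<bar> \<le> r" for i :: nat and z g :: real
  proof -
    have "\<bar>z\<bar> ^ (i - 1) \<le> 1" using that by (intro power_le_one) auto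
    then have "real i * \<bar>z\<bar> ^ (i - 1) * \<bar>g\<bar> \<le> 2 ^ i * 1 * r"
      using of_nat_less_two_power[of i, where 'a = real] that by (intro mult_mono) auto
    then show ?thesis by (simp add: abs_mult power_abs)
  qed
  have p: "\<bar>p\<bar> \<le> 2 ^ k * r" and q: "\<bar>q\<bar> \<le> 2 ^ l * r"
    unfolding p_def q_def using lin[OF assms(1,3), of k] lin[OF assms(2,4), of l] by simp_all
  have two: "(2::real) ^ i \<le> 4 ^ i" for i by (rule power_mono) auto
  have Y: "\<bar>(y + j) ^ l\<bar> \<le> 4 ^ l" 
    using power_mono[of "\<bar>y + j\<bar>" 2 l] assms two[of l] abs_triangle_ineq[of y j]
    by (simp add: power_abs)
  have X: "\<bar>x ^ k\<bar> \<le> 4 ^ k"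
  proof -
    have "\<bar>x ^ k\<bar> \<le> 1" unfolding power_abs using assms by (intro power_le_one) auto
    also have "1 \<le> (4::real) ^ k" by (rule one_le_power) simp
    finally show ?thesis .
  qed
  have pr: "\<bar>p\<bar> \<le> 4 ^ k"
    using order_trans[OF p mult_mono[OF two[of k] assms(5)]] r by simp
  have XP: "\<bar>x ^ k + p\<bar> \<le> 4 ^ k + 4 ^ k"
    using abs_triangle_ineq[of "x ^ k" p] X pr by linarith
  have xh: "(x + h) ^ k = x ^ k + p + R" and yj: "(y + j) ^ l = y ^ l + q + S"
    by (simp_all add: R_def S_def p_def q_def)
  have "(x + h) ^ k * (y + j) ^ l - x ^ k * y ^ l - (p * y ^ l + x ^ k * q) =
      R * (y + j) ^ l + (p * q + (x ^ k + p) * S)"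
    unfolding xh yj by (simp add: algebra_simps)
  also have "\<bar>\<dots>\<bar> \<le> \<bar>R\<bar> * \<bar>(y + j) ^ l\<bar> + (\<bar>p\<bar> * \<bar>q\<bar> + \<bar>x ^ k + p\<bar> * \<bar>S\<bar>)"
    using abs_triangle_ineq[of "R * (y + j) ^ l" "p * q + (x ^ k + p) * S"]
      abs_triangle_ineq[of "p * q" "(x ^ k + p) * S"]
    unfolding abs_mult by linarith
  also have "\<dots> \<le> (4 ^ k * r\<^sup>2) * 4 ^ l + ((2 ^ k * r) * (2 ^ l * r) + (4 ^ k + 4 ^ k) * (4 ^ l * r\<^sup>2))"
    by (intro add_mono mult_mono R S p q XP Y) (use r in auto)
  also have "\<dots> = (3 * (4 ^ k * 4 ^ l) + 2 ^ k * 2 ^ l) * r\<^sup>2"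
    by (simp add: algebra_simps power2_eq_square)
  also have "\<dots> \<le> (3 * (4 ^ k * 4 ^ l) + 4 ^ k * 4 ^ l) * r\<^sup>2"
    by (intro mult_right_mono add_left_mono mult_mono two) auto
  finally show ?thesis by (simp add: p_def q_def mult_ac)
qed

lemma hom_part_scaleR: "hom_part a N (t *\<^sub>R w) = t ^ N *\<^sub>R hom_part a N w"
  unfolding hom_part_def scaleR_sum_right
  by (rule sum.cong) (auto simp: power_mult_distrib power_add mult_ac)

lemma hom_part_taylor:
  obtains C where "0 \<le> C" "\<And>t w h. \<bar>t\<bar> \<le> 1 \<Longrightarrow> norm w \<le> 1 \<Longrightarrow> norm h \<le> 1 \<Longrightarrow>
    norm (hom_part a N (t *\<^sub>R w + h) - t ^ N *\<^sub>R hom_part a N w - t ^ (N - 1) *\<^sub>R hom_deriv a N w h)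
      \<le> C * (norm h)\<^sup>2"
proof -
  let ?I = "{(k, l). k + l = N}"
  define C where "C = (\<Sum>(k, l)\<in>?I. 4 * 4 ^ k * 4 ^ l * norm (a k l))"
  have "norm (hom_part a N (t *\<^sub>R w + h) - t ^ N *\<^sub>R hom_part a N w - t ^ (N - 1) *\<^sub>R hom_deriv a N w h)
      \<le> C * (norm h)\<^sup>2"
    if t: "\<bar>t\<bar> \<le> 1" and w: "norm w \<le> 1" and h: "norm h \<le> 1" for t w h
  proof -
    define D where "D = (\<lambda>(k, l). (t * fst w + fst h) ^ k * (t * snd w + snd h) ^ l
        - (t * fst w) ^ k * (t * snd w) ^ l
        - (real k * (t * fst w) ^ (k - 1) * (t * snd w) ^ l * fst h
          + real l * (t * fst w) ^ k * (t * snd w) ^ (l - 1) * snd h))"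
    have "hom_part a N (t *\<^sub>R w + h) - t ^ N *\<^sub>R hom_part a N w - t ^ (N - 1) *\<^sub>R hom_deriv a N w h
      = (\<Sum>(k, l)\<in>?I. D (k, l) *\<^sub>R a k l)"
      unfolding hom_part_scaleR[symmetric]
      unfolding hom_part_def hom_deriv_def scaleR_sum_right sum_subtractf[symmetric]
    proof (rule sum.cong[OF refl], clarify)
      fix k l assume N: "N = k + l"
      have 1: "t ^ (k + l - 1) * (real k * fst w ^ (k - 1) * snd w ^ l * fst h) =
          real k * (t * fst w) ^ (k - 1) * (t * snd w) ^ l * fst h"
        by (cases k) (auto simp: power_mult_distrib power_add mult_ac)
      have 2: "t ^ (k + l - 1) * (real l * fst w ^ k * snd w ^ (l - 1) * snd h) =
          real l * (t * fst w) ^ k * (t * snd w) ^ (l - 1) * snd h"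
        by (cases l) (auto simp: power_mult_distrib power_add mult_ac)
      show "(fst (t *\<^sub>R w + h) ^ k * snd (t *\<^sub>R w + h) ^ l) *\<^sub>R a k l -
          (fst (t *\<^sub>R w) ^ k * snd (t *\<^sub>R w) ^ l) *\<^sub>R a k l -
          t ^ (k + l - 1) *\<^sub>R (real k * fst w ^ (k - 1) * snd w ^ l * fst h
            + real l * fst w ^ k * snd w ^ (l - 1) * snd h) *\<^sub>R a k l = D (k, l) *\<^sub>R a k l"
        unfolding D_def scaleR_scaleR distrib_left 1 2
        by (simp add: scaleR_diff_left)
    qed
    also have "norm \<dots> \<le> (\<Sum>(k, l)\<in>?I. 4 * 4 ^ k * 4 ^ l * norm (a k l) * (norm h)\<^sup>2)"
    proof (rule sum_norm_le, clarify)
      fix k l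
      have "\<bar>t * fst w\<bar> \<le> 1" "\<bar>t * snd w\<bar> \<le> 1"
        using t w abs_fst_snd_le[of w] mult_mono[of "\<bar>t\<bar>" 1 "\<bar>fst w\<bar>" 1] mult_mono[of "\<bar>t\<bar>" 1 "\<bar>snd w\<bar>" 1]
        by (auto simp: abs_mult)
      then have "\<bar>D (k, l)\<bar> \<le> 4 * 4 ^ k * 4 ^ l * (norm h)\<^sup>2"
        unfolding D_def using h abs_fst_snd_le[of h] by (simp only: case_prod_conv) (rule monomial_taylor)
      then have "\<bar>D (k, l)\<bar> * norm (a k l) \<le> 4 * 4 ^ k * 4 ^ l * (norm h)\<^sup>2 * norm (a k l)"
        by (rule mult_right_mono) simp
      then show "norm (D (k, l) *\<^sub>R a k l) \<le> 4 * 4 ^ k * 4 ^ l * norm (a k l) * (norm h)\<^sup>2"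
        by (simp add: mult_ac)
    qed
    also have "\<dots> = C * (norm h)\<^sup>2" by (simp add: C_def sum_distrib_right case_prod_unfold)
    finally show ?thesis .
  qed
  moreover have "0 \<le> C" unfolding C_def by (intro sum_nonneg) auto
  ultimately show ?thesis using that by blast
qed

lemma hom_deriv_bound:
  obtains C where "0 \<le> C" "\<And>w h. norm w \<le> 1 \<Longrightarrow> norm (hom_deriv a N w h) \<le> C * norm h"
proof -
  let ?I = "{(k, l). k + l = N}"
  define C where "C = (\<Sum>(k, l)\<in>?I. real (k + l) * norm (a k l))"
  have "norm (hom_deriv a N w h) \<le> C * norm h" if w: "norm w \<le> 1" for w h
  proof -
    have "norm (hom_deriv a N w h) \<le> (\<Sum>(k, l)\<in>?I. real (k + l) * norm (a k l) * norm h)"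
      unfolding hom_deriv_def
    proof (rule sum_norm_le, clarify)
      fix k l
      have p: "\<bar>fst w\<bar> ^ i \<le> 1" "\<bar>snd w\<bar> ^ i \<le> 1" for i
        using w abs_fst_snd_le[of w] by (auto intro!: power_le_one)
      have m: "u * v \<le> 1" if "0 \<le> u" "u \<le> 1" "0 \<le> v" "v \<le> 1" for u v :: real
        using mult_mono[of u 1 v 1] that by simp
      have "\<bar>real k * fst w ^ (k - 1) * snd w ^ l * fst h + real l * fst w ^ k * snd w ^ (l - 1) * snd h\<bar>
        \<le> real k * (\<bar>fst w\<bar> ^ (k - 1) * \<bar>snd w\<bar> ^ l) * \<bar>fst h\<bar> + real l * (\<bar>fst w\<bar> ^ k * \<bar>snd w\<bar> ^ (l - 1)) * \<bar>snd h\<bar>"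
        by (rule order_trans[OF abs_triangle_ineq]) (simp add: abs_mult power_abs)
      also have "\<dots> \<le> real k * 1 * norm h + real l * 1 * norm h"
        by (intro add_mono mult_mono m p abs_fst_snd_le) auto
      finally have "\<bar>real k * fst w ^ (k - 1) * snd w ^ l * fst h + real l * fst w ^ k * snd w ^ (l - 1) * snd h\<bar>
        \<le> real (k + l) * norm h" by (simp add: algebra_simps)
      from mult_right_mono[OF this, of "norm (a k l)"]
      show "norm ((real k * fst w ^ (k - 1) * snd w ^ l * fst h + real l * fst w ^ k * snd w ^ (l - 1) * snd h) *\<^sub>R a k l)
        \<le> real (k + l) * norm (a k l) * norm h"
        by (simp add: mult_ac)
    qed
    also have "\<dots> = C * norm h" by (simp add: C_def sum_distrib_right case_prod_unfold)
    finally show ?thesis .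
  qed
  moreover have "0 \<le> C" unfolding C_def by (intro sum_nonneg) auto
  ultimately show ?thesis using that by blast
qed

section \<open>Small bounded functions under substitution\<close>

lemma nonlinearity_in_L2_funs:
  assumes "continuous_on (cball 0 \<rho>) (nonlinearity a)" "f \<in> L2_funs" "AE x in leb. norm (f x) \<le> \<rho>"
  shows "(\<lambda>x. nonlinearity a (f x)) \<in> L2_funs"
proof -
  let ?g = "\<lambda>w. if w \<in> cball 0 \<rho> then nonlinearity a w else 0"
  have "?g \<in> borel_measurable borel"
    using assms(1) by (intro borel_measurable_continuous_on_if) auto
  moreover have "f \<in> borel_measurable leb" using assms(2) by (simp add: L2_funs_def)
  ultimately have m: "(\<lambda>x. ?g (f x)) \<in> borel_measurable leb" by (rule measurable_compose[rotated])
  have m': "(\<lambda>x. nonlinearity a (f x)) \<in> borel_measurable leb"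
    by (rule borel_measurable_leb_AE_cong[OF m]) (use assms(3) in eventually_elim, simp)
  have "bounded (nonlinearity a ` cball 0 \<rho>)"
    by (intro compact_imp_bounded compact_continuous_image assms compact_cball)
  then obtain K where K: "\<And>w. w \<in> cball 0 \<rho> \<Longrightarrow> norm (nonlinearity a w) \<le> K"
    unfolding bounded_iff by blast
  show ?thesis
    by (rule L2_funs_bounded[OF m', of K]) (use assms(3) in eventually_elim, simp add: K)
qed

text \<open>The substitution operator is defined with a chosen representative; any other one with small
  values gives the same class.\<close>
lemma substitution_L2_of:
  assumes c: "continuous_on (cball 0 \<rho>) (nonlinearity a)" and f: "f \<in> L2_funs"
    and b: "AE x in leb. norm (f x) \<le> \<rho>"
  shows "substitution a (L2_of f) = L2_of (\<lambda>x. nonlinearity a (f x))"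
proof -
  have ae: "AE x in leb. rep_L2 (L2_of f) x = f x" by (rule rep_L2_of[OF f])
  have b': "AE x in leb. norm (rep_L2 (L2_of f) x) \<le> \<rho>" using ae b by eventually_elim simp
  show ?thesis
    unfolding substitution_def
    by (subst L2_of_eq_iff[OF nonlinearity_in_L2_funs[OF c rep_L2_in b'] nonlinearity_in_L2_funs[OF c f b]])
       (use ae in eventually_elim, simp)
qed

section \<open>The invariance equation\<close>

locale center_manifold = critical_operator +
  fixes a :: "nat \<Rightarrow> nat \<Rightarrow> real \<times> real" and \<Phi> :: "real \<Rightarrow> L2"
  assumes nl: "nonlinearity_assms a" and cm: "center_manifold_function H1 A \<alpha> a c \<Phi>"
begin

abbreviation r :: "real \<Rightarrow> real" where "r \<equiv> reduced_nonlinearity a e \<Phi>"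

abbreviation forcing :: "real \<Rightarrow> L2" where "forcing s \<equiv> substitution a (s *\<^sub>R e + \<Phi> s)"

lemma inner_stable_e:
  assumes "v \<in> closure (span (E ` stable))"
  shows "inner v e = 0"
proof -
  have "span (E ` stable) \<subseteq> {v. inner v e = 0}"
    using inner_e_stable by (intro span_minimal) (auto simp: inner_commute subspace_def inner_add_left)
  moreover have "closed {v. inner v e = 0}"
    by (intro closed_Collect_eq continuous_intros)
  ultimately show ?thesis using closure_minimal assms by blast
qed

lemma stable_modes: "{mode (\<alpha> m n) m | m n. 1 \<le> m \<and> n \<in> {1, 2} \<and> (m, n) \<noteq> (c, 1)} = E ` stable"
  by (force simp: E_def stable_def)

text \<open>A solution on the manifold has the form \<open>u = y e + \<Phi>(y)\<close>, where the scalar \<open>y\<close> is recovered by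
  projecting \<open>u\<close> on \<open>e\<close> and is therefore differentiable. Comparing the right derivative of this
  expression at time zero with the equation gives the invariance equation.\<close>
lemma invariance_equation:
  assumes eps: "0 < \<epsilon>" and s: "s \<in> {-\<epsilon><..<\<epsilon>}"
    and cl: "\<And>s. s \<in> {-\<epsilon><..<\<epsilon>} \<Longrightarrow> \<Phi> s \<in> H1 \<and> \<Phi> s \<in> closure (span (E ` stable))"
    and der: "(\<Phi> has_vector_derivative d) (at s)"
    and inv: "locally_invariant ((\<lambda>s. s *\<^sub>R e + \<Phi> s) ` {-\<epsilon><..<\<epsilon>}) H1 A a"
  shows "A (\<Phi> s) = r s *\<^sub>R d + r s *\<^sub>R e - forcing s"
proof -
  obtain T u where T: "0 < T" and u0: "u 0 = s *\<^sub>R e + \<Phi> s" and sol: "solution_on T H1 A a u"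
    and inS: "\<forall>t\<in>{0..<T}. u t \<in> (\<lambda>s. s *\<^sub>R e + \<Phi> s) ` {-\<epsilon><..<\<epsilon>}"
    using inv s unfolding locally_invariant_def by blast
  define y where "y t = inner (u t) e * (2 / pi)" for t
  define V where "V = A (u 0) + substitution a (u 0)"
  have u_eq: "u t = y t *\<^sub>R e + \<Phi> (y t)" if t: "t \<in> {0..<T}" for t
  proof -
    obtain z where z: "z \<in> {-\<epsilon><..<\<epsilon>}" "u t = z *\<^sub>R e + \<Phi> z"
      using bspec[OF inS t] by blast
    have "inner (u t) e = z * (pi / 2)"
      using inner_stable_e[of "\<Phi> z"] cl[OF z(1)] by (simp add: z(2) inner_add_left inner_e_e)
    then have "y t = z" by (simp add: y_def)
    then show ?thesis using z by simp
  qed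
  have y0: "y 0 = s"
    using inner_stable_e[of "\<Phi> s"] cl[OF s] by (simp add: y_def u0 inner_add_left inner_e_e)
  have du: "(u has_vector_derivative V) (at 0 within {0..<T})"
    using sol T unfolding solution_on_def V_def by simp
  have dy: "(y has_vector_derivative inner V e * (2 / pi)) (at 0 within {0..<T})"
    unfolding y_def
    by (rule bounded_linear.has_vector_derivative[OF bounded_linear_compose[OF bounded_linear_mult_left bounded_linear_inner_left] du])
  have "((\<Phi> \<circ> y) has_vector_derivative (inner V e * (2 / pi)) *\<^sub>R d) (at 0 within {0..<T})"
    by (rule vector_diff_chain_within[OF dy]) (simp add: y0 has_vector_derivative_at_within[OF der])
  moreover have "((\<lambda>t. y t *\<^sub>R e) has_vector_derivative (inner V e * (2 / pi)) *\<^sub>R e) (at 0 within {0..<T})"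
    by (rule bounded_linear.has_vector_derivative[OF bounded_linear_scaleR_left dy])
  ultimately have "((\<lambda>t. y t *\<^sub>R e + (\<Phi> \<circ> y) t) has_vector_derivative
      (inner V e * (2 / pi)) *\<^sub>R e + (inner V e * (2 / pi)) *\<^sub>R d) (at 0 within {0..<T})"
    by (intro has_vector_derivative_add)
  then have "(u has_vector_derivative
      (inner V e * (2 / pi)) *\<^sub>R e + (inner V e * (2 / pi)) *\<^sub>R d) (at 0 within {0..<T})"
    by (rule has_vector_derivative_transform[rotated 2]) (use T u_eq in auto)
  moreover have "at 0 within {0..<T} \<noteq> bot"
  proof -
    have "0 islimpt {0<..<T}" using T by (simp add: islimpt_greaterThanLessThan1)
    then have "0 islimpt {0..<T}" by (rule islimpt_subset) auto
    then show ?thesis by (simp add: trivial_limit_within)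
  qed
  ultimately have V: "V = (inner V e * (2 / pi)) *\<^sub>R e + (inner V e * (2 / pi)) *\<^sub>R d"
    using vector_derivative_unique_within[OF _ du] by metis
  have Phi: "\<Phi> s \<in> H1" using cl[OF s] by simp
  have "A (s *\<^sub>R e + 1 *\<^sub>R \<Phi> s) = s *\<^sub>R A e + 1 *\<^sub>R A (\<Phi> s)"
    using sa e_in_H1 Phi unfolding self_adjoint_def by blast
  then have Au0: "A (s *\<^sub>R e + \<Phi> s) = A (\<Phi> s)" by (simp add: A_e)
  have "inner V e = inner (A (\<Phi> s)) e + inner (forcing s) e"
    by (simp add: V_def inner_add_left Au0 u0)
  also have "inner (A (\<Phi> s)) e = 0"
    by (rule inner_A_e[OF Phi])
  finally have rs: "inner V e * (2 / pi) = r s"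
    by (simp add: reduced_nonlinearity_def inner_e_e)
  have "A (\<Phi> s) + forcing s = r s *\<^sub>R e + r s *\<^sub>R d"
    using V unfolding rs unfolding V_def u0 Au0 .
  then show ?thesis by (simp add: algebra_simps)
qed

text \<open>The quadratic bound makes the first derivative of \<open>(\<Phi>, A \<Phi>)\<close> vanish at the origin, and the
  existence of a second derivative there makes it \<open>O(s)\<close>.\<close>
lemma center_manifold_facts:
  obtains \<Phi>' where
    "\<forall>\<^sub>F s in at 0. \<Phi> s \<in> H1 \<and> \<Phi> s \<in> closure (span (E ` stable))"
    "(\<lambda>s. norm (A (\<Phi> s))) \<in> O[at 0](\<lambda>s. s ^ 2)"
    "(\<lambda>s. norm (\<Phi>' s)) \<in> O[at 0](\<lambda>s. s)"
    "\<forall>\<^sub>F s in at 0. A (\<Phi> s) = r s *\<^sub>R \<Phi>' s + r s *\<^sub>R e - forcing s"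
proof -
  obtain \<epsilon> where eps: "0 < \<epsilon>"
    and cl: "\<And>s. s \<in> {-\<epsilon><..<\<epsilon>} \<Longrightarrow> \<Phi> s \<in> H1 \<and> \<Phi> s \<in> closure (span (E ` stable))"
    and C2: "C_curve_on 2 {-\<epsilon><..<\<epsilon>} (\<lambda>s. (\<Phi> s, A (\<Phi> s)))"
    and quad: "(\<lambda>s. norm (\<Phi> s, A (\<Phi> s))) \<in> O[at 0](\<lambda>s. s\<^sup>2)"
    and inv: "locally_invariant ((\<lambda>s. s *\<^sub>R e + \<Phi> s) ` {-\<epsilon><..<\<epsilon>}) H1 A a"
    using cm unfolding center_manifold_function_def stable_modes e_def \<alpha>\<^sub>c_def by blast
  from C2 obtain D where D0: "D 0 = (\<lambda>s. (\<Phi> s, A (\<Phi> s)))"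
    and D: "\<And>j s. j < 2 \<Longrightarrow> s \<in> {-\<epsilon><..<\<epsilon>} \<Longrightarrow> (D j has_vector_derivative D (Suc j) s) (at s)"
    unfolding C_curve_on_def by blast
  obtain C where C: "0 < C" "\<forall>\<^sub>F s in at 0. norm (norm (D 0 s)) \<le> C * norm (s\<^sup>2)"
    using quad unfolding D0 by (rule landau_o.bigE)
  then obtain \<delta> where \<delta>: "0 < \<delta>" "\<And>s. s \<noteq> 0 \<Longrightarrow> \<bar>s\<bar> < \<delta> \<Longrightarrow> norm (D 0 s) \<le> C * s\<^sup>2"
    by (auto simp: eventually_at)
  have z: "0 \<in> {-\<epsilon><..<\<epsilon>}" using eps by simp
  have D00: "D 0 0 = 0"
  proof -
    have "isCont (D 0) 0" using D[of 0 0] z has_vector_derivative_continuous by auto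
    then have "((\<lambda>s. norm (D 0 s)) \<longlongrightarrow> norm (D 0 0)) (at 0)"
      by (intro tendsto_norm) (simp add: isCont_def)
    moreover have "((\<lambda>s. norm (D 0 s)) \<longlongrightarrow> 0) (at 0)"
    proof (rule tendsto_sandwich[of "\<lambda>_. 0" _ _ "\<lambda>s. C * s\<^sup>2"])
      show "\<forall>\<^sub>F s in at 0. norm (D 0 s) \<le> C * s\<^sup>2" using C(2) by simp
      have "((\<lambda>s::real. C * s\<^sup>2) \<longlongrightarrow> C * 0\<^sup>2) (at 0)" by (intro tendsto_intros)
      then show "((\<lambda>s::real. C * s\<^sup>2) \<longlongrightarrow> 0) (at 0)" by simp
    qed auto
    ultimately have "norm (D 0 0) = 0" by (rule tendsto_unique[OF at_neq_bot])
    then show ?thesis by simp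
  qed
  have "(D 0 has_vector_derivative 0) (at 0)"
    unfolding has_vector_derivative_def has_derivative_at_alt
  proof (intro conjI allI impI)
    fix d :: real assume d: "0 < d"
    show "\<exists>\<delta>>0. \<forall>s::real. norm (s - 0) < \<delta> \<longrightarrow> norm (D 0 s - D 0 0 - (s - 0) *\<^sub>R 0) \<le> d * norm (s - 0)"
    proof (intro exI[of _ "min \<delta> (d / C)"] conjI allI impI)
      fix s :: real assume s: "norm (s - 0) < min \<delta> (d / C)"
      show "norm (D 0 s - D 0 0 - (s - 0) *\<^sub>R 0) \<le> d * norm (s - 0)"
      proof (cases "s = 0")
        case False
        have "norm (D 0 s) \<le> C * s\<^sup>2" using False s by (intro \<delta>) auto
        also have "\<dots> = (C * \<bar>s\<bar>) * \<bar>s\<bar>" by (simp add: power2_eq_square)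
        also have "\<dots> \<le> d * \<bar>s\<bar>"
          using s C by (intro mult_right_mono) (auto simp: pos_less_divide_eq mult.commute less_imp_le)
        finally show ?thesis by (simp add: D00)
      qed simp
    qed (use \<delta> d C in auto)
  qed (simp add: bounded_linear_zero)
  then have D10: "D 1 0 = 0"
    using vector_derivative_unique_at[OF D[of 0 0] ] z by fastforce
  have D1: "(\<lambda>s. norm (D 1 s)) \<in> O[at 0](\<lambda>s. s)"
  proof -
    have "(D 1 has_vector_derivative D 2 0) (at 0)" using D[of 1 0] z by (simp add: numeral_2_eq_2)
    then obtain d where d: "0 < d" "\<And>s. norm (s - 0) < d \<Longrightarrow>
        norm (D 1 s - D 1 0 - (s - 0) *\<^sub>R D 2 0) \<le> 1 * norm (s - 0)"
      unfolding has_vector_derivative_def has_derivative_at_alt by (metis zero_less_one)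
    have "norm (D 1 s) \<le> (1 + norm (D 2 0)) * \<bar>s\<bar>" if "\<bar>s\<bar> < d" for s
    proof -
      have "norm (D 1 s) \<le> norm (D 1 s - s *\<^sub>R D 2 0) + norm (s *\<^sub>R D 2 0)"
        using norm_triangle_ineq[of "D 1 s - s *\<^sub>R D 2 0" "s *\<^sub>R D 2 0"] by simp
      also have "\<dots> \<le> 1 * \<bar>s\<bar> + \<bar>s\<bar> * norm (D 2 0)"
        using d(2)[of s] that D10 by (intro add_mono) auto
      finally show ?thesis by (simp add: algebra_simps)
    qed
    then have "\<forall>\<^sub>F s in at 0. norm (norm (D 1 s)) \<le> (1 + norm (D 2 0)) * norm s"
      using d(1) by (auto simp: eventually_at)
    then show ?thesis by (rule bigoI)
  qed
  have near: "\<forall>\<^sub>F s in at 0. s \<in> {-\<epsilon><..<\<epsilon>}"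
    using eps by (auto simp: eventually_at intro!: exI[of _ \<epsilon>])
  show ?thesis
  proof (rule that[of "\<lambda>s. fst (D 1 s)"])
    show "\<forall>\<^sub>F s in at 0. \<Phi> s \<in> H1 \<and> \<Phi> s \<in> closure (span (E ` stable))"
      using near by eventually_elim (rule cl)
    have "(\<lambda>s. norm (A (\<Phi> s))) \<in> O[at 0](\<lambda>s. norm (\<Phi> s, A (\<Phi> s)))"
      using norm_snd_le by (intro landau_o.big_mono always_eventually) auto
    then show "(\<lambda>s. norm (A (\<Phi> s))) \<in> O[at 0](\<lambda>s. s ^ 2)" using quad by (rule landau_o.big_trans)
    have "(\<lambda>s. norm (fst (D 1 s))) \<in> O[at 0](\<lambda>s. norm (D 1 s))"
      using norm_fst_le[of "fst (D 1 s)" "snd (D 1 s)" for s]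
      by (intro landau_o.big_mono always_eventually) simp
    then show "(\<lambda>s. norm (fst (D 1 s))) \<in> O[at 0](\<lambda>s. s)" using D1 by (rule landau_o.big_trans)
    show "\<forall>\<^sub>F s in at 0. A (\<Phi> s) = r s *\<^sub>R fst (D 1 s) + r s *\<^sub>R e - forcing s"
      using near
    proof eventually_elim
      case (elim s)
      have "(D 0 has_vector_derivative D 1 s) (at s)" using D[of 0 s] elim by simp
      from bounded_linear.has_vector_derivative[OF bounded_linear_fst this]
      have "(\<Phi> has_vector_derivative fst (D 1 s)) (at s)" by (simp add: D0)
      then show ?case by (intro invariance_equation[OF eps elim _ _ inv] cl)
    qed
  qed
qed

end

section \<open>Asymptotics on the center manifold\<close>

lemma power_bigo_at_0:
  assumes "n \<le> m"
  shows "(\<lambda>s::real. s ^ m) \<in> O[at 0](\<lambda>s. s ^ n)"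
proof (rule bigoI[where c = 1])
  have "\<forall>\<^sub>F s::real in at 0. \<bar>s\<bar> \<le> 1"
    by (auto simp: eventually_at intro!: exI[of _ 1])
  then show "\<forall>\<^sub>F s::real in at 0. norm (s ^ m) \<le> 1 * norm (s ^ n)"
    by eventually_elim (use assms in \<open>auto simp: power_abs intro: power_decreasing\<close>)
qed

lemma bigo_at_0_bound:
  fixes f :: "real \<Rightarrow> real"
  assumes "f \<in> O[at 0](\<lambda>s. s ^ k)"
  obtains C where "0 < C" "\<forall>\<^sub>F s in at 0. \<bar>f s\<bar> \<le> C * \<bar>s\<bar> ^ k"
  using assms by (elim landau_o.bigE) (auto simp: power_abs)

lemma bigo_at_0I:
  fixes f :: "real \<Rightarrow> real"
  assumes "\<forall>\<^sub>F s in at 0. \<bar>f s\<bar> \<le> C * \<bar>s\<bar> ^ k"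
  shows "f \<in> O[at 0](\<lambda>s. s ^ k)"
  by (rule bigoI[where c = C]) (use assms in \<open>simp add: power_abs\<close>)

lemma has_sum_finite_sum:
  fixes f :: "'i \<Rightarrow> 'a \<Rightarrow> real"
  assumes "\<And>i. i \<in> F \<Longrightarrow> (f i has_sum S i) T"
  shows "((\<lambda>x. \<Sum>i\<in>F. f i x) has_sum (\<Sum>i\<in>F. S i)) T"
  using assms by (induction F rule: infinite_finite_induct) (auto intro: has_sum_add)

locale center_manifold_degree = center_manifold +
  fixes d :: nat
  assumes d: "2 \<le> d" and low: "\<And>k l. 2 \<le> k + l \<Longrightarrow> k + l < d \<Longrightarrow> a k l = 0"
begin

abbreviation g :: "real \<times> real" where "g \<equiv> hom_part a d \<alpha>\<^sub>c"

text \<open>The gradient of \<open>w \<mapsto> hom_part a d w \<bullet> \<alpha>\<^sub>c\<close> at \<open>\<alpha>\<^sub>c\<close>.\<close>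
definition q :: "real \<times> real" where
  "q = (\<Sum>(k, l)\<in>{(k, l). k + l = d}. (a k l \<bullet> \<alpha>\<^sub>c) *\<^sub>R
     (real k * fst \<alpha>\<^sub>c ^ (k - 1) * snd \<alpha>\<^sub>c ^ l, real l * fst \<alpha>\<^sub>c ^ k * snd \<alpha>\<^sub>c ^ (l - 1)))"

definition sine_power :: "real \<times> real \<Rightarrow> L2" where
  "sine_power v = L2_of (\<lambda>x. sin (real c * x) ^ d *\<^sub>R v)"

text \<open>A representative of \<open>s e + \<Phi>(s)\<close>.\<close>
definition profile :: "real \<Rightarrow> real \<Rightarrow> real \<times> real" where
  "profile s x = (s * sin (real c * x)) *\<^sub>R \<alpha>\<^sub>c + rep_L2 (\<Phi> s) x"

lemma hom_part_low: "2 \<le> N \<Longrightarrow> N < d \<Longrightarrow> hom_part a N w = 0"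
  unfolding hom_part_def by (rule sum.neutral) (use low in auto)

lemma hom_deriv_inner: "hom_deriv a d \<alpha>\<^sub>c h \<bullet> \<alpha>\<^sub>c = h \<bullet> q"
  unfolding hom_deriv_def q_def inner_sum_left inner_sum_right
  by (rule sum.cong) (auto simp: inner_prod_def algebra_simps)

lemma sum_hom_parts:
  "(\<Sum>N=2..2 * d - 1. hom_part a N w) = (\<Sum>N=d..2 * d - 1. hom_part a N w)"
  by (rule sum.mono_neutral_right) (use d in \<open>auto intro: hom_part_low\<close>)

subsection \<open>Pointwise expansions\<close>

text \<open>The increment \<open>h\<close> stands for a value of \<open>\<Phi> s\<close> and has order \<open>d\<close>. Its quadratic contributions are then
  of order \<open>2 d\<close>, and so are its linear contributions to the homogeneous parts of degree \<open>N > d\<close>,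
  which have order \<open>N - 1 + d\<close>. What remains below order \<open>2 d\<close> is the linear contribution to the part
  of degree \<open>d\<close>.\<close>
lemma pointwise_expansion:
  assumes C0: "0 \<le> C0"
  obtains C \<delta> where "0 < \<delta>"
    "\<And>s \<sigma> h. \<bar>s\<bar> < \<delta> \<Longrightarrow> \<bar>\<sigma>\<bar> \<le> 1 \<Longrightarrow> norm h \<le> C0 * \<bar>s\<bar> ^ d \<Longrightarrow>
      norm (nonlinearity a ((s * \<sigma>) *\<^sub>R \<alpha>\<^sub>c + h)
        - (\<Sum>N=d..2 * d - 1. (s * \<sigma>) ^ N *\<^sub>R hom_part a N \<alpha>\<^sub>c)
        - (s * \<sigma>) ^ (d - 1) *\<^sub>R hom_deriv a d \<alpha>\<^sub>c h) \<le> C * \<bar>s\<bar> ^ (2 * d)"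
proof -
  obtain C1 \<rho> where \<rho>: "0 < \<rho>" and C1: "0 \<le> C1" and nb: "\<And>w K. norm w \<le> \<rho> \<Longrightarrow>
    norm (nonlinearity a w - (\<Sum>N=2..K. hom_part a N w)) \<le> C1 * (norm w / (2 * \<rho>)) ^ (K + 1)"
    using nonlinearity_expansion[OF nl] by metis
  have "\<forall>N. \<exists>C\<ge>0. \<forall>t w h. \<bar>t\<bar> \<le> 1 \<longrightarrow> norm w \<le> 1 \<longrightarrow> norm h \<le> 1 \<longrightarrow>
    norm (hom_part a N (t *\<^sub>R w + h) - t ^ N *\<^sub>R hom_part a N w - t ^ (N - 1) *\<^sub>R hom_deriv a N w h)
      \<le> C * (norm h)\<^sup>2"
    using hom_part_taylor[of a] by metis
  then obtain T where T: "\<And>N. 0 \<le> T N" "\<And>N t w h. \<bar>t\<bar> \<le> 1 \<Longrightarrow> norm w \<le> 1 \<Longrightarrow> norm h \<le> 1 \<Longrightarrow>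
    norm (hom_part a N (t *\<^sub>R w + h) - t ^ N *\<^sub>R hom_part a N w - t ^ (N - 1) *\<^sub>R hom_deriv a N w h)
      \<le> T N * (norm h)\<^sup>2"
    by metis
  have "\<forall>N. \<exists>C\<ge>0. \<forall>w h. norm w \<le> 1 \<longrightarrow> norm (hom_deriv a N w h) \<le> C * norm h"
    using hom_deriv_bound[of a] by metis
  then obtain B where B: "\<And>N. 0 \<le> B N"
    "\<And>N w h. norm w \<le> 1 \<Longrightarrow> norm (hom_deriv a N w h) \<le> B N * norm h"
    by metis
  define D where "D N = T N * C0\<^sup>2 + B N * C0" for N
  define C where "C = C1 * ((1 + C0) / (2 * \<rho>)) ^ (2 * d) + (\<Sum>N=d..2 * d - 1. D N)"
  define \<delta> where "\<delta> = min 1 (min (\<rho> / (1 + C0)) (1 / (1 + C0)))"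
  have \<delta>: "0 < \<delta>" using \<rho> C0 by (simp add: \<delta>_def)
  have "norm (nonlinearity a ((s * \<sigma>) *\<^sub>R \<alpha>\<^sub>c + h)
        - (\<Sum>N=d..2 * d - 1. (s * \<sigma>) ^ N *\<^sub>R hom_part a N \<alpha>\<^sub>c)
        - (s * \<sigma>) ^ (d - 1) *\<^sub>R hom_deriv a d \<alpha>\<^sub>c h) \<le> C * \<bar>s\<bar> ^ (2 * d)"
    if s: "\<bar>s\<bar> < \<delta>" and \<sigma>: "\<bar>\<sigma>\<bar> \<le> 1" and h: "norm h \<le> C0 * \<bar>s\<bar> ^ d" for s \<sigma> h
  proof -
    define t where "t = s * \<sigma>"
    define w where "w = t *\<^sub>R \<alpha>\<^sub>c + h"
    have s1: "\<bar>s\<bar> \<le> 1" using s by (simp add: \<delta>_def)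
    have ts: "\<bar>t\<bar> \<le> \<bar>s\<bar>" using mult_left_mono[OF \<sigma>, of "\<bar>s\<bar>"] by (simp add: t_def abs_mult)
    have sd: "\<bar>s\<bar> ^ d \<le> \<bar>s\<bar>" using power_decreasing[of 1 d "\<bar>s\<bar>"] s1 d by simp
    have hs: "norm h \<le> C0 * \<bar>s\<bar>" using h mult_left_mono[OF sd C0] by linarith
    have s2: "(1 + C0) * \<bar>s\<bar> \<le> \<rho>" "(1 + C0) * \<bar>s\<bar> \<le> 1"
      using s C0 by (auto simp: \<delta>_def pos_less_divide_eq mult.commute less_imp_le)
    have h1: "norm h \<le> 1" using hs s2(2) s1 by (simp add: algebra_simps)
    have w: "norm w \<le> (1 + C0) * \<bar>s\<bar>"
      using norm_triangle_ineq[of "t *\<^sub>R \<alpha>\<^sub>c" h] ts hs norm_critical_vector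
      by (simp add: w_def algebra_simps)
    have "norm (nonlinearity a w - (\<Sum>N=2..2 * d - 1. hom_part a N w)) \<le> C1 * (norm w / (2 * \<rho>)) ^ (2 * d - 1 + 1)"
      using w s2 by (intro nb) simp
    also have "2 * d - 1 + 1 = 2 * d" using d by simp
    also have "C1 * (norm w / (2 * \<rho>)) ^ (2 * d) \<le> C1 * ((1 + C0) * \<bar>s\<bar> / (2 * \<rho>)) ^ (2 * d)"
      using w \<rho> C1 by (intro mult_left_mono power_mono divide_right_mono) auto
    also have "\<dots> = C1 * ((1 + C0) / (2 * \<rho>)) ^ (2 * d) * \<bar>s\<bar> ^ (2 * d)"
      by (simp add: power_mult_distrib power_divide)
    finally have 1: "norm (nonlinearity a w - (\<Sum>N=d..2 * d - 1. hom_part a N w))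
      \<le> C1 * ((1 + C0) / (2 * \<rho>)) ^ (2 * d) * \<bar>s\<bar> ^ (2 * d)"
      unfolding sum_hom_parts .
    define z where "z = t ^ (d - 1) *\<^sub>R hom_deriv a d \<alpha>\<^sub>c h"
    have 2: "norm (hom_part a N w - t ^ N *\<^sub>R hom_part a N \<alpha>\<^sub>c - (if N = d then z else 0)) \<le> D N * \<bar>s\<bar> ^ (2 * d)"
      if N: "N \<in> {d..2 * d - 1}" for N
    proof -
      let ?z = "t ^ (N - 1) *\<^sub>R hom_deriv a N \<alpha>\<^sub>c h"
      have "norm (hom_part a N w - t ^ N *\<^sub>R hom_part a N \<alpha>\<^sub>c - ?z) \<le> T N * (norm h)\<^sup>2"
        unfolding w_def using ts s1 h1 norm_critical_vector by (intro T(2)) auto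
      also have "\<dots> \<le> T N * (C0 * \<bar>s\<bar> ^ d)\<^sup>2"
        using h by (intro mult_left_mono power_mono T(1)) auto
      also have "\<dots> = T N * C0\<^sup>2 * \<bar>s\<bar> ^ (2 * d)"
        by (simp add: power_mult_distrib power_mult[symmetric] mult.commute[of d])
      finally have 3: "norm (hom_part a N w - t ^ N *\<^sub>R hom_part a N \<alpha>\<^sub>c - ?z) \<le> T N * C0\<^sup>2 * \<bar>s\<bar> ^ (2 * d)" .
      show ?thesis
      proof (cases "N = d")
        case True
        have "T N * C0\<^sup>2 * \<bar>s\<bar> ^ (2 * d) \<le> D N * \<bar>s\<bar> ^ (2 * d)"
          unfolding D_def using B C0 by (intro mult_right_mono) auto
        then show ?thesis using 3 True by (simp add: z_def)
      next
        case False
        have "\<bar>t\<bar> ^ (N - 1) \<le> \<bar>s\<bar> ^ (N - 1)" using ts by (intro power_mono) auto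
        also have "\<dots> \<le> \<bar>s\<bar> ^ d" using s1 N False by (intro power_decreasing) auto
        finally have "norm ?z \<le> \<bar>s\<bar> ^ d * (B N * (C0 * \<bar>s\<bar> ^ d))"
          using order_trans[OF B(2)[of \<alpha>\<^sub>c N h] mult_left_mono[OF h B(1)[of N]]] norm_critical_vector
          by (simp add: power_abs) (intro mult_mono, auto)
        also have "\<dots> = B N * C0 * \<bar>s\<bar> ^ (2 * d)" by (simp add: mult_2 power_add)
        finally have "norm ?z \<le> B N * C0 * \<bar>s\<bar> ^ (2 * d)" .
        then have "norm ((hom_part a N w - t ^ N *\<^sub>R hom_part a N \<alpha>\<^sub>c - ?z) + ?z)
            \<le> T N * C0\<^sup>2 * \<bar>s\<bar> ^ (2 * d) + B N * C0 * \<bar>s\<bar> ^ (2 * d)"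
          using 3 by (intro norm_triangle_le add_mono)
        then show ?thesis using False by (simp add: D_def algebra_simps)
      qed
    qed
    have "(\<Sum>N=d..2 * d - 1. if N = d then z else 0) = z" 
      unfolding sum.delta[OF finite_atLeastAtMost] using d by auto
    then have "(\<Sum>N=d..2 * d - 1. hom_part a N w) - (\<Sum>N=d..2 * d - 1. t ^ N *\<^sub>R hom_part a N \<alpha>\<^sub>c) - z
        = (\<Sum>N=d..2 * d - 1. hom_part a N w - t ^ N *\<^sub>R hom_part a N \<alpha>\<^sub>c - (if N = d then z else 0))"
      by (simp only: sum_subtractf)
    also have "norm \<dots> \<le> (\<Sum>N=d..2 * d - 1. D N * \<bar>s\<bar> ^ (2 * d))"
      by (intro sum_norm_le 2)
    finally have 4: "norm ((\<Sum>N=d..2 * d - 1. hom_part a N w)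
        - (\<Sum>N=d..2 * d - 1. t ^ N *\<^sub>R hom_part a N \<alpha>\<^sub>c) - z) \<le> (\<Sum>N=d..2 * d - 1. D N) * \<bar>s\<bar> ^ (2 * d)"
      by (simp add: sum_distrib_right)
    have "nonlinearity a w - (\<Sum>N=d..2 * d - 1. t ^ N *\<^sub>R hom_part a N \<alpha>\<^sub>c) - z =
       (nonlinearity a w - (\<Sum>N=d..2 * d - 1. hom_part a N w)) + ((\<Sum>N=d..2 * d - 1. hom_part a N w)
        - (\<Sum>N=d..2 * d - 1. t ^ N *\<^sub>R hom_part a N \<alpha>\<^sub>c) - z)" by simp
    also have "norm \<dots> \<le> C * \<bar>s\<bar> ^ (2 * d)"
      using norm_triangle_mono[OF 1 4] by (simp add: C_def distrib_right)
    finally show ?thesis by (simp add: w_def z_def t_def)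
  qed
  then show ?thesis using that[OF \<delta>] by blast
qed

lemma pointwise_leading_order:
  assumes C0: "0 \<le> C0"
  obtains C \<delta> where "0 < \<delta>"
    "\<And>s \<sigma> h. \<bar>s\<bar> < \<delta> \<Longrightarrow> \<bar>\<sigma>\<bar> \<le> 1 \<Longrightarrow> norm h \<le> C0 * \<bar>s\<bar> ^ d \<Longrightarrow>
      norm (nonlinearity a ((s * \<sigma>) *\<^sub>R \<alpha>\<^sub>c + h) - (s * \<sigma>) ^ d *\<^sub>R g) \<le> C * \<bar>s\<bar> ^ (d + 1)"
proof -
  obtain C1 \<delta> where \<delta>: "0 < \<delta>" and C1:
    "\<And>s \<sigma> h. \<bar>s\<bar> < \<delta> \<Longrightarrow> \<bar>\<sigma>\<bar> \<le> 1 \<Longrightarrow> norm h \<le> C0 * \<bar>s\<bar> ^ d \<Longrightarrow>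
      norm (nonlinearity a ((s * \<sigma>) *\<^sub>R \<alpha>\<^sub>c + h)
        - (\<Sum>N=d..2 * d - 1. (s * \<sigma>) ^ N *\<^sub>R hom_part a N \<alpha>\<^sub>c)
        - (s * \<sigma>) ^ (d - 1) *\<^sub>R hom_deriv a d \<alpha>\<^sub>c h) \<le> C1 * \<bar>s\<bar> ^ (2 * d)"
    by (rule pointwise_expansion[OF C0]) (rule that)
  obtain B where B: "0 \<le> B" "\<And>w h. norm w \<le> 1 \<Longrightarrow> norm (hom_deriv a d w h) \<le> B * norm h"
    using hom_deriv_bound[of a d] by metis
  define C where "C = \<bar>C1\<bar> + (\<Sum>N=d+1..2 * d - 1. norm (hom_part a N \<alpha>\<^sub>c)) + B * C0"
  have "norm (nonlinearity a ((s * \<sigma>) *\<^sub>R \<alpha>\<^sub>c + h) - (s * \<sigma>) ^ d *\<^sub>R g) \<le> C * \<bar>s\<bar> ^ (d + 1)"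
    if s: "\<bar>s\<bar> < min \<delta> 1" and \<sigma>: "\<bar>\<sigma>\<bar> \<le> 1" and h: "norm h \<le> C0 * \<bar>s\<bar> ^ d" for s \<sigma> h
  proof -
    define t where "t = s * \<sigma>"
    let ?n = "nonlinearity a (t *\<^sub>R \<alpha>\<^sub>c + h)" and ?S = "\<Sum>N=d+1..2 * d - 1. t ^ N *\<^sub>R hom_part a N \<alpha>\<^sub>c"
      and ?z = "t ^ (d - 1) *\<^sub>R hom_deriv a d \<alpha>\<^sub>c h"
    have ts: "\<bar>t\<bar> \<le> \<bar>s\<bar>" using mult_left_mono[OF \<sigma>, of "\<bar>s\<bar>"] by (simp add: t_def abs_mult)
    have pw: "\<bar>s\<bar> ^ N \<le> \<bar>s\<bar> ^ (d + 1)" if "d + 1 \<le> N" for N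
      using s that by (intro power_decreasing) auto
    have split: "(\<Sum>N=d..2 * d - 1. t ^ N *\<^sub>R hom_part a N \<alpha>\<^sub>c) = t ^ d *\<^sub>R g + ?S"
      using d by (simp add: sum.atLeast_Suc_atMost)
    have "norm (?n - (t ^ d *\<^sub>R g + ?S) - ?z) \<le> C1 * \<bar>s\<bar> ^ (2 * d)"
      using C1[OF _ \<sigma> h] s unfolding t_def[symmetric] split by simp
    also have "\<dots> \<le> \<bar>C1\<bar> * \<bar>s\<bar> ^ (d + 1)"
      using pw[of "2 * d"] d by (intro mult_mono) auto
    finally have 1: "norm (?n - (t ^ d *\<^sub>R g + ?S) - ?z) \<le> \<bar>C1\<bar> * \<bar>s\<bar> ^ (d + 1)" .
    have "norm ?S \<le> (\<Sum>N=d+1..2 * d - 1. norm (hom_part a N \<alpha>\<^sub>c) * \<bar>s\<bar> ^ (d + 1))"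
    proof (rule sum_norm_le)
      fix N assume N: "N \<in> {d+1..2 * d - 1}"
      have "\<bar>t\<bar> ^ N \<le> \<bar>s\<bar> ^ (d + 1)"
        using order_trans[OF power_mono[OF ts abs_ge_zero, of N] pw[of N]] N by simp
      from mult_left_mono[OF this norm_ge_zero[of "hom_part a N \<alpha>\<^sub>c"]]
      show "norm (t ^ N *\<^sub>R hom_part a N \<alpha>\<^sub>c) \<le> norm (hom_part a N \<alpha>\<^sub>c) * \<bar>s\<bar> ^ (d + 1)"
        by (simp only: norm_scaleR real_norm_def power_abs mult.commute)
    qed
    then have 2: "norm ?S \<le> (\<Sum>N=d+1..2 * d - 1. norm (hom_part a N \<alpha>\<^sub>c)) * \<bar>s\<bar> ^ (d + 1)"
      by (simp only: sum_distrib_right)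
    have "norm ?z \<le> \<bar>s\<bar> ^ (d - 1) * (B * (C0 * \<bar>s\<bar> ^ d))"
      using order_trans[OF B(2)[of \<alpha>\<^sub>c h] mult_left_mono[OF h B(1)]] norm_critical_vector
        power_mono[OF ts, of "d - 1"]
      by (simp add: power_abs) (intro mult_mono, auto)
    also have "\<dots> = B * C0 * \<bar>s\<bar> ^ (d - 1 + d)" by (simp add: power_add)
    also have "\<dots> \<le> B * C0 * \<bar>s\<bar> ^ (d + 1)"
      using pw[of "d - 1 + d"] B C0 d by (intro mult_left_mono) auto
    finally have 3: "norm ?z \<le> B * C0 * \<bar>s\<bar> ^ (d + 1)" .
    have "norm ((?n - (t ^ d *\<^sub>R g + ?S) - ?z) + (?S + ?z)) \<le> \<bar>C1\<bar> * \<bar>s\<bar> ^ (d + 1)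
        + ((\<Sum>N=d+1..2 * d - 1. norm (hom_part a N \<alpha>\<^sub>c)) * \<bar>s\<bar> ^ (d + 1) + B * C0 * \<bar>s\<bar> ^ (d + 1))"
      by (intro norm_triangle_mono 1 2 3)
    also have "(?n - (t ^ d *\<^sub>R g + ?S) - ?z) + (?S + ?z) = ?n - t ^ d *\<^sub>R g" by simp
    finally show ?thesis unfolding C_def t_def distrib_right by (simp only: add.assoc)
  qed
  moreover have "0 < min \<delta> 1" using \<delta> by simp
  ultimately show ?thesis using that by blast
qed

subsection \<open>Order of the center manifold function\<close>

lemma profile_L2: "profile s \<in> L2_funs" "L2_of (profile s) = s *\<^sub>R e + \<Phi> s"
proof -
  have e': "(\<lambda>x. sin (real c * x) *\<^sub>R \<alpha>\<^sub>c) \<in> L2_funs" by (rule sin_scaleR_in_L2_funs)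
  have profile: "profile s = (\<lambda>x. s *\<^sub>R (sin (real c * x) *\<^sub>R \<alpha>\<^sub>c) + rep_L2 (\<Phi> s) x)"
    by (simp add: profile_def fun_eq_iff)
  show "profile s \<in> L2_funs" unfolding profile by (intro L2_funs_add L2_funs_scaleR e' rep_L2_in)
  show "L2_of (profile s) = s *\<^sub>R e + \<Phi> s"
    unfolding profile L2_of_add[OF L2_funs_scaleR[OF e'] rep_L2_in] L2_of_scaleR[OF e'] L2_of_rep e_def mode_def ..
qed

lemma sup_order:
  assumes "(\<lambda>s. norm (A (\<Phi> s))) \<in> O[at 0](\<lambda>s. s ^ k)"
  obtains C where "0 \<le> C" "\<forall>\<^sub>F s in at 0. AE x in leb. norm (rep_L2 (\<Phi> s) x) \<le> C * \<bar>s\<bar> ^ k"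
proof -
  obtain K where K: "0 \<le> K" "\<And>u. u \<in> H1 \<Longrightarrow> u \<in> closure (span (E ` stable)) \<Longrightarrow>
    AE x in leb. norm (rep_L2 u x) \<le> K * norm (A u)"
    by (rule sup_bound) (rule that)
  obtain C where C: "0 < C" "\<forall>\<^sub>F s in at 0. \<bar>norm (A (\<Phi> s))\<bar> \<le> C * \<bar>s\<bar> ^ k"
    using bigo_at_0_bound[OF assms] by metis
  have dom: "\<forall>\<^sub>F s in at 0. \<Phi> s \<in> H1 \<and> \<Phi> s \<in> closure (span (E ` stable))"
    by (rule center_manifold_facts)
  have "\<forall>\<^sub>F s in at 0. AE x in leb. norm (rep_L2 (\<Phi> s) x) \<le> K * C * \<bar>s\<bar> ^ k"
    using C(2) dom
  proof eventually_elim
    case (elim s)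
    have "K * norm (A (\<Phi> s)) \<le> K * C * \<bar>s\<bar> ^ k"
      using mult_left_mono[OF _ K(1), of "norm (A (\<Phi> s))" "C * \<bar>s\<bar> ^ k"] elim by (simp add: mult.assoc)
    moreover have "AE x in leb. norm (rep_L2 (\<Phi> s) x) \<le> K * norm (A (\<Phi> s))" using K(2) elim by blast
    ultimately show ?case by (auto elim: eventually_mono)
  qed
  then show ?thesis using that[of "K * C"] K(1) C(1) by auto
qed

text \<open>Near the origin the argument is small in the sup norm, so that substitution is given by the
  power series.\<close>
lemma forcing_eq:
  obtains C where "0 \<le> C" "\<forall>\<^sub>F s in at 0. (AE x in leb. norm (profile s x) \<le> C * \<bar>s\<bar>) \<and>
    (\<lambda>x. nonlinearity a (profile s x)) \<in> L2_funs \<and> forcing s = L2_of (\<lambda>x. nonlinearity a (profile s x))"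
proof -
  obtain \<rho> where \<rho>: "0 < \<rho>" "continuous_on (cball 0 \<rho>) (nonlinearity a)"
    using nonlinearity_continuous[OF nl] by metis
  have quad: "(\<lambda>s. norm (A (\<Phi> s))) \<in> O[at 0](\<lambda>s. s ^ 2)"
    by (rule center_manifold_facts)
  obtain C where C: "0 \<le> C" "\<forall>\<^sub>F s in at 0. AE x in leb. norm (rep_L2 (\<Phi> s) x) \<le> C * \<bar>s\<bar> ^ 2"
    by (rule sup_order[OF quad]) (rule that)
  define K where "K = 1 + C"
  have K: "0 < K" using C by (simp add: K_def)
  have "\<forall>\<^sub>F s::real in at 0. \<bar>s\<bar> < min 1 (\<rho> / K)"
    using \<rho> K by (auto simp: eventually_at intro!: exI[of _ "min 1 (\<rho> / K)"])
  with C(2) have "\<forall>\<^sub>F s in at 0. (AE x in leb. norm (profile s x) \<le> K * \<bar>s\<bar>) \<and>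
    (\<lambda>x. nonlinearity a (profile s x)) \<in> L2_funs \<and> forcing s = L2_of (\<lambda>x. nonlinearity a (profile s x))"
  proof eventually_elim
    case (elim s)
    have w: "AE x in leb. norm (profile s x) \<le> K * \<bar>s\<bar>"
      using elim(1)
    proof eventually_elim
      case (elim x)
      have "\<bar>s\<bar> ^ 2 \<le> \<bar>s\<bar>" using \<open>\<bar>s\<bar> < min 1 (\<rho> / K)\<close> power_decreasing[of 1 2 "\<bar>s\<bar>"] by simp
      then have "C * \<bar>s\<bar> ^ 2 \<le> C * \<bar>s\<bar>" using C by (intro mult_left_mono) auto
      moreover have "norm ((s * sin (real c * x)) *\<^sub>R \<alpha>\<^sub>c) \<le> \<bar>s\<bar>"
        using norm_critical_vector by (simp add: abs_mult mult_right_le_one_le)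
      ultimately show ?case
        using norm_triangle_ineq[of "(s * sin (real c * x)) *\<^sub>R \<alpha>\<^sub>c" "rep_L2 (\<Phi> s) x"] elim
        unfolding profile_def K_def by (simp add: algebra_simps del: norm_scaleR)
    qed
    have "K * \<bar>s\<bar> \<le> \<rho>" using elim(2) K by (simp add: pos_less_divide_eq mult.commute)
    then have w': "AE x in leb. norm (profile s x) \<le> \<rho>" using w by (auto elim: eventually_mono)
    show ?case
      using w nonlinearity_in_L2_funs[OF \<rho>(2) profile_L2(1) w'] substitution_L2_of[OF \<rho>(2) profile_L2(1) w']
      by (simp add: profile_L2(2))
  qed
  then show ?thesis using that[of K] K by simp
qed

lemma forcing_order: "(\<lambda>s. norm (forcing s)) \<in> O[at 0](\<lambda>s. s ^ d)"
proof -
  obtain C1 \<rho> where \<rho>: "0 < \<rho>" and C1: "0 \<le> C1" and nb: "\<And>w K. norm w \<le> \<rho> \<Longrightarrow>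
    norm (nonlinearity a w - (\<Sum>N=2..K. hom_part a N w)) \<le> C1 * (norm w / (2 * \<rho>)) ^ (K + 1)"
    using nonlinearity_expansion[OF nl] by metis
  obtain C where C: "0 \<le> C" "\<forall>\<^sub>F s in at 0. (AE x in leb. norm (profile s x) \<le> C * \<bar>s\<bar>) \<and>
    (\<lambda>x. nonlinearity a (profile s x)) \<in> L2_funs \<and> forcing s = L2_of (\<lambda>x. nonlinearity a (profile s x))"
    by (rule forcing_eq) (rule that)
  have "(\<Sum>N=2..d - 1. hom_part a N w) = 0" for w
    by (intro sum.neutral ballI hom_part_low) (use d in auto)
  then have nb': "norm (nonlinearity a w) \<le> C1 * (norm w / (2 * \<rho>)) ^ d" if "norm w \<le> \<rho>" for w
    using nb[OF that, of "d - 1"] d by simp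
  define K where "K = C1 * (C / (2 * \<rho>)) ^ d"
  have K: "0 \<le> K" using C1 C \<rho> by (simp add: K_def)
  have "\<forall>\<^sub>F s::real in at 0. \<bar>s\<bar> < \<rho> / (1 + C)"
    using \<rho> C by (auto simp: eventually_at intro!: exI[of _ "\<rho> / (1 + C)"])
  with C(2) have "\<forall>\<^sub>F s in at 0. \<bar>norm (forcing s)\<bar> \<le> (sqrt pi * K) * \<bar>s\<bar> ^ d"
  proof eventually_elim
    case (elim s)
    have "C * \<bar>s\<bar> \<le> (1 + C) * \<bar>s\<bar>" by (simp add: algebra_simps)
    also have "\<dots> \<le> \<rho>" using elim(2) C by (simp add: pos_less_divide_eq mult.commute)
    finally have Cs: "C * \<bar>s\<bar> \<le> \<rho>" .
    have "AE x in leb. norm (nonlinearity a (profile s x)) \<le> K * \<bar>s\<bar> ^ d"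
      using elim(1)[THEN conjunct1]
    proof eventually_elim
      case (elim x)
      have "norm (nonlinearity a (profile s x)) \<le> C1 * (norm (profile s x) / (2 * \<rho>)) ^ d"
        using elim Cs by (intro nb') auto
      also have "\<dots> \<le> C1 * (C * \<bar>s\<bar> / (2 * \<rho>)) ^ d"
        using elim C1 \<rho> by (intro mult_left_mono power_mono divide_right_mono) auto
      finally show ?case by (simp add: K_def power_mult_distrib power_divide)
    qed
    then have "norm (L2_of (\<lambda>x. nonlinearity a (profile s x))) \<le> sqrt pi * (K * \<bar>s\<bar> ^ d)"
      using elim(1) K by (intro norm_L2_of_le) (auto simp: L2_funs_def)
    then show ?case using elim(1) by (simp add: mult.assoc)
  qed
  then show ?thesis by (rule bigo_at_0I)
qed

lemma reduced_eq: "r s = 2 / pi * inner (forcing s) e"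
  by (simp add: reduced_nonlinearity_def inner_e_e)

lemma reduced_order: "r \<in> O[at 0](\<lambda>s. s ^ d)"
proof -
  have "r \<in> O[at 0](\<lambda>s. norm (forcing s))"
  proof (rule bigoI)
    show "\<forall>\<^sub>F s in at 0. norm (r s) \<le> (2 / pi * norm e) * norm (norm (forcing s))"
      using Cauchy_Schwarz_ineq2[of "forcing s" e for s]
      by (intro always_eventually allI) (simp add: reduced_eq abs_mult field_simps)
  qed
  then show ?thesis using forcing_order by (rule landau_o.big_trans)
qed

text \<open>In the invariance equation the forcing and \<open>r\<close> have order \<open>d\<close>, hence so has \<open>A (\<Phi> s)\<close>: this
  improves on the quadratic bound that defines the center manifold.\<close>
lemma manifold_order: "(\<lambda>s. norm (A (\<Phi> s))) \<in> O[at 0](\<lambda>s. s ^ d)"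
proof -
  obtain \<Phi>' where D: "(\<lambda>s. norm (\<Phi>' s)) \<in> O[at 0](\<lambda>s. s)"
    and inv: "\<forall>\<^sub>F s in at 0. A (\<Phi> s) = r s *\<^sub>R \<Phi>' s + r s *\<^sub>R e - forcing s"
    by (rule center_manifold_facts) (rule that)
  have D1: "(\<lambda>s. norm (\<Phi>' s)) \<in> O[at 0](\<lambda>s. 1)"
    using landau_o.big_trans[OF _ power_bigo_at_0[of 0 1]] D by simp
  have "(\<lambda>s. r s * norm (\<Phi>' s)) \<in> O[at 0](\<lambda>s. s ^ d * 1)"
    by (rule landau_o.big.mult[OF reduced_order D1])
  moreover have "(\<lambda>s. r s * norm e) \<in> O[at 0](\<lambda>s. s ^ d)"
    using reduced_order by (cases "norm e = 0") auto
  ultimately have S: "(\<lambda>s. \<bar>r s * norm (\<Phi>' s)\<bar> + \<bar>r s * norm e\<bar> + norm (forcing s)) \<in> O[at 0](\<lambda>s. s ^ d)"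
    using forcing_order by (intro sum_in_bigo) (auto simp: landau_o.big.abs_in_iff)
  have "(\<lambda>s. norm (A (\<Phi> s))) \<in> O[at 0](\<lambda>s. \<bar>r s * norm (\<Phi>' s)\<bar> + \<bar>r s * norm e\<bar> + norm (forcing s))"
  proof (rule landau_o.big_mono)
    show "\<forall>\<^sub>F s in at 0. norm (norm (A (\<Phi> s))) \<le> norm (\<bar>r s * norm (\<Phi>' s)\<bar> + \<bar>r s * norm e\<bar> + norm (forcing s))"
      using inv
    proof eventually_elim
      case (elim s)
      have "norm (A (\<Phi> s)) \<le> norm (r s *\<^sub>R \<Phi>' s) + norm (r s *\<^sub>R e) + norm (forcing s)"
        unfolding elim by (intro order_trans[OF norm_triangle_ineq4] add_right_mono norm_triangle_ineq)
      then show ?case by (simp add: abs_mult)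
    qed
  qed
  then show ?thesis using S by (rule landau_o.big_trans)
qed


subsection \<open>Expansion of the reduced nonlinearity\<close>

lemma sine_power_L2: "(\<lambda>x. sin (real c * x) ^ d *\<^sub>R v) \<in> L2_funs"
  by (intro continuous_in_L2_funs continuous_intros)

lemma inner_sine_power_E:
  assumes "1 \<le> m"
  shows "inner (sine_power v) (E (m, n)) = Re (sine_integral m c d) * (v \<bullet> \<alpha> m n)"
proof -
  have "inner (sine_power v) (E (m, n)) = (\<integral>x. (v \<bullet> \<alpha> m n) * (sin (real m * x) * sin (real c * x) ^ d) \<partial>leb)"
    unfolding sine_power_def E_def case_prod_conv inner_mode[OF sine_power_L2]
    by (simp only: inner_scaleR_left mult_ac)
  then show ?thesis by (simp add: sine_integral_eq[OF assms])
qed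

lemma self_number_eq:
  "self_number c \<alpha> a N = 2 / pi * (\<integral>x. sin (real c * x) ^ (N + 1) \<partial>leb) * (hom_part a N \<alpha>\<^sub>c \<bullet> \<alpha>\<^sub>c)"
proof -
  have "(\<Sum>(k, l)\<in>{(k, l). k + l = N}. (a k l \<bullet> \<alpha> c 1) * fst (\<alpha> c 1) ^ k * snd (\<alpha> c 1) ^ l)
     = hom_part a N \<alpha>\<^sub>c \<bullet> \<alpha>\<^sub>c"
    unfolding hom_part_def inner_sum_left \<alpha>\<^sub>c_def by (rule sum.cong) auto
  then show ?thesis unfolding self_number_def self_coeff_eq_integral[OF c] by simp
qed

lemma forcing_leading_order:
  "(\<lambda>s. norm (forcing s - s ^ d *\<^sub>R sine_power g)) \<in> O[at 0](\<lambda>s. s ^ (d + 1))"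
proof -
  obtain C0 where C0: "0 \<le> C0" "\<forall>\<^sub>F s in at 0. AE x in leb. norm (rep_L2 (\<Phi> s) x) \<le> C0 * \<bar>s\<bar> ^ d"
    by (rule sup_order[OF manifold_order]) (rule that)
  obtain C \<delta> where \<delta>: "0 < \<delta>" and C:
    "\<And>s \<sigma> h. \<bar>s\<bar> < \<delta> \<Longrightarrow> \<bar>\<sigma>\<bar> \<le> 1 \<Longrightarrow> norm h \<le> C0 * \<bar>s\<bar> ^ d \<Longrightarrow>
      norm (nonlinearity a ((s * \<sigma>) *\<^sub>R \<alpha>\<^sub>c + h) - (s * \<sigma>) ^ d *\<^sub>R g) \<le> C * \<bar>s\<bar> ^ (d + 1)"
    by (rule pointwise_leading_order[OF C0(1)]) (rule that)
  obtain C2 where C2: "\<forall>\<^sub>F s in at 0. (AE x in leb. norm (profile s x) \<le> C2 * \<bar>s\<bar>) \<and>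
    (\<lambda>x. nonlinearity a (profile s x)) \<in> L2_funs \<and> forcing s = L2_of (\<lambda>x. nonlinearity a (profile s x))"
    by (rule forcing_eq) (rule that)
  have "\<forall>\<^sub>F s::real in at 0. \<bar>s\<bar> < \<delta>"
    using \<delta> by (auto simp: eventually_at)
  with C0(2) C2 have "\<forall>\<^sub>F s in at 0. \<bar>norm (forcing s - s ^ d *\<^sub>R sine_power g)\<bar> \<le> sqrt pi * \<bar>C\<bar> * \<bar>s\<bar> ^ (d + 1)"
  proof eventually_elim
    case (elim s)
    let ?f = "\<lambda>x. nonlinearity a (profile s x) - s ^ d *\<^sub>R (sin (real c * x) ^ d *\<^sub>R g)"
    have L: "(\<lambda>x. nonlinearity a (profile s x)) \<in> L2_funs" using elim by blast
    have f: "?f \<in> L2_funs" by (intro L2_funs_diff L L2_funs_scaleR sine_power_L2)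
    have "L2_of ?f = forcing s - s ^ d *\<^sub>R sine_power g"
      unfolding L2_of_diff[OF L L2_funs_scaleR[OF sine_power_L2]] L2_of_scaleR[OF sine_power_L2]
      using elim by (simp add: sine_power_def)
    moreover have "norm (L2_of ?f) \<le> sqrt pi * (\<bar>C\<bar> * \<bar>s\<bar> ^ (d + 1))"
    proof (rule norm_L2_of_le)
      show "AE x in leb. norm (?f x) \<le> \<bar>C\<bar> * \<bar>s\<bar> ^ (d + 1)"
        using elim(1)
      proof eventually_elim
        case (elim x)
        have "norm (?f x) \<le> C * \<bar>s\<bar> ^ (d + 1)"
          using C[OF \<open>\<bar>s\<bar> < \<delta>\<close> _ elim, of "sin (real c * x)"] by (simp add: profile_def power_mult_distrib)
        also have "\<dots> \<le> \<bar>C\<bar> * \<bar>s\<bar> ^ (d + 1)" by (intro mult_right_mono) auto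
        finally show ?case .
      qed
    qed (use f in \<open>auto simp: L2_funs_def\<close>)
    ultimately show ?case by (simp add: mult.assoc)
  qed
  then show ?thesis by (rule bigo_at_0I)
qed

text \<open>The pointwise expansion is multiplied by \<open>sin (c x) \<alpha>\<^sub>c\<close> and integrated. The powers of \<open>s\<close> collect the
  self interaction numbers, and the term linear in \<open>\<Phi>\<close> becomes its pairing with the gradient \<open>q\<close>.\<close>
lemma reduced_expansion:
  "(\<lambda>s. r s - (\<Sum>N=d..2 * d - 1. self_number c \<alpha> a N * s ^ N)
      - 2 / pi * s ^ (d - 1) * inner (\<Phi> s) (sine_power q)) \<in> O[at 0](\<lambda>s. s ^ (2 * d))"
proof -
  obtain C0 where C0: "0 \<le> C0" "\<forall>\<^sub>F s in at 0. AE x in leb. norm (rep_L2 (\<Phi> s) x) \<le> C0 * \<bar>s\<bar> ^ d"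
    by (rule sup_order[OF manifold_order]) (rule that)
  obtain C \<delta> where \<delta>: "0 < \<delta>" and C:
    "\<And>s \<sigma> h. \<bar>s\<bar> < \<delta> \<Longrightarrow> \<bar>\<sigma>\<bar> \<le> 1 \<Longrightarrow> norm h \<le> C0 * \<bar>s\<bar> ^ d \<Longrightarrow>
      norm (nonlinearity a ((s * \<sigma>) *\<^sub>R \<alpha>\<^sub>c + h)
        - (\<Sum>N=d..2 * d - 1. (s * \<sigma>) ^ N *\<^sub>R hom_part a N \<alpha>\<^sub>c)
        - (s * \<sigma>) ^ (d - 1) *\<^sub>R hom_deriv a d \<alpha>\<^sub>c h) \<le> C * \<bar>s\<bar> ^ (2 * d)"
    by (rule pointwise_expansion[OF C0(1)]) (rule that)
  obtain C2 where C2: "\<forall>\<^sub>F s in at 0. (AE x in leb. norm (profile s x) \<le> C2 * \<bar>s\<bar>) \<and>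
    (\<lambda>x. nonlinearity a (profile s x)) \<in> L2_funs \<and> forcing s = L2_of (\<lambda>x. nonlinearity a (profile s x))"
    by (rule forcing_eq) (rule that)
  have "\<forall>\<^sub>F s::real in at 0. \<bar>s\<bar> < \<delta>"
    using \<delta> by (auto simp: eventually_at)
  with C0(2) C2 have "\<forall>\<^sub>F s in at 0. \<bar>r s - (\<Sum>N=d..2 * d - 1. self_number c \<alpha> a N * s ^ N)
      - 2 / pi * s ^ (d - 1) * inner (\<Phi> s) (sine_power q)\<bar> \<le> 2 * C * \<bar>s\<bar> ^ (2 * d)"
  proof eventually_elim
    case (elim s)
    interpret finite_measure leb by (rule finite_measure_leb)
    define \<sigma> where "\<sigma> x = sin (real c * x)" for x
    define \<phi> where "\<phi> = rep_L2 (\<Phi> s)"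
    define I where "I N = (\<integral>x. \<sigma> x ^ (N + 1) \<partial>leb)" for N
    define f1 where "f1 = (\<lambda>x. nonlinearity a (profile s x) \<bullet> (\<sigma> x *\<^sub>R \<alpha>\<^sub>c))"
    define f2 where "f2 = (\<lambda>x. (\<Sum>N=d..2 * d - 1. (s ^ N * (hom_part a N \<alpha>\<^sub>c \<bullet> \<alpha>\<^sub>c)) * \<sigma> x ^ (N + 1)))"
    define f3 where "f3 = (\<lambda>x. s ^ (d - 1) * (\<phi> x \<bullet> (\<sigma> x ^ d *\<^sub>R q)))"
    have L: "(\<lambda>x. nonlinearity a (profile s x)) \<in> L2_funs" using elim by blast
    have sL: "(\<lambda>x. \<sigma> x *\<^sub>R \<alpha>\<^sub>c) \<in> L2_funs" unfolding \<sigma>_def by (rule sin_scaleR_in_L2_funs)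
    have qL: "(\<lambda>x. \<sigma> x ^ d *\<^sub>R q) \<in> L2_funs" unfolding \<sigma>_def by (rule sine_power_L2)
    have pL: "\<phi> \<in> L2_funs" unfolding \<phi>_def by (rule rep_L2_in)
    have i1: "integrable leb f1" unfolding f1_def by (rule L2_funs_integrable_inner[OF L sL])
    have ip: "integrable leb (\<lambda>x. \<sigma> x ^ N)" for N
      unfolding \<sigma>_def by (intro integrable_leb_continuous continuous_intros)
    have i2: "integrable leb f2" unfolding f2_def
      by (intro Bochner_Integration.integrable_sum Bochner_Integration.integrable_mult_right ip)
    have i3: "integrable leb f3" unfolding f3_def
      by (intro Bochner_Integration.integrable_mult_right L2_funs_integrable_inner pL qL)
    have v1: "integral\<^sup>L leb f1 = inner (forcing s) e"
      using elim(2) inner_L2_of[OF L sL] by (simp add: f1_def e_def mode_def \<sigma>_def)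
    have v2: "integral\<^sup>L leb f2 = (\<Sum>N=d..2 * d - 1. (s ^ N * (hom_part a N \<alpha>\<^sub>c \<bullet> \<alpha>\<^sub>c)) * I N)"
      unfolding f2_def I_def
      by (subst Bochner_Integration.integral_sum) (auto intro!: Bochner_Integration.integrable_mult_right ip simp del: power_Suc)
    have v3: "integral\<^sup>L leb f3 = s ^ (d - 1) * inner (\<Phi> s) (sine_power q)"
      using inner_L2_of[OF pL qL] by (simp add: f3_def sine_power_def \<sigma>_def \<phi>_def L2_of_rep)
    have bound: "AE x in leb. \<bar>f1 x - (f2 x + f3 x)\<bar> \<le> C * \<bar>s\<bar> ^ (2 * d)"
      using elim(1)
    proof eventually_elim
      case (elim x)
      let ?D = "nonlinearity a (profile s x)
        - (\<Sum>N=d..2 * d - 1. (s * \<sigma> x) ^ N *\<^sub>R hom_part a N \<alpha>\<^sub>c)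
        - (s * \<sigma> x) ^ (d - 1) *\<^sub>R hom_deriv a d \<alpha>\<^sub>c (\<phi> x)"
      have D: "norm ?D \<le> C * \<bar>s\<bar> ^ (2 * d)"
        using C[OF \<open>\<bar>s\<bar> < \<delta>\<close> _ elim, of "\<sigma> x"] by (simp add: profile_def \<sigma>_def \<phi>_def)
      have "\<sigma> x * \<sigma> x ^ (d - 1) = \<sigma> x ^ d" using d by (simp flip: power_Suc)
      then have z: "\<sigma> x * ((s * \<sigma> x) ^ (d - 1) * b) = s ^ (d - 1) * (\<sigma> x ^ d * b)" for b
        by (simp add: power_mult_distrib algebra_simps)
      have "?D \<bullet> (\<sigma> x *\<^sub>R \<alpha>\<^sub>c) = f1 x - (f2 x + f3 x)"
        unfolding f1_def f2_def f3_def inner_diff_left inner_sum_left inner_scaleR_left inner_scaleR_right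
          hom_deriv_inner right_diff_distrib z
        by (simp add: power_mult_distrib sum_distrib_left mult_ac)
      moreover have "\<bar>?D \<bullet> (\<sigma> x *\<^sub>R \<alpha>\<^sub>c)\<bar> \<le> norm ?D * norm (\<sigma> x *\<^sub>R \<alpha>\<^sub>c)"
        by (rule Cauchy_Schwarz_ineq2)
      moreover have "norm ?D * norm (\<sigma> x *\<^sub>R \<alpha>\<^sub>c) \<le> norm ?D * 1"
        using norm_critical_vector by (intro mult_left_mono) (auto simp: \<sigma>_def)
      ultimately show ?case using D by linarith
    qed
    have i: "integrable leb (\<lambda>x. f1 x - (f2 x + f3 x))" using i1 i2 i3 by auto
    have "\<bar>\<integral>x. f1 x - (f2 x + f3 x) \<partial>leb\<bar> \<le> (\<integral>x. \<bar>f1 x - (f2 x + f3 x)\<bar> \<partial>leb)"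
      by (rule integral_abs_bound)
    also have "\<dots> \<le> (\<integral>x. C * \<bar>s\<bar> ^ (2 * d) \<partial>leb)"
      by (rule integral_mono_AE) (use i bound in auto)
    also have "\<dots> = pi * (C * \<bar>s\<bar> ^ (2 * d))" using measure_leb by simp
    also have "(\<integral>x. f1 x - (f2 x + f3 x) \<partial>leb) = inner (forcing s) e
       - (\<Sum>N=d..2 * d - 1. (s ^ N * (hom_part a N \<alpha>\<^sub>c \<bullet> \<alpha>\<^sub>c)) * I N) - s ^ (d - 1) * inner (\<Phi> s) (sine_power q)"
      using i1 i2 i3 by (simp add: v1 v2 v3)
    finally have fin: "\<bar>inner (forcing s) e
       - (\<Sum>N=d..2 * d - 1. (s ^ N * (hom_part a N \<alpha>\<^sub>c \<bullet> \<alpha>\<^sub>c)) * I N) - s ^ (d - 1) * inner (\<Phi> s) (sine_power q)\<bar>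
       \<le> pi * (C * \<bar>s\<bar> ^ (2 * d))" .
    have "r s - (\<Sum>N=d..2 * d - 1. self_number c \<alpha> a N * s ^ N)
      - 2 / pi * s ^ (d - 1) * inner (\<Phi> s) (sine_power q) =
      2 / pi * (inner (forcing s) e
       - (\<Sum>N=d..2 * d - 1. (s ^ N * (hom_part a N \<alpha>\<^sub>c \<bullet> \<alpha>\<^sub>c)) * I N) - s ^ (d - 1) * inner (\<Phi> s) (sine_power q))"
      unfolding reduced_eq self_number_eq I_def \<sigma>_def right_diff_distrib sum_distrib_left
      by (simp add: mult_ac)
    then have "\<bar>r s - (\<Sum>N=d..2 * d - 1. self_number c \<alpha> a N * s ^ N)
      - 2 / pi * s ^ (d - 1) * inner (\<Phi> s) (sine_power q)\<bar> =
      2 / pi * \<bar>inner (forcing s) e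
       - (\<Sum>N=d..2 * d - 1. (s ^ N * (hom_part a N \<alpha>\<^sub>c \<bullet> \<alpha>\<^sub>c)) * I N) - s ^ (d - 1) * inner (\<Phi> s) (sine_power q)\<bar>"
      by (simp only: abs_mult) simp
    also have "\<dots> \<le> 2 / pi * (pi * (C * \<bar>s\<bar> ^ (2 * d)))"
      using fin by (rule mult_left_mono) simp
    finally show ?case by simp
  qed
  then show ?thesis by (rule bigo_at_0I)
qed

text \<open>Up to a constant factor, the contribution of the mode \<open>p\<close> to the pairing of \<open>sine_power v\<close> with
  the preimage under the operator of the stable part of \<open>sine_power w\<close>.\<close>
definition mode_product :: "real \<times> real \<Rightarrow> real \<times> real \<Rightarrow> nat \<times> nat \<Rightarrow> real" where
  "mode_product v w p = inner (sine_power v) (E p) / \<beta> (fst p) (snd p) * inner (sine_power w) (E p)"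

lemma mode_product_summable: "mode_product v w summable_on stable"
proof (rule abs_summable_summable)
  show "(\<lambda>p. norm (mode_product v w p)) summable_on stable"
  proof (rule summable_on_comparison_test)
    show "(\<lambda>p. \<bar>inner (sine_power v) (E p) / \<beta> (fst p) (snd p)\<bar> * (norm (sine_power w) * sqrt (pi / 2))) summable_on stable"
      by (intro summable_on_cmult_left resolvent_coefficients_summable)
    fix p assume p: "p \<in> stable"
    have "\<bar>inner (sine_power w) (E p)\<bar> \<le> norm (sine_power w) * sqrt (pi / 2)"
      using Cauchy_Schwarz_ineq2[of "sine_power w" "E p"] by (simp only: norm_E_stable[OF p])
    then show "norm (mode_product v w p) \<le> \<bar>inner (sine_power v) (E p) / \<beta> (fst p) (snd p)\<bar> * (norm (sine_power w) * sqrt (pi / 2))"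
      unfolding mode_product_def real_norm_def abs_mult by (rule mult_left_mono) simp
  qed auto
qed

text \<open>To leading order \<open>A (\<Phi> s)\<close> is the stable part of \<open>- s\<^sup>d sine_power g\<close>. The error \<open>Z\<close> has order \<open>d + 1\<close> in
  norm, and its effect on the pairing is bounded by the absolutely summable weights \<open>b p\<close>.\<close>
lemma manifold_pairing:
  "(\<lambda>s. inner (\<Phi> s) (sine_power v) + 2 / pi * s ^ d * (\<Sum>\<^sub>\<infinity>p\<in>stable. mode_product v g p)) \<in> O[at 0](\<lambda>s. s ^ (d + 1))"
proof -
  obtain \<Phi>' where dom: "\<forall>\<^sub>F s in at 0. \<Phi> s \<in> H1 \<and> \<Phi> s \<in> closure (span (E ` stable))"
    and D: "(\<lambda>s. norm (\<Phi>' s)) \<in> O[at 0](\<lambda>s. s)"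
    and inv: "\<forall>\<^sub>F s in at 0. A (\<Phi> s) = r s *\<^sub>R \<Phi>' s + r s *\<^sub>R e - forcing s"
    by (rule center_manifold_facts) (rule that)
  define b where "b p = inner (sine_power v) (E p) / \<beta> (fst p) (snd p)" for p
  define K where "K = 2 / pi * (\<Sum>\<^sub>\<infinity>p\<in>stable. \<bar>b p\<bar>) * sqrt (pi / 2)"
  have bs: "(\<lambda>p. \<bar>b p\<bar>) summable_on stable"
    unfolding b_def by (rule resolvent_coefficients_summable)
  define Z where "Z s = r s *\<^sub>R \<Phi>' s - (forcing s - s ^ d *\<^sub>R sine_power g)" for s
  have "(\<lambda>s. r s * norm (\<Phi>' s)) \<in> O[at 0](\<lambda>s. s ^ d * s)"
    by (rule landau_o.big.mult[OF reduced_order D])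
  then have "(\<lambda>s. \<bar>r s * norm (\<Phi>' s)\<bar> + norm (forcing s - s ^ d *\<^sub>R sine_power g)) \<in> O[at 0](\<lambda>s. s ^ (d + 1))"
    using forcing_leading_order by (intro sum_in_bigo) (auto simp: landau_o.big.abs_in_iff mult.commute)
  moreover have "(\<lambda>s. norm (Z s)) \<in> O[at 0](\<lambda>s. \<bar>r s * norm (\<Phi>' s)\<bar> + norm (forcing s - s ^ d *\<^sub>R sine_power g))"
  proof (intro landau_o.big_mono always_eventually allI)
    fix s
    show "norm (norm (Z s)) \<le> norm (\<bar>r s * norm (\<Phi>' s)\<bar> + norm (forcing s - s ^ d *\<^sub>R sine_power g))"
      unfolding Z_def using norm_triangle_ineq4[of "r s *\<^sub>R \<Phi>' s" "forcing s - s ^ d *\<^sub>R sine_power g"]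
      by (simp add: abs_mult)
  qed
  ultimately have Z: "(\<lambda>s. norm (Z s)) \<in> O[at 0](\<lambda>s. s ^ (d + 1))"
    by (rule landau_o.big_trans[rotated])
  have "(\<lambda>s. inner (\<Phi> s) (sine_power v) + 2 / pi * s ^ d * (\<Sum>\<^sub>\<infinity>p\<in>stable. mode_product v g p)) \<in> O[at 0](\<lambda>s. norm (Z s))"
  proof (rule bigoI)
    show "\<forall>\<^sub>F s in at 0. norm (inner (\<Phi> s) (sine_power v) + 2 / pi * s ^ d * (\<Sum>\<^sub>\<infinity>p\<in>stable. mode_product v g p)) \<le> K * norm (norm (Z s))"
      using dom inv
    proof eventually_elim
      case (elim s)
      have "((\<lambda>p. 2 / pi * b p * inner (A (\<Phi> s)) (E p) + 2 / pi * s ^ d * mode_product v g p) has_sum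
        (inner (\<Phi> s) (sine_power v) + 2 / pi * s ^ d * (\<Sum>\<^sub>\<infinity>p\<in>stable. mode_product v g p))) stable"
        unfolding b_def using elim
        by (intro has_sum_add inner_by_modes has_sum_cmult_right has_sum_infsum mode_product_summable) auto
      moreover have "((\<lambda>p. 2 / pi * \<bar>b p\<bar> * (sqrt (pi / 2) * norm (Z s))) has_sum
        2 / pi * (\<Sum>\<^sub>\<infinity>p\<in>stable. \<bar>b p\<bar>) * (sqrt (pi / 2) * norm (Z s))) stable"
        by (intro has_sum_cmult_left has_sum_cmult_right has_sum_infsum bs)
      ultimately have "norm (inner (\<Phi> s) (sine_power v) + 2 / pi * s ^ d * (\<Sum>\<^sub>\<infinity>p\<in>stable. mode_product v g p))
        \<le> 2 / pi * (\<Sum>\<^sub>\<infinity>p\<in>stable. \<bar>b p\<bar>) * (sqrt (pi / 2) * norm (Z s))"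
      proof (rule norm_infsum_le)
        fix p assume p: "p \<in> stable"
        have x: "inner (A (\<Phi> s)) (E p) = inner (Z s) (E p) - s ^ d * inner (sine_power g) (E p)"
          using inner_e_stable[OF p] unfolding elim(2) Z_def
          by (simp add: inner_diff_left inner_add_left)
        have Qb: "mode_product v g p = b p * inner (sine_power g) (E p)" by (simp add: mode_product_def b_def)
        have "2 / pi * b p * inner (A (\<Phi> s)) (E p) + 2 / pi * s ^ d * mode_product v g p = 2 / pi * b p * inner (Z s) (E p)"
          unfolding x Qb by (simp add: right_diff_distrib mult_ac)
        also have "norm \<dots> = 2 / pi * \<bar>b p\<bar> * \<bar>inner (Z s) (E p)\<bar>"
          by (simp add: abs_mult)
        also have "\<dots> \<le> 2 / pi * \<bar>b p\<bar> * (sqrt (pi / 2) * norm (Z s))"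
          using Cauchy_Schwarz_ineq2[of "Z s" "E p"]
          by (intro mult_left_mono) (simp_all only: norm_E_stable[OF p] mult.commute, simp)
        finally show "norm (2 / pi * b p * inner (A (\<Phi> s)) (E p) + 2 / pi * s ^ d * mode_product v g p)
          \<le> 2 / pi * \<bar>b p\<bar> * (sqrt (pi / 2) * norm (Z s))" .
      qed
      then show ?case by (simp add: K_def mult.assoc)
    qed
  qed
  then show ?thesis using Z by (rule landau_o.big_trans)
qed

section \<open>The cross interaction number\<close>

text \<open>The term of the monomial \<open>(k, l)\<close> in the gradient \<open>q\<close>.\<close>
definition outer_vec :: "nat \<times> nat \<Rightarrow> real \<times> real" where
  "outer_vec = (\<lambda>(k, l). (a k l \<bullet> \<alpha>\<^sub>c) *\<^sub>R
     (real k * fst \<alpha>\<^sub>c ^ (k - 1) * snd \<alpha>\<^sub>c ^ l, real l * fst \<alpha>\<^sub>c ^ k * snd \<alpha>\<^sub>c ^ (l - 1)))"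

text \<open>The term of the monomial \<open>(k, l)\<close> in \<open>g\<close>.\<close>
definition inner_vec :: "nat \<times> nat \<Rightarrow> real \<times> real" where
  "inner_vec = (\<lambda>(k, l). (fst \<alpha>\<^sub>c ^ k * snd \<alpha>\<^sub>c ^ l) *\<^sub>R a k l)"

text \<open>The indices of the cross interaction number with \<open>N1 = N2 = d\<close>, parametrised by two monomials of
  degree \<open>d\<close> and a mode.\<close>
definition leading_index :: "(nat \<times> nat) \<times> (nat \<times> nat) \<Rightarrow> nat \<times> nat \<Rightarrow> nat \<times> nat \<times> nat \<times> nat \<times> nat \<times> nat \<times> nat \<times> nat" where
  "leading_index = (\<lambda>((k, l), (k', l')) (m, n). (d, d, k, l, k', l', m, n))"

definition cross_term :: "nat \<times> nat \<times> nat \<times> nat \<times> nat \<times> nat \<times> nat \<times> nat \<Rightarrow> real" where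
  "cross_term = (\<lambda>(N1, N2, k, l, k', l', m, n).
        1 / \<beta> m n * cross_coeff c \<alpha> (N1, N2, k, l, k', l', m, n) *
        (a k l \<bullet> \<alpha> c 1) * (a k' l' \<bullet> \<alpha> m n))"

abbreviation degree_d :: "(nat \<times> nat) set" where "degree_d \<equiv> {(k, l). k + l = d}"

lemma cross_number_eq: "cross_number c \<beta> \<alpha> a N = infsum cross_term (cross_indices c N)"
  by (simp add: cross_number_def cross_term_def)

lemma mode_product_stable:
  assumes "(m, n) \<in> stable"
  shows "mode_product v w (m, n) = (Re (sine_integral m c d))\<^sup>2 / \<beta> m n * (v \<bullet> \<alpha> m n) * (w \<bullet> \<alpha> m n)"
proof -
  have "1 \<le> m" using assms by (simp add: stable_def)
  then show ?thesis by (simp add: mode_product_def inner_sine_power_E power2_eq_square)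
qed

lemma cross_term_leading_index:
  assumes i: "i \<in> degree_d \<times> degree_d" and p: "p \<in> stable"
  shows "cross_term (leading_index i p) = - 4 / pi\<^sup>2 * mode_product (outer_vec (fst i)) (inner_vec (snd i)) p"
proof -
  obtain k l k' l' m n where ip: "i = ((k, l), (k', l'))" "p = (m, n)"
    by (metis surj_pair)
  have 1: "real k * x ^ (k + k' - 1) = real k * x ^ (k - 1) * x ^ k'" for x :: real
    by (cases k) (auto simp: power_add)
  have 2: "real l * x ^ (l + l' - 1) = real l * x ^ (l - 1) * x ^ l'" for x :: real
    by (cases l) (auto simp: power_add)
  define x y J where "x = fst \<alpha>\<^sub>c" and "y = snd \<alpha>\<^sub>c" and "J = Re (sine_integral m c d)"
  have Av: "outer_vec (k, l) \<bullet> v = (a k l \<bullet> \<alpha>\<^sub>c) *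
      (real k * x ^ (k - 1) * y ^ l * fst v + real l * x ^ k * y ^ (l - 1) * snd v)" for v
    unfolding outer_vec_def case_prod_conv inner_scaleR_left x_def y_def by (simp add: inner_prod_def)
  have Bv: "inner_vec (k', l') \<bullet> v = x ^ k' * y ^ l' * (a k' l' \<bullet> v)" for v
    unfolding inner_vec_def case_prod_conv inner_scaleR_left x_def y_def ..
  have "cross_term (leading_index i p) = 1 / \<beta> m n * (- 4 / pi\<^sup>2 *
     (real k * x ^ (k + k' - 1) * y ^ (l + l') * fst (\<alpha> m n) +
      x ^ (k + k') * (real l * y ^ (l + l' - 1)) * snd (\<alpha> m n)) * J * J) * (a k l \<bullet> \<alpha>\<^sub>c) * (a k' l' \<bullet> \<alpha> m n)"
    by (simp add: cross_term_def leading_index_def ip cross_coeff_def x_def y_def J_def \<alpha>\<^sub>c_def mult_ac)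
  also have "\<dots> = - 4 / pi\<^sup>2 * (J\<^sup>2 / \<beta> m n * ((a k l \<bullet> \<alpha>\<^sub>c) * (real k * x ^ (k - 1) * y ^ l * fst (\<alpha> m n)
       + real l * x ^ k * y ^ (l - 1) * snd (\<alpha> m n))) * ((x ^ k' * y ^ l') * (a k' l' \<bullet> \<alpha> m n)))"
    unfolding 1 2 power_add by (simp add: algebra_simps power2_eq_square)
  also have "\<dots> = - 4 / pi\<^sup>2 * mode_product (outer_vec (k, l)) (inner_vec (k', l')) (m, n)"
    using p unfolding ip(2) by (subst mode_product_stable) (simp_all only: J_def Av Bv)
  finally show ?thesis by (simp add: ip)
qed

lemma mode_product_bilinear:
  assumes "p \<in> stable"
  shows "mode_product q g p = (\<Sum>i\<in>degree_d \<times> degree_d. mode_product (outer_vec (fst i)) (inner_vec (snd i)) p)"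
proof -
  obtain m n where p: "p = (m, n)" by (cases p)
  have q: "q = (\<Sum>i\<in>degree_d. outer_vec i)" and g: "g = (\<Sum>j\<in>degree_d. inner_vec j)"
    by (simp_all add: q_def outer_vec_def hom_part_def inner_vec_def)
  have "mode_product q g p = (\<Sum>i\<in>degree_d. \<Sum>j\<in>degree_d. mode_product (outer_vec i) (inner_vec j) p)"
    using assms unfolding p
    by (simp add: mode_product_stable q g inner_sum_left sum_distrib_left sum_distrib_right sum_divide_distrib mult_ac)
  then show ?thesis by (simp add: sum.cartesian_product case_prod_unfold)
qed

text \<open>Since \<open>N1 + N2 \<le> 2 d\<close>, unless both equal \<open>d\<close> one of them is smaller than \<open>d\<close>, and the
  coefficients of that degree vanish.\<close>
lemma cross_term_zero:
  assumes "(N1, N2, k, l, k', l', m, n) \<in> cross_indices c N" "N \<le> 2 * d - 1" "\<not> (N1 = d \<and> N2 = d)"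
  shows "cross_term (N1, N2, k, l, k', l', m, n) = 0"
proof -
  have "N1 < d \<or> N2 < d" and "k + l = N1" "k' + l' = N2" "2 \<le> N1" "2 \<le> N2"
    using assms by (auto simp: cross_indices_def)
  then have "a k l = 0 \<or> a k' l' = 0" using low by auto
  then show ?thesis by (auto simp: cross_term_def)
qed

lemma cross_number_low:
  assumes "N < 2 * d - 1"
  shows "cross_number c \<beta> \<alpha> a N = 0"
  unfolding cross_number_eq
proof (rule infsum_0)
  fix x assume x: "x \<in> cross_indices c N"
  obtain N1 N2 k l k' l' m n where xe: "x = (N1, N2, k, l, k', l', m, n)" by (metis surj_pair)
  show "cross_term x = 0"
    using x assms unfolding xe by (intro cross_term_zero) (auto simp: cross_indices_def)
qed

text \<open>Only the indices with \<open>N1 = N2 = d\<close> contribute. For each of the finitely many pairs of monomials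
  the sum over the modes converges absolutely, and by bilinearity the pairs add up to
  \<open>mode_product q g\<close>.\<close>
lemma cross_number_first:
  "cross_number c \<beta> \<alpha> a (2 * d - 1) = - 4 / pi\<^sup>2 * (\<Sum>\<^sub>\<infinity>p\<in>stable. mode_product q g p)"
proof -
  let ?I = "degree_d \<times> degree_d"
  define V where "V i = - 4 / pi\<^sup>2 * (\<Sum>\<^sub>\<infinity>p\<in>stable. mode_product (outer_vec (fst i)) (inner_vec (snd i)) p)" for i
  have piece: "(cross_term has_sum V i) (leading_index i ` stable)" if i: "i \<in> ?I" for i
  proof -
    have inj: "inj_on (leading_index i) stable"
      by (auto simp: inj_on_def leading_index_def case_prod_unfold prod_eq_iff)
    have "((\<lambda>p. - 4 / pi\<^sup>2 * mode_product (outer_vec (fst i)) (inner_vec (snd i)) p) has_sum V i) stable"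
      unfolding V_def by (intro has_sum_cmult_right has_sum_infsum mode_product_summable)
    then have "((cross_term \<circ> leading_index i) has_sum V i) stable"
      by (rule has_sum_cong[THEN iffD1, rotated]) (simp add: cross_term_leading_index[OF i])
    then show ?thesis using has_sum_reindex[OF inj] by blast
  qed
  have "(cross_term has_sum (\<Sum>i\<in>?I. V i)) (\<Union>i\<in>?I. leading_index i ` stable)"
  proof (rule sum_has_sum)
    show "finite ?I" by simp
    show "leading_index i ` stable \<inter> leading_index j ` stable = {}" if "i \<noteq> j" for i j
      using that by (auto simp: leading_index_def case_prod_unfold prod_eq_iff)
  qed (rule piece)
  moreover have "(cross_term has_sum S) (\<Union>i\<in>?I. leading_index i ` stable) \<longleftrightarrow>
      (cross_term has_sum S) (cross_indices c (2 * d - 1))" for S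
  proof (rule has_sum_cong_neutral)
    fix x assume x: "x \<in> cross_indices c (2 * d - 1) - (\<Union>i\<in>?I. leading_index i ` stable)"
    obtain N1 N2 k l k' l' m n where xe: "x = (N1, N2, k, l, k', l', m, n)" by (metis surj_pair)
    have "\<not> (N1 = d \<and> N2 = d)"
    proof
      assume N: "N1 = d \<and> N2 = d"
      then have "x = leading_index ((k, l), (k', l')) (m, n)" "((k, l), (k', l')) \<in> ?I" "(m, n) \<in> stable"
        using x by (auto simp: xe leading_index_def cross_indices_def stable_def)
      then show False using x by blast
    qed
    then show "cross_term x = 0"
      using x unfolding xe by (intro cross_term_zero) auto
  next
    fix x assume "x \<in> (\<Union>i\<in>?I. leading_index i ` stable) - cross_indices c (2 * d - 1)"
    moreover have "leading_index i p \<in> cross_indices c (2 * d - 1)" if "i \<in> ?I" "p \<in> stable" for i p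
      using that d by (auto simp: leading_index_def cross_indices_def stable_def)
    ultimately show "cross_term x = 0" by blast
  qed simp
  ultimately have "cross_number c \<beta> \<alpha> a (2 * d - 1) = (\<Sum>i\<in>?I. V i)"
    unfolding cross_number_eq by (intro infsumI) simp
  moreover have "(\<Sum>\<^sub>\<infinity>p\<in>stable. mode_product q g p) = (\<Sum>i\<in>?I. \<Sum>\<^sub>\<infinity>p\<in>stable. mode_product (outer_vec (fst i)) (inner_vec (snd i)) p)"
  proof (rule infsumI)
    have "((\<lambda>p. \<Sum>i\<in>?I. mode_product (outer_vec (fst i)) (inner_vec (snd i)) p) has_sum
      (\<Sum>i\<in>?I. \<Sum>\<^sub>\<infinity>p\<in>stable. mode_product (outer_vec (fst i)) (inner_vec (snd i)) p)) stable"
      by (intro has_sum_finite_sum has_sum_infsum mode_product_summable)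
    then show "(mode_product q g has_sum (\<Sum>i\<in>?I. \<Sum>\<^sub>\<infinity>p\<in>stable. mode_product (outer_vec (fst i)) (inner_vec (snd i)) p)) stable"
      by (rule has_sum_cong[THEN iffD1, rotated]) (rule mode_product_bilinear[symmetric])
  qed
  ultimately show ?thesis by (simp add: V_def sum_distrib_left)
qed

section \<open>The leading term of the reduced equation\<close>

lemma transition_number_low:
  assumes "2 \<le> N" "N < d"
  shows "transition_number c \<beta> \<alpha> a N = 0"
  using cross_number_low[of N] assms hom_part_low[OF assms]
  by (simp add: transition_number_def self_number_eq)

text \<open>The pairing of \<open>\<Phi>\<close> with \<open>q\<close> is replaced by its leading term. Multiplied by \<open>s\<^sup>d\<^sup>-\<^sup>1\<close> this is a monomial
  of degree \<open>2 d - 1\<close>, whose coefficient is the first cross interaction number that can be nonzero.\<close>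
lemma transition_expansion:
  "(\<lambda>s. r s - (\<Sum>N=d..2 * d - 1. transition_number c \<beta> \<alpha> a N * s ^ N)) \<in> O[at 0](\<lambda>s. s ^ (2 * d))"
proof -
  define X where "X = (\<Sum>\<^sub>\<infinity>p\<in>stable. mode_product q g p)"
  define f1 where "f1 = (\<lambda>s. r s - (\<Sum>N=d..2 * d - 1. self_number c \<alpha> a N * s ^ N)
      - 2 / pi * s ^ (d - 1) * inner (\<Phi> s) (sine_power q))"
  define f2 where "f2 = (\<lambda>s. inner (\<Phi> s) (sine_power q) + 2 / pi * s ^ d * X)"
  have f1: "f1 \<in> O[at 0](\<lambda>s. s ^ (2 * d))" unfolding f1_def by (rule reduced_expansion)
  have f2: "f2 \<in> O[at 0](\<lambda>s. s ^ (d + 1))" unfolding f2_def X_def by (rule manifold_pairing)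
  have "d - 1 + (d + 1) = 2 * d" using d by simp
  then have p: "(\<lambda>s::real. s ^ (d - 1) * s ^ (d + 1)) = (\<lambda>s. s ^ (2 * d))"
    by (simp only: power_add[symmetric])
  have "(\<lambda>s. s ^ (d - 1) * f2 s) \<in> O[at 0](\<lambda>s. s ^ (d - 1) * s ^ (d + 1))"
    by (intro landau_o.big.mult f2) simp
  then have "(\<lambda>s. 2 / pi * (s ^ (d - 1) * f2 s)) \<in> O[at 0](\<lambda>s. s ^ (2 * d))"
    unfolding p by simp
  with f1 have "(\<lambda>s. f1 s + 2 / pi * (s ^ (d - 1) * f2 s)) \<in> O[at 0](\<lambda>s. s ^ (2 * d))"
    by (rule sum_in_bigo)
  moreover have "r s - (\<Sum>N=d..2 * d - 1. transition_number c \<beta> \<alpha> a N * s ^ N)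
      = f1 s + 2 / pi * (s ^ (d - 1) * f2 s)" for s
  proof -
    have "(\<Sum>N=d..2 * d - 1. cross_number c \<beta> \<alpha> a N * s ^ N) =
        (\<Sum>N=d..2 * d - 1. if N = 2 * d - 1 then cross_number c \<beta> \<alpha> a (2 * d - 1) * s ^ (2 * d - 1) else 0)"
      by (rule sum.cong) (auto simp: cross_number_low)
    also have "\<dots> = cross_number c \<beta> \<alpha> a (2 * d - 1) * s ^ (2 * d - 1)"
      unfolding sum.delta[OF finite_atLeastAtMost] using d by auto
    also have "s ^ (2 * d - 1) = s ^ (d - 1) * s ^ d"
      using d unfolding power_add[symmetric] by (intro arg_cong[of _ _ "\<lambda>n. s ^ n"]) simp
    finally have "(\<Sum>N=d..2 * d - 1. cross_number c \<beta> \<alpha> a N * s ^ N) = - 4 / pi\<^sup>2 * X * (s ^ (d - 1) * s ^ d)"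
      by (simp only: cross_number_first X_def)
    moreover have "(\<Sum>N=d..2 * d - 1. transition_number c \<beta> \<alpha> a N * s ^ N) =
       (\<Sum>N=d..2 * d - 1. self_number c \<alpha> a N * s ^ N) + (\<Sum>N=d..2 * d - 1. cross_number c \<beta> \<alpha> a N * s ^ N)"
      by (simp add: transition_number_def distrib_right sum.distrib)
    moreover have "2 / pi * (s ^ (d - 1) * f2 s) =
        2 / pi * s ^ (d - 1) * inner (\<Phi> s) (sine_power q) + 4 / pi\<^sup>2 * X * (s ^ (d - 1) * s ^ d)"
      by (simp add: f2_def distrib_left power2_eq_square mult_ac)
    ultimately show ?thesis by (simp add: f1_def)
  qed
  ultimately show ?thesis by simp
qed

end

lemma monomial_bigo_zero:
  fixes K :: real
  assumes "(\<lambda>s. K * s ^ m) \<in> O[at 0](\<lambda>s. s ^ (m + 1))"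
  shows "K = 0"
proof (rule ccontr)
  assume K: "K \<noteq> 0"
  obtain C where C: "0 < C" "\<forall>\<^sub>F s in at 0. \<bar>K * s ^ m\<bar> \<le> C * \<bar>s\<bar> ^ (m + 1)"
    by (rule bigo_at_0_bound[OF assms]) (rule that)
  have "\<forall>\<^sub>F s::real in at 0. s \<noteq> 0 \<and> \<bar>s\<bar> < \<bar>K\<bar> / C"
    using K C by (auto simp: eventually_at intro!: exI[of _ "\<bar>K\<bar> / C"])
  with C(2) have "\<forall>\<^sub>F s::real in at 0. False"
  proof eventually_elim
    case (elim s)
    have "\<bar>s\<bar> ^ m * \<bar>K\<bar> \<le> \<bar>s\<bar> ^ m * (C * \<bar>s\<bar>)"
      using elim(1) by (simp add: abs_mult power_abs mult_ac)
    then have "\<bar>K\<bar> \<le> C * \<bar>s\<bar>" using elim(2) by (simp add: mult_le_cancel_left)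
    then show False using elim(2) C by (simp add: pos_less_divide_eq mult.commute)
  qed
  then show False by simp
qed

lemma leading_term_unique:
  assumes "leading_term f m P" "leading_term f m' P'"
  shows "m = m' \<and> P = P'"
proof -
  have less: False if "leading_term f m P" "leading_term f m' P'" "m < m'" for m m' P P'
  proof -
    have 1: "(\<lambda>s. f s - P * s ^ m) \<in> O[at 0](\<lambda>s. s ^ (m + 1))"
      using that by (simp add: leading_term_def)
    have 2: "(\<lambda>s. f s - P' * s ^ m') \<in> O[at 0](\<lambda>s. s ^ (m + 1))"
      using that landau_o.big_trans[OF _ power_bigo_at_0[of "m + 1" "m' + 1"]]
      by (simp add: leading_term_def)
    have 3: "(\<lambda>s. P' * s ^ m') \<in> O[at 0](\<lambda>s. s ^ (m + 1))"
      using that power_bigo_at_0[of "m + 1" m'] by (cases "P' = 0") auto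
    have "(\<lambda>s. (f s - P' * s ^ m') - (f s - P * s ^ m) + P' * s ^ m') \<in> O[at 0](\<lambda>s. s ^ (m + 1))"
      by (rule sum_in_bigo(1)[OF sum_in_bigo(2)[OF 2 1] 3])
    then have "P = 0" by (intro monomial_bigo_zero[of P m]) simp
    then show False using that by (simp add: leading_term_def)
  qed
  have m: "m = m'" using less[OF assms] less[OF assms(2,1)] by (cases m m' rule: linorder_cases) auto
  have 1: "(\<lambda>s. f s - P * s ^ m) \<in> O[at 0](\<lambda>s. s ^ (m + 1))"
    and 2: "(\<lambda>s. f s - P' * s ^ m) \<in> O[at 0](\<lambda>s. s ^ (m + 1))"
    using assms unfolding m by (simp_all add: leading_term_def)
  have "(\<lambda>s. (f s - P' * s ^ m) - (f s - P * s ^ m)) \<in> O[at 0](\<lambda>s. s ^ (m + 1))"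
    by (rule sum_in_bigo(2)[OF 2 1])
  then have "P - P' = 0" by (intro monomial_bigo_zero[of "P - P'" m]) (simp add: left_diff_distrib)
  with m show ?thesis by simp
qed

theorem theorem3p1:
  fixes H1 :: "L2 set"
    and L :: "real \<Rightarrow> L2 \<Rightarrow> L2"
    and \<alpha> :: "real \<Rightarrow> nat \<Rightarrow> nat \<Rightarrow> real \<times> real"
    and \<beta> :: "real \<Rightarrow> nat \<Rightarrow> nat \<Rightarrow> real"
    and lam0 :: real and c :: nat
    and a :: "nat \<Rightarrow> nat \<Rightarrow> real \<times> real"
    and \<Phi> :: "real \<Rightarrow> L2"
    and \<mm> :: nat and P :: real
  assumes "linear_operator_assms H1 L \<alpha> \<beta>"
    and "exchange_of_stabilities \<beta> lam0 c"
    and "nonlinearity_assms a"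
    and "center_manifold_function H1 (L lam0) (\<alpha> lam0) a c \<Phi>"
    and "\<exists>N. 2 \<le> N \<and> N \<le> 2 * lowest_degree a - 1 \<and> transition_number c (\<beta> lam0) (\<alpha> lam0) a N \<noteq> 0"
  shows "leading_term (reduced_nonlinearity a (mode (\<alpha> lam0 c 1) c) \<Phi>) \<mm> P \<longleftrightarrow>
           \<mm> = (LEAST N. 2 \<le> N \<and> transition_number c (\<beta> lam0) (\<alpha> lam0) a N \<noteq> 0) \<and>
           P = transition_number c (\<beta> lam0) (\<alpha> lam0) a \<mm>"
proof -
  define d where "d = lowest_degree a"
  obtain N0 where N0: "2 \<le> N0" "N0 \<le> 2 * d - 1" "transition_number c (\<beta> lam0) (\<alpha> lam0) a N0 \<noteq> 0"
    using assms(5) by (auto simp: d_def)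
  have "\<exists>k l. 2 \<le> k + l \<and> a k l \<noteq> 0"
  proof (rule ccontr)
    assume "\<not> ?thesis"
    then have z: "\<And>k l. 2 \<le> k + l \<Longrightarrow> a k l = 0" by blast
    have "self_number c (\<alpha> lam0) a N0 = 0"
      unfolding self_number_def using z N0(1) by (auto intro!: sum.neutral)
    moreover have "cross_number c (\<beta> lam0) (\<alpha> lam0) a N0 = 0"
      unfolding cross_number_def by (rule infsum_0) (auto simp: cross_indices_def z)
    ultimately show False using N0(3) by (simp add: transition_number_def)
  qed
  then have ex: "\<exists>d. 2 \<le> d \<and> (\<exists>k l. k + l = d \<and> a k l \<noteq> 0)" by blast
  have d2: "2 \<le> d" unfolding d_def lowest_degree_def using LeastI_ex[OF ex] by blast
  have low: "a k l = 0" if "2 \<le> k + l" "k + l < d" for k l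
    using not_less_Least[of "k + l" "\<lambda>d. 2 \<le> d \<and> (\<exists>k l. k + l = d \<and> a k l \<noteq> 0)"] that
    unfolding d_def lowest_degree_def by blast
  interpret center_manifold_degree H1 "L lam0" "\<alpha> lam0" "\<beta> lam0" c a \<Phi> d
    using assms(1-4) d2 low
    by unfold_locales (auto simp: linear_operator_assms_def exchange_of_stabilities_def less_imp_neq)
  let ?T = "transition_number c (\<beta> lam0) (\<alpha> lam0) a"
  define M where "M = (LEAST N. 2 \<le> N \<and> ?T N \<noteq> 0)"
  have M: "2 \<le> M" "?T M \<noteq> 0"
    unfolding M_def using LeastI[of "\<lambda>N. 2 \<le> N \<and> ?T N \<noteq> 0" N0] N0 by blast+
  have below: "?T N = 0" if "2 \<le> N" "N < M" for N
    using not_less_Least that unfolding M_def by blast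
  have Md: "d \<le> M" using transition_number_low[of M] M by (meson not_le)
  have "M \<le> N0" unfolding M_def using N0 by (intro Least_le) blast
  then have M2: "M \<le> 2 * d - 1" using N0 by simp
  have "leading_term r M (?T M)"
    unfolding leading_term_def
  proof (intro conjI M)
    have "(\<lambda>s. r s - (\<Sum>N=d..2 * d - 1. ?T N * s ^ N)) \<in> O[at 0](\<lambda>s. s ^ (M + 1))"
      using M2 d2 by (intro landau_o.big_trans[OF transition_expansion power_bigo_at_0]) simp
    moreover have "(\<lambda>s. \<Sum>N=M+1..2 * d - 1. ?T N * s ^ N) \<in> O[at 0](\<lambda>s. s ^ (M + 1))"
    proof (rule big_sum_in_bigo)
      fix N assume "N \<in> {M+1..2 * d - 1}"
      then have "(\<lambda>s::real. s ^ N) \<in> O[at 0](\<lambda>s. s ^ (M + 1))" by (intro power_bigo_at_0) simp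
      then show "(\<lambda>s. ?T N * s ^ N) \<in> O[at 0](\<lambda>s. s ^ (M + 1))" by (cases "?T N = 0") auto
    qed
    ultimately have "(\<lambda>s. (r s - (\<Sum>N=d..2 * d - 1. ?T N * s ^ N)) + (\<Sum>N=M+1..2 * d - 1. ?T N * s ^ N))
        \<in> O[at 0](\<lambda>s. s ^ (M + 1))"
      by (rule sum_in_bigo)
    moreover have "(\<Sum>N=d..2 * d - 1. ?T N * s ^ N) = ?T M * s ^ M + (\<Sum>N=M+1..2 * d - 1. ?T N * s ^ N)" for s
    proof -
      have "(\<Sum>N=d..2 * d - 1. ?T N * s ^ N) = (\<Sum>N=M..2 * d - 1. ?T N * s ^ N)"
        using Md d2 below by (intro sum.mono_neutral_right) auto
      then show ?thesis using M2 by (simp add: sum.atLeast_Suc_atMost)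
    qed
    ultimately show "(\<lambda>s. r s - ?T M * s ^ M) \<in> O[at 0](\<lambda>s. s ^ (M + 1))"
      by (simp add: algebra_simps)
  qed
  moreover have "r = reduced_nonlinearity a (mode (\<alpha> lam0 c 1) c) \<Phi>"
    by (simp add: e_def \<alpha>\<^sub>c_def)
  ultimately have lead: "leading_term (reduced_nonlinearity a (mode (\<alpha> lam0 c 1) c) \<Phi>) M (?T M)"
    by simp
  show ?thesis
    using lead leading_term_unique[OF lead] unfolding M_def[symmetric] by blast
qed

end
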